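(* Fix one of the types A, B, D below, and let $u=1$ for type A and $u=\tfrac12$ for types B and D. Let $d=d(n)$ be positive integers with $d(n)=u\log n+a\sqrt{u\log n}+o(\sqrt{\log n})$ as $n\to\infty$ for some $a\in\mathbb{R}$. For each $n$ let $(\xi_1,\dots,\xi_n)$ be a tuple of random vectors in $\mathbb{R}^{d(n)}$ satisfying all assumptions of that type with $d=d(n)$, with associated convex hull $H_{n,d(n)}$. Then $$\lim_{n\to\infty}\mathbb{P}[0\notin H_{n,d(n)}]=\frac{1}{\sqrt{2\pi}}\int_{-\infty}^a e^{-t^2/2}\,dt.$$
   Context: For a tuple $(\xi_1,\dots,\xi_n)$ of random vectors in $\mathbb{R}^d$, put $S_k=\xi_1+\dots+\xi_k$ and $S_n^*=S_{n-1}-\xi_n$. Type A: $n\ge d+1$; the tuple is exchangeable ($(\xi_1,\dots,\xi_n)\stackrel{d}{=}(\xi_{\sigma(1)},\dots,\xi_{\sigma(n)})$ for all permutations $\sigma$); $S_n=0$ a.s.; any $d$ vectors among $S_1,\dots,S_{n-1}$ are linearly independent a.s.; $H_{n,d}=\mathrm{Conv}(S_1,\dots,S_{n-1})$. Type B: $n\ge d$; $(\xi_1,\dots,\xi_n)\stackrel{d}{=}(\varepsilon_1\xi_{\sigma(1)},\dots,\varepsilon_n\xi_{\sigma(n)})$ for all permutations $\sigma$ and all signs $\varepsilon_i\in\{-1,1\}$; any $d$ vectors among $S_1,\dots,S_n$ are linearly independent a.s.; $H_{n,d}=\mathrm{Conv}(S_1,\dots,S_n)$. Type D: $n\ge\max\{2,d\}$;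 the same invariance as type B but only for signs with $\varepsilon_1\cdots\varepsilon_n=1$; any $d$ vectors from either collection $S_1,\dots,S_n$ or $S_1,\dots,S_{n-1},S_n^*$ are linearly independent a.s.; $H_{n,d}=\mathrm{Conv}(S_1,\dots,S_n,S_n^* )$. *)

theory Defs
  imports "HOL-Probability.Probability" "HOL-Library.Landau_Symbols"
begin

text \<open>Conventions. A vector of R^d is represented by a function v :: nat => real of which
only the coordinates j < d are used (v j for j >= d is ignored everywhere).
A tuple (xi_1,...,xi_n) of random vectors on the probability space M is a function
X :: nat => 'a => nat => real, where X i is the i-th random vector (1 <= i <= n).\<close>

datatype refl_type = TypeA | TypeB | TypeD

definition u_const :: "refl_type \<Rightarrow> real" where
  "u_const T = (if T = TypeA then 1 else 1/2)"

definition psum :: "(nat \<Rightarrow> 'a \<Rightarrow> nat \<Rightarrow> real) \<Rightarrow> nat \<Rightarrow> 'a \<Rightarrow> nat \<Rightarrow> real" where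
  "psum X k \<omega> = (\<lambda>j. \<Sum>i\<in>{1..k}. X i \<omega> j)"

definition psum_star :: "(nat \<Rightarrow> 'a \<Rightarrow> nat \<Rightarrow> real) \<Rightarrow> nat \<Rightarrow> 'a \<Rightarrow> nat \<Rightarrow> real" where
  "psum_star X n \<omega> = (\<lambda>j. psum X (n - 1) \<omega> j - X n \<omega> j)"

definition lin_indep_fam :: "nat \<Rightarrow> (nat \<Rightarrow> nat \<Rightarrow> real) \<Rightarrow> nat set \<Rightarrow> bool" where
  "lin_indep_fam d v K \<longleftrightarrow>
     (\<forall>c :: nat \<Rightarrow> real. (\<forall>j<d. (\<Sum>k\<in>K. c k * v k j) = 0) \<longrightarrow> (\<forall>k\<in>K. c k = 0))"

definition any_d_indep :: "nat \<Rightarrow> (nat \<Rightarrow> nat \<Rightarrow> real) \<Rightarrow> nat set \<Rightarrow> bool" where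
  "any_d_indep d v I \<longleftrightarrow> (\<forall>K. K \<subseteq> I \<and> card K = d \<longrightarrow> lin_indep_fam d v K)"

definition zero_in_conv :: "nat \<Rightarrow> (nat \<Rightarrow> nat \<Rightarrow> real) \<Rightarrow> nat set \<Rightarrow> bool" where
  "zero_in_conv d v K \<longleftrightarrow>
     (\<exists>w :: nat \<Rightarrow> real. (\<forall>k\<in>K. w k \<ge> 0) \<and> (\<Sum>k\<in>K. w k) = 1 \<and>
        (\<forall>j<d. (\<Sum>k\<in>K. w k * v k j) = 0))"

definition tuple_law :: "'a measure \<Rightarrow> nat \<Rightarrow> nat \<Rightarrow> (nat \<Rightarrow> 'a \<Rightarrow> nat \<Rightarrow> real)
    \<Rightarrow> (nat \<times> nat \<Rightarrow> real) measure" where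
  "tuple_law M n d X =
     distr M (PiM ({1..n} \<times> {..<d}) (\<lambda>_. borel))
       (\<lambda>\<omega>. restrict (\<lambda>(i, j). X i \<omega> j) ({1..n} \<times> {..<d}))"

definition signed_perm :: "(nat \<Rightarrow> real) \<Rightarrow> (nat \<Rightarrow> nat) \<Rightarrow> (nat \<Rightarrow> 'a \<Rightarrow> nat \<Rightarrow> real)
    \<Rightarrow> nat \<Rightarrow> 'a \<Rightarrow> nat \<Rightarrow> real" where
  "signed_perm \<epsilon> \<sigma> X = (\<lambda>i \<omega> j. \<epsilon> i * X (\<sigma> i) \<omega> j)"

definition admissible_signs :: "refl_type \<Rightarrow> nat \<Rightarrow> (nat \<Rightarrow> real) \<Rightarrow> bool" where
  "admissible_signs T n \<epsilon> \<longleftrightarrow>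
     (\<forall>i\<in>{1..n}. \<epsilon> i \<in> {-1, 1}) \<and>
     (case T of
        TypeA \<Rightarrow> (\<forall>i\<in>{1..n}. \<epsilon> i = 1)
      | TypeB \<Rightarrow> True
      | TypeD \<Rightarrow> (\<Prod>i\<in>{1..n}. \<epsilon> i) = 1)"

definition hull_pts :: "refl_type \<Rightarrow> (nat \<Rightarrow> 'a \<Rightarrow> nat \<Rightarrow> real) \<Rightarrow> nat \<Rightarrow> 'a \<Rightarrow> nat \<Rightarrow> nat \<Rightarrow> real" where
  "hull_pts T X n \<omega> k = (if T = TypeD \<and> k = n + 1 then psum_star X n \<omega> else psum X k \<omega>)"

definition hull_idx :: "refl_type \<Rightarrow> nat \<Rightarrow> nat set" where
  "hull_idx T n = (case T of TypeA \<Rightarrow> {1..n-1} | TypeB \<Rightarrow> {1..n} | TypeD \<Rightarrow> {1..n+1})"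

definition type_assms :: "refl_type \<Rightarrow> nat \<Rightarrow> nat \<Rightarrow> 'a measure \<Rightarrow> (nat \<Rightarrow> 'a \<Rightarrow> nat \<Rightarrow> real) \<Rightarrow> bool" where
  "type_assms T n d M X \<longleftrightarrow>
     prob_space M \<and>
     (\<forall>i\<in>{1..n}. \<forall>j<d. (\<lambda>\<omega>. X i \<omega> j) \<in> borel_measurable M) \<and>
     (\<forall>\<sigma> \<epsilon>. \<sigma> permutes {1..n} \<and> admissible_signs T n \<epsilon> \<longrightarrow>
        tuple_law M n d X = tuple_law M n d (signed_perm \<epsilon> \<sigma> X)) \<and>
     (case T of
        TypeA \<Rightarrow> n \<ge> d + 1 \<and>
                 (AE \<omega> in M. \<forall>j<d. psum X n \<omega> j = 0) \<and>
                 (AE \<omega> in M. any_d_indep d (\<lambda>k. psum X k \<omega>) {1..n-1})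
      | TypeB \<Rightarrow> n \<ge> d \<and>
                 (AE \<omega> in M. any_d_indep d (\<lambda>k. psum X k \<omega>) {1..n})
      | TypeD \<Rightarrow> n \<ge> max 2 d \<and>
                 (AE \<omega> in M. any_d_indep d (\<lambda>k. psum X k \<omega>) {1..n} \<and>
                    any_d_indep d (\<lambda>k. if k = n then psum_star X n \<omega> else psum X k \<omega>) {1..n}))"

end

theory Submission
  imports Defs "HOL-Real_Asymp.Real_Asymp"
begin

text \<open>For a signed permutation \<open>g\<close> of the vectors, \<open>0\<close> lies in the hull of the partial sums iff the Weyl chamber
of \<open>g\<close> meets the kernel \<open>L\<close> of \<open>x \<mapsto> \<Sum>i. x i * \<xi> i\<close>; by invariance, the probability is the proportion of chambers
met by \<open>L\<close>. For generic \<open>L\<close> this proportion is deterministic. Indeed, over a fixed chamber in the first \<open>N\<close>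
coordinates, the number of positions that the last coordinate of \<open>x \<in> L\<close> can take among the thresholds
\<open>0, x j, - x j\<close> is one plus the number of thresholds that it can hit, so adding a coordinate gives
\<open>R (N + 1, d + 1) = R (N, d) + (1 + q N) R (N, d + 1)\<close>, with \<open>q = 1\<close> in type A, \<open>q = 2\<close> in type B and \<open>d\<close> the
codimension of \<open>L\<close>. Consequently \<open>P (0 \<notin> H) = P (Y < d)\<close>, where \<open>Y\<close> is a sum of independent Bernoulli variables with
parameters \<open>1 / (2 + q j)\<close>, \<open>1 \<le> j < N\<close>, and \<open>Y\<close> satisfies a central limit theorem with mean and variance \<open>ln N / q\<close>.
In type A one normalises \<open>x n = 0\<close>, so that \<open>N = n - 1\<close>. In type D the hull is the union of two type B hulls
that differ by the sign of the last step, and both contain \<open>0\<close> iff the hull of \<open>S 1, \<dots>, S (n - 1)\<close> does; hence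
\<open>P (0 \<notin> H)\<close> is twice the type B value for \<open>n\<close> minus the type B value for \<open>n - 1\<close>.\<close>

section \<open>Cells of a reflection arrangement\<close>

text \<open>The parameters \<open>1 / (2 + q * j)\<close> come from fibres: over a cell in
  \<open>j\<close> coordinates there are \<open>1 + q * j\<close> thresholds, hence
  \<open>2 + q * j\<close> positions for the next coordinate. The recursion closes because of
  codimension: forgetting the last coordinate of \<open>L\<close> lowers a positive codimension by
  one, while first intersecting \<open>L\<close> with the hyperplane of a threshold compensates for
  this; both results are again generic. Vectors are functions on all of \<open>nat\<close>, so that
  forgetting a coordinate changes \<open>N\<close> and not \<open>L\<close>.

  The method needs the order of the thresholds to be constant on a cell. In types A and B two
  thresholds cross only on a hyperplane of the arrangement. In type D the thresholds
  \<open>x j\<close> and \<open>- x j\<close> would cross at \<open>x j = 0\<close>, which is not a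
  wall; hence the detour through type B.

  Genericity of the random kernel requires independence of the partial sums for all signed
  permutations at once. The hypotheses speak of the given order only (in type D also with the last
  sign reversed); invariance transports them almost surely to each of the finitely many
  others.\<close>

text \<open>The label \<open>(s, i)\<close> stands for the threshold \<open>s * x i\<close>, and \<open>(0, 0)\<close> for the threshold \<open>0\<close>. The sign set
\<open>S\<close> is \<open>{1}\<close> in type A and \<open>{1, -1}\<close> in type B; the function \<open>below S N x\<close> encodes the cell of a regular \<open>x\<close>.\<close>

definition labels :: "real set \<Rightarrow> nat \<Rightarrow> (real \<times> nat) set" where
  "labels S N = insert (0, 0) (S \<times> {1..N})"

definition lval :: "(nat \<Rightarrow> real) \<Rightarrow> real \<times> nat \<Rightarrow> real" where
  "lval x l = fst l * x (snd l)"

definition below :: "real set \<Rightarrow> nat \<Rightarrow> (nat \<Rightarrow> real) \<Rightarrow> nat \<Rightarrow> (real \<times> nat) set" where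
  "below S N x = (\<lambda>i\<in>{1..N}. {l \<in> labels S (i - 1). lval x l < x i})"

definition regular :: "real set \<Rightarrow> nat \<Rightarrow> (nat \<Rightarrow> real) \<Rightarrow> bool" where
  "regular S N x \<longleftrightarrow> (\<forall>i\<in>{1..N}. \<forall>l\<in>labels S (i - 1). lval x l \<noteq> x i)"

definition cell_count :: "real set \<Rightarrow> nat \<Rightarrow> (nat \<Rightarrow> real) set \<Rightarrow> nat" where
  "cell_count S N L = card (below S N ` {x \<in> L. regular S N x})"

definition lin_subspace :: "(nat \<Rightarrow> real) set \<Rightarrow> bool" where
  "lin_subspace L \<longleftrightarrow> (\<lambda>i. 0) \<in> L \<and> (\<forall>x\<in>L. \<forall>y\<in>L. \<forall>a b. (\<lambda>i. a * x i + b * y i) \<in> L)"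

definition sign_set :: "real set \<Rightarrow> bool" where
  "sign_set S \<longleftrightarrow> S = {1} \<or> S = {1, -1}"

lemma linclD: "lin_subspace L \<Longrightarrow> x \<in> L \<Longrightarrow> y \<in> L \<Longrightarrow> (\<lambda>i. a * x i + b * y i) \<in> L"
  by (simp add: lin_subspace_def)

lemma lval_lin: "lval (\<lambda>i. a * x i + b * y i) l = a * lval x l + b * lval y l"
  by (simp add: lval_def algebra_simps)

lemma lval_cong: "l \<in> labels S N \<Longrightarrow> (\<And>i. i \<in> {1..N} \<Longrightarrow> x i = y i) \<Longrightarrow> lval x l = lval y l"
  by (auto simp: labels_def lval_def)

lemma finite_labels: "sign_set S \<Longrightarrow> finite (labels S N)"
  by (auto simp: labels_def sign_set_def)

lemma card_labels: "sign_set S \<Longrightarrow> card (labels S N) = 1 + card S * N"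
  by (auto simp: labels_def sign_set_def card_cartesian_product)

lemma below_PiE: "below S N x \<in> (\<Pi>\<^sub>E i\<in>{1..N}. Pow (labels S (i - 1)))"
  by (auto simp: below_def)

lemma finite_below: "sign_set S \<Longrightarrow> finite (below S N ` A)"
  by (rule finite_subset[of _ "\<Pi>\<^sub>E i\<in>{1..N}. Pow (labels S (i - 1))"])
     (use below_PiE in \<open>blast, auto intro!: finite_PiE simp: finite_labels\<close>)

lemma below_Suc: "below S (Suc N) x = (below S N x)(Suc N := {l \<in> labels S N. lval x l < x (Suc N)})"
  by (rule ext) (auto simp: below_def)

lemma below_Suc_eq_iff:
  "below S (Suc N) x = below S (Suc N) y \<longleftrightarrow>
     below S N x = below S N y \<and>
     {l \<in> labels S N. lval x l < x (Suc N)} = {l \<in> labels S N. lval y l < y (Suc N)}" (is "_ \<longleftrightarrow> ?R")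
proof
  assume h: "below S (Suc N) x = below S (Suc N) y"
  have "below S N x i = below S N y i" for i
    using fun_cong[OF h, of i] by (cases "i = Suc N") (auto simp: below_def split: if_splits)
  thus ?R using fun_cong[OF h, of "Suc N"] by (auto simp: below_Suc)
qed (simp add: below_Suc)

lemma regular_Suc:
  "regular S (Suc N) x \<longleftrightarrow> regular S N x \<and> (\<forall>l\<in>labels S N. lval x l \<noteq> x (Suc N))"
  by (auto simp: regular_def atLeastAtMostSuc_conv)

lemma below_eq_iff:
  "below S N x = below S N y \<longleftrightarrow>
     (\<forall>i\<in>{1..N}. \<forall>l\<in>labels S (i - 1). lval x l < x i \<longleftrightarrow> lval y l < y i)"
  (is "_ \<longleftrightarrow> ?R")
proof
  assume h: "below S N x = below S N y"
  show ?R
  proof (intro ballI)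
    fix i l assume i: "i \<in> {1..N}" and l: "l \<in> labels S (i - 1)"
    have "l \<in> below S N x i \<longleftrightarrow> l \<in> below S N y i" by (simp only: h)
    thus "lval x l < x i \<longleftrightarrow> lval y l < y i" unfolding below_def using i l by simp
  qed
next
  assume R: ?R
  show "below S N x = below S N y" unfolding below_def
  proof (rule restrict_ext, rule Collect_cong)
    fix i l assume "i \<in> {1..N}"
    thus "l \<in> labels S (i - 1) \<and> lval x l < x i \<longleftrightarrow> l \<in> labels S (i - 1) \<and> lval y l < y i"
      using R by blast
  qed
qed

section \<open>Order of the thresholds on a cell; cells are open convex cones\<close>

lemma sign_set_mult: "sign_set S \<Longrightarrow> s \<in> S \<Longrightarrow> t \<in> S \<Longrightarrow> s * t \<in> S"
  by (auto simp: sign_set_def)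

lemma sign_set_cases: "sign_set S \<Longrightarrow> s \<in> S \<Longrightarrow> s = 1 \<or> s = -1"
  by (auto simp: sign_set_def)

text \<open>Two thresholds compare like the coordinate of larger index against an earlier threshold:
  a sign is moved from one side to the other, which is why \<open>S\<close> has to be closed under
  products. If both labels carry the same index, their signs are opposite and the comparison is one
  with \<open>0\<close>.\<close>

lemma label_pair_cases:
  assumes S: "sign_set S" and l: "l \<in> labels S N" "l' \<in> labels S N" and ne: "l \<noteq> l'"
  obtains c m i where "c = 1 \<or> c = (-1::real)" "i \<in> {1..N}" "m \<in> labels S (i - 1)"
    "\<And>x. lval x l < lval x l' \<longleftrightarrow> c * (x i - lval x m) > 0"
    "\<And>x. lval x l = lval x l' \<longleftrightarrow> x i = lval x m"
proof -
  obtain s a where la: "l = (s, a)" by (cases l)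
  obtain t b where lb: "l' = (t, b)" by (cases l')
  have z: "(0,0) \<in> labels S k" for k by (simp add: labels_def)
  consider "l = (0,0)" "t \<in> S" "b \<in> {1..N}" | "l' = (0,0)" "s \<in> S" "a \<in> {1..N}"
    | "s \<in> S" "a \<in> {1..N}" "t \<in> S" "b \<in> {1..N}"
    using l ne la lb by (auto simp: labels_def)
  thus thesis
  proof cases
    case 1 thus thesis using that[of t b "(0,0)"] z sign_set_cases[OF S 1(2)] lb
      by (auto simp: lval_def)
  next
    case 2 thus thesis using that[of "-s" a "(0,0)"] z sign_set_cases[OF S 2(2)] la
      by (auto simp: lval_def)
  next
    case 3
    note sc = sign_set_cases[OF S 3(1)] sign_set_cases[OF S 3(3)]
    have m: "s * t \<in> S" using S 3 sign_set_mult by blast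
    consider "a < b" | "b < a" | "a = b" by linarith
    thus thesis
    proof cases
      case 1
      hence "(s * t, a) \<in> labels S (b - 1)" using m 3 by (auto simp: labels_def)
      moreover have "lval x l < lval x l' \<longleftrightarrow> t * (x b - lval x (s * t, a)) > 0"
        "lval x l = lval x l' \<longleftrightarrow> x b = lval x (s * t, a)" for x
        using sc la lb by (auto simp: lval_def)
      ultimately show thesis using that[of t b "(s * t, a)"] 3 sc by blast
    next
      case 2
      hence "(s * t, b) \<in> labels S (a - 1)" using m 3 by (auto simp: labels_def)
      moreover have "lval x l < lval x l' \<longleftrightarrow> - s * (x a - lval x (s * t, b)) > 0"
        "lval x l = lval x l' \<longleftrightarrow> x a = lval x (s * t, b)" for x
        using sc la lb by (auto simp: lval_def)
      moreover have "- s = 1 \<or> - s = -1" using sc by auto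
      ultimately show thesis using that[of "-s" a "(s * t, b)"] 3 by blast
    next
      case 3
      hence "s = - t" using ne la lb sc by auto
      thus thesis using that[of t b "(0,0)"] z sc la lb 3 \<open>b \<in> {1..N}\<close>
        by (auto simp: lval_def)
    qed
  qed
qed

lemma regular_inj_on: "sign_set S \<Longrightarrow> regular S N x \<Longrightarrow> inj_on (lval x) (labels S N)"
  by (rule inj_onI, rule ccontr, erule label_pair_cases, assumption+) (metis regular_def)

text \<open>A cell records only comparisons of a coordinate with thresholds of smaller index, but by
  \<open>label_pair_cases\<close> these decide every comparison between two thresholds.\<close>

lemma below_eq_order:
  assumes S: "sign_set S" and r: "regular S N x" "regular S N y" and e: "below S N x = below S N y"
    and l: "l \<in> labels S N" "l' \<in> labels S N"
  shows "lval x l < lval x l' \<longleftrightarrow> lval y l < lval y l'"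
proof (cases "l = l'")
  case False
  show ?thesis
  proof (rule label_pair_cases[OF S l False])
    fix c :: real and m i
    assume c: "c = 1 \<or> c = -1" "i \<in> {1..N}" "m \<in> labels S (i - 1)"
      and eq: "\<And>x. lval x l < lval x l' \<longleftrightarrow> c * (x i - lval x m) > 0"
    have "lval x m < x i \<longleftrightarrow> lval y m < y i" using e c(2,3) by (auto simp: below_eq_iff)
    moreover have "lval x m \<noteq> x i" "lval y m \<noteq> y i" using r c(2,3) by (auto simp: regular_def)
    ultimately show ?thesis unfolding eq using c(1) by (elim disjE) auto
  qed
qed simp

text \<open>Every recorded comparison is a strict homogeneous linear inequality, so cells are cones
  and the positive weights need no normalisation.\<close>

lemma cell_convex:
  assumes r: "regular S N x" "regular S N y" and e: "below S N x = below S N y" and ab: "a > 0" "b > 0"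
  shows "regular S N (\<lambda>i. a * x i + b * y i)" "below S N (\<lambda>i. a * x i + b * y i) = below S N x"
proof -
  have *: "(a * lval x l + b * lval y l < a * x i + b * y i \<longleftrightarrow> lval x l < x i)
       \<and> a * lval x l + b * lval y l \<noteq> a * x i + b * y i"
    if "i \<in> {1..N}" "l \<in> labels S (i - 1)" for i l
  proof -
    have h: "lval x l < x i \<longleftrightarrow> lval y l < y i" "lval x l \<noteq> x i" "lval y l \<noteq> y i"
      using that r e by (auto simp: below_eq_iff regular_def)
    show ?thesis
    proof (cases "lval x l < x i")
      case True
      hence "a * lval x l < a * x i" "b * lval y l < b * y i" using h ab by auto
      thus ?thesis using True by linarith
    next
      case False
      hence "a * lval x l > a * x i" "b * lval y l > b * y i" using h ab by auto
      thus ?thesis using False by linarith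
    qed
  qed
  show "regular S N (\<lambda>i. a * x i + b * y i)" using * by (auto simp: regular_def lval_lin)
  show "below S N (\<lambda>i. a * x i + b * y i) = below S N x"
    using * by (auto simp: below_eq_iff lval_lin)
qed

lemma eventually_lval_side:
  assumes ne: "lval x l \<noteq> x i"
  shows "\<forall>\<^sub>F \<delta> in at_right 0. (lval (\<lambda>i. x i + \<delta> * y i) l < x i + \<delta> * y i \<longleftrightarrow> lval x l < x i) \<and>
    lval (\<lambda>i. x i + \<delta> * y i) l \<noteq> x i + \<delta> * y i"
proof -
  have t: "((\<lambda>\<delta>. lval (\<lambda>i. x i + \<delta> * y i) l - (x i + \<delta> * y i)) \<longlongrightarrow> lval x l - x i) (at_right 0)"
    unfolding lval_def by (auto intro!: tendsto_eq_intros)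
  show ?thesis
  proof (cases "lval x l < x i")
    case True
    have "\<forall>\<^sub>F \<delta> in at_right 0. lval (\<lambda>i. x i + \<delta> * y i) l - (x i + \<delta> * y i) < 0"
      using order_tendstoD(2)[OF t, of 0] True by simp
    thus ?thesis by eventually_elim (use True in auto)
  next
    case False
    have "\<forall>\<^sub>F \<delta> in at_right 0. lval (\<lambda>i. x i + \<delta> * y i) l - (x i + \<delta> * y i) > 0"
      using order_tendstoD(1)[OF t, of 0] False ne by simp
    thus ?thesis by eventually_elim (use False in auto)
  qed
qed

text \<open>Cells are open: finitely many strict inequalities survive a small step in any
  direction.\<close>

lemma eventually_below:
  assumes "sign_set S" "regular S N x"
  shows "\<forall>\<^sub>F \<delta> in at_right 0. regular S N (\<lambda>i. x i + \<delta> * y i) \<and> below S N (\<lambda>i. x i + \<delta> * y i) = below S N x"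
proof -
  have "\<forall>\<^sub>F \<delta> in at_right 0. \<forall>i\<in>{1..N}. \<forall>l\<in>labels S (i - 1).
      (lval (\<lambda>i. x i + \<delta> * y i) l < x i + \<delta> * y i \<longleftrightarrow> lval x l < x i) \<and>
      lval (\<lambda>i. x i + \<delta> * y i) l \<noteq> x i + \<delta> * y i"
    using assms by (intro eventually_ball_finite ballI eventually_lval_side) (auto simp: finite_labels regular_def)
  thus ?thesis by eventually_elim (auto simp: regular_def below_eq_iff)
qed

text \<open>On a cell the thresholds are linearly ordered and do not cross, so the positions of the last coordinate form an
interval, and two consecutive positions both occur iff the threshold between them is hit.\<close>

lemma card_positions:
  assumes S: "sign_set S" and L: "lin_subspace L" and pr: "\<And>l. l \<in> labels S N \<Longrightarrow> \<exists>y\<in>L. lval y l \<noteq> y (Suc N)"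
    and c: "c \<in> below S N ` {x \<in> L. regular S N x}"
  shows "card ((\<lambda>x. {l \<in> labels S N. lval x l < x (Suc N)}) `
            {x \<in> L. regular S (Suc N) x \<and> below S N x = c})
       = 1 + card {l \<in> labels S N. \<exists>x\<in>L. regular S N x \<and> below S N x = c \<and> lval x l = x (Suc N)}"
proof -
  define D where "D = (\<lambda>x. {l \<in> labels S N. lval x l < x (Suc N)})"
  define Q where "Q = {x \<in> L. regular S N x \<and> below S N x = c}"
  define P where "P = D ` {x \<in> Q. \<forall>l\<in>labels S N. lval x l \<noteq> x (Suc N)}"
  define J where "J = {l \<in> labels S N. \<exists>x\<in>Q. lval x l = x (Suc N)}"
  obtain x0 where x0: "x0 \<in> Q" using c by (auto simp: Q_def)
  \<comment> \<open>If the last coordinate lies just above the threshold \<open>l\<close>, then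
    exactly \<open>up l\<close> is below it; just under the threshold it is
    \<open>up l - {l}\<close>. The order at the single point \<open>x0\<close> stands for the order
    at every point of \<open>Q\<close>.\<close>
  define up where "up = (\<lambda>l. {l' \<in> labels S N. lval x0 l' \<le> lval x0 l})"
  have fin: "finite (labels S N)" using S by (rule finite_labels)
  have ord: "lval x l < lval x l' \<longleftrightarrow> lval x0 l < lval x0 l'"
    if "x \<in> Q" "l \<in> labels S N" "l' \<in> labels S N" for x l l'
    using below_eq_order[OF S, of N x x0 l l'] that x0 by (auto simp: Q_def)
  have inj: "inj_on (lval x) (labels S N)" if "x \<in> Q" for x
    using regular_inj_on[OF S] that by (auto simp: Q_def)
  have pert: "\<exists>z\<in>Q. (\<forall>l'\<in>labels S N. lval z l' \<noteq> z (Suc N)) \<and>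
       D z = (if b then up l else up l - {l})"
    if l: "l \<in> J" for l b
  proof -
    obtain x where x: "x \<in> Q" "lval x l = x (Suc N)" and lN: "l \<in> labels S N" using l by (auto simp: J_def)
    obtain y0 where y0: "y0 \<in> L" "lval y0 l \<noteq> y0 (Suc N)" using pr lN by blast
    \<comment> \<open>A direction of \<open>L\<close> that leaves the hyperplane of
      \<open>l\<close>; negating it reaches the side prescribed by \<open>b\<close>.\<close>
    define y where "y = (if (lval y0 l < y0 (Suc N)) = b then y0 else (\<lambda>i. (-1) * y0 i + 0 * y0 i))"
    have yL: "y \<in> L" using y0 linclD[OF L y0(1) y0(1), of "-1" 0] by (auto simp: y_def)
    have y: "(lval y l < y (Suc N)) = b" "lval y l \<noteq> y (Suc N)"
      using y0 lval_lin[of "-1" y0 0 y0 l] by (auto simp: y_def)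
    let ?z = "\<lambda>\<delta> i. x i + \<delta> * y i"
    let ?W = "\<lambda>\<delta>. \<forall>l'\<in>labels S N - {l}. (lval (?z \<delta>) l' < ?z \<delta> (Suc N) \<longleftrightarrow> lval x l' < x (Suc N)) \<and>
      lval (?z \<delta>) l' \<noteq> ?z \<delta> (Suc N)"
    \<comment> \<open>Distinct labels have distinct values at a regular point, so \<open>x\<close>
      hits no second threshold and a small step crosses none.\<close>
    have "lval x l' \<noteq> x (Suc N)" if "l' \<in> labels S N - {l}" for l'
      using inj[OF x(1)] that lN x(2) by (auto simp: inj_on_def)
    hence "\<forall>\<^sub>F \<delta> in at_right 0. ?W \<delta>"
      using fin by (intro eventually_ball_finite ballI eventually_lval_side) auto
    moreover have "\<forall>\<^sub>F \<delta> in at_right 0. (\<delta>::real) > 0" by (rule eventually_at_right_less)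
    moreover have "\<forall>\<^sub>F \<delta> in at_right 0. regular S N (\<lambda>i. x i + \<delta> * y i) \<and> below S N (\<lambda>i. x i + \<delta> * y i) = below S N x"
      using eventually_below[OF S] x(1) by (auto simp: Q_def)
    ultimately have "\<forall>\<^sub>F \<delta> in at_right 0. ?W \<delta> \<and> \<delta> > 0 \<and> regular S N (?z \<delta>) \<and> below S N (?z \<delta>) = below S N x"
      by eventually_elim blast
    then obtain \<delta> where W: "?W \<delta>" and d: "\<delta> > 0" "regular S N (?z \<delta>)" "below S N (?z \<delta>) = below S N x"
      using eventually_happens'[OF trivial_limit_at_right_real] by blast
    have d2: "(lval (?z \<delta>) l' < ?z \<delta> (Suc N) \<longleftrightarrow> lval x l' < x (Suc N)) \<and> lval (?z \<delta>) l' \<noteq> ?z \<delta> (Suc N)"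
      if "l' \<in> labels S N" "l' \<noteq> l" for l'
      using W that by blast
    define z where "z = (\<lambda>i. x i + \<delta> * y i)"
    have "z \<in> L" using linclD[OF L _ yL, of x 1 \<delta>] x(1) by (simp add: z_def Q_def)
    hence zQ: "z \<in> Q" using d x(1) by (auto simp: Q_def z_def)
    have zl: "lval z l - z (Suc N) = \<delta> * (lval y l - y (Suc N))"
      using x(2) lval_lin[of 1 x \<delta> y l] by (simp add: z_def algebra_simps)
    have zl1: "lval z l \<noteq> z (Suc N)" using zl y d(1) by auto
    have zl2: "lval z l < z (Suc N) \<longleftrightarrow> b"
    proof -
      have "lval z l < z (Suc N) \<longleftrightarrow> \<delta> * (lval y l - y (Suc N)) < 0" using zl by linarith
      also have "\<dots> \<longleftrightarrow> b" using d(1) y(1) by (simp add: mult_less_0_iff)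
      finally show ?thesis .
    qed
    have 1: "lval z l' \<noteq> z (Suc N)" if "l' \<in> labels S N" for l'
      using d2[OF that] zl1 by (cases "l' = l") (auto simp: z_def)
    have 2: "lval z l' < z (Suc N) \<longleftrightarrow> (if b then lval x0 l' \<le> lval x0 l else lval x0 l' \<le> lval x0 l \<and> l' \<noteq> l)" if "l' \<in> labels S N" for l'
    proof (cases "l' = l")
      case False
      have "lval z l' < z (Suc N) \<longleftrightarrow> lval x l' < lval x l" using d2[OF that False] x(2) by (simp add: z_def)
      also have "\<dots> \<longleftrightarrow> lval x0 l' < lval x0 l" using ord[OF x(1) that lN] .
      also have "\<dots> \<longleftrightarrow> lval x0 l' \<le> lval x0 l"
        using inj[OF x0] that lN False by (auto simp: inj_on_def order_le_less)
      finally show ?thesis using False by auto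
    qed (use zl2 in auto)
    show ?thesis using zQ 1 2 by (intro bexI[of _ z]) (auto simp: D_def up_def)
  qed
  have Pne: "P \<noteq> {}"
  proof (cases "\<exists>l\<in>labels S N. lval x0 l = x0 (Suc N)")
    case True
    then obtain l where "l \<in> J" using x0 by (auto simp: J_def)
    from pert[OF this, of True] show ?thesis by (auto simp: P_def)
  qed (use x0 in \<open>auto simp: P_def\<close>)
  have finP: "finite P" by (rule finite_subset[of _ "Pow (labels S N)"]) (auto simp: P_def D_def fin)
  \<comment> \<open>Positions are down-sets of a chain, so the one of least cardinality is the
    lowest. Every other position is matched with its highest threshold; the unmatched
    \<open>Dm\<close> is the \<open>1\<close> in the formula.\<close>
  define Dm where "Dm = arg_min_on card P"
  have Dm: "Dm \<in> P" "\<And>E. E \<in> P \<Longrightarrow> card Dm \<le> card E"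
    using arg_min_if_finite[OF finP Pne, of card] unfolding Dm_def by (auto simp: not_less)
  have lower: "l' \<in> E" if "E \<in> P" "l \<in> E" "l' \<in> labels S N" "lval x0 l' \<le> lval x0 l" for E l l'
  proof -
    obtain x where x: "x \<in> Q" "E = D x" using \<open>E \<in> P\<close> unfolding P_def by blast
    have "\<not> lval x0 l < lval x0 l'" using that by simp
    hence "\<not> lval x l < lval x l'" using ord[OF x(1), of l l'] that x by (auto simp: D_def)
    thus ?thesis using that x by (auto simp: D_def)
  qed
  have subP: "E \<subseteq> labels S N" if "E \<in> P" for E using that by (auto simp: P_def D_def)
  have finE: "finite E" if "E \<in> P" for E using subP[OF that] fin finite_subset by blast
  have img: "up ` J = P - {Dm}"
  proof (intro equalityI subsetI)
    fix E assume "E \<in> up ` J"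
    then obtain l where l: "l \<in> J" "E = up l" by auto
    have lN: "l \<in> labels S N" using l by (auto simp: J_def)
    have "up l \<in> P" using pert[OF l(1), of True] by (auto simp: P_def)
    moreover have "up l - {l} \<in> P" using pert[OF l(1), of False] by (auto simp: P_def)
    moreover have "card (up l - {l}) < card (up l)"
      using lN fin by (intro psubset_card_mono) (auto simp: up_def)
    ultimately show "E \<in> P - {Dm}" using Dm(2)[of "up l - {l}"] l(2) by auto
  next
    fix E assume E: "E \<in> P - {Dm}"
    have ns: "\<not> E \<subseteq> Dm"
    proof
      assume "E \<subseteq> Dm"
      moreover have "card Dm \<le> card E" using Dm E by auto
      ultimately have "E = Dm" using finE[OF Dm(1)] by (simp add: card_seteq)
      thus False using E by auto
    qed
    have finE': "finite (lval x0 ` E)" "lval x0 ` E \<noteq> {}" using finE E ns by auto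
    obtain l where l: "l \<in> E" "lval x0 l = Max (lval x0 ` E)" using Max_in[OF finE'] by auto
    have lm: "lval x0 l' \<le> lval x0 l" if "l' \<in> E" for l' using l(2) that finE'(1) by simp
    have lN: "l \<in> labels S N" using l E subP by auto
    have EP: "E \<in> P" using E by auto
    have Eup: "E = up l" using lower[OF EP l(1)] lm subP[OF EP] by (auto simp: up_def)
    have lD: "l \<notin> Dm"
    proof
      assume "l \<in> Dm"
      hence "E \<subseteq> Dm" using lower[OF Dm(1)] lm subP[OF EP] by blast
      thus False using ns by simp
    qed
    obtain x where x: "x \<in> Q" "E = D x" using EP unfolding P_def by blast
    obtain y where y: "y \<in> Q" "Dm = D y" "\<forall>l\<in>labels S N. lval y l \<noteq> y (Suc N)"
      using Dm(1) unfolding P_def by blast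
    \<comment> \<open>Weights for which \<open>lval z l - z (Suc N)\<close> cancels: this difference
      is negative at \<open>x\<close>, where \<open>l\<close> is below, and positive at
      \<open>y\<close>, where it is above.\<close>
    define a where "a = lval y l - y (Suc N)"
    define b where "b = x (Suc N) - lval x l"
    have ab: "a > 0" "b > 0" using x y l(1) lD lN unfolding a_def b_def
      by (auto simp: D_def less_le)
    define z where "z = (\<lambda>i. a * x i + b * y i)"
    have "z \<in> L" using linclD[OF L, of x y a b] x y by (simp add: z_def Q_def)
    moreover have "regular S N z" "below S N z = below S N x"
      unfolding z_def using cell_convex[of S N x y a b] x y ab by (auto simp: Q_def)
    moreover have "lval z l = z (Suc N)"
      using lval_lin[of a x b y l] by (simp add: z_def a_def b_def algebra_simps)
    ultimately have "l \<in> J" using x lN by (auto simp: J_def Q_def)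
    thus "E \<in> up ` J" using Eup by blast
  qed
  have "inj_on up J"
  proof (rule inj_onI)
    fix l l' assume h: "l \<in> J" "l' \<in> J" "up l = up l'"
    have "l \<in> up l" "l' \<in> up l'" using h by (auto simp: up_def J_def)
    hence "l \<in> up l'" "l' \<in> up l" using h(3) by auto
    hence "lval x0 l = lval x0 l'" by (auto simp: up_def)
    thus "l = l'" using inj[OF x0] h by (auto simp: inj_on_def J_def)
  qed
  hence "card J = card (P - {Dm})" using card_image img by metis
  also have "\<dots> = card P - 1" using Dm(1) finP by simp
  finally have "card P = 1 + card J" using Dm(1) finP by (metis Suc_pred' card_gt_0_iff empty_iff plus_1_eq_Suc)
  moreover have "P = D ` {x \<in> L. regular S (Suc N) x \<and> below S N x = c}"
    by (auto simp: P_def Q_def regular_Suc)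
  moreover have "J = {l \<in> labels S N. \<exists>x\<in>L. regular S N x \<and> below S N x = c \<and> lval x l = x (Suc N)}"
    by (auto simp: J_def Q_def)
  ultimately show ?thesis by (simp add: D_def)
qed

text \<open>Double counting of pairs of a cell and a threshold that is hit over it. Grouped by
  cells, the pairs give the excess found in \<open>card_positions\<close>; grouped by thresholds,
  they count the cells met by the hyperplane sections of \<open>L\<close>.\<close>

lemma cell_count_Suc:
  assumes S: "sign_set S" and L: "lin_subspace L" and pr: "\<And>l. l \<in> labels S N \<Longrightarrow> \<exists>y\<in>L. lval y l \<noteq> y (Suc N)"
  shows "cell_count S (Suc N) L = cell_count S N L + (\<Sum>l\<in>labels S N. cell_count S N {x \<in> L. lval x l = x (Suc N)})"
proof -
  define R where "R = below S N ` {x \<in> L. regular S N x}"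
  define D where "D = (\<lambda>x. {l \<in> labels S N. lval x l < x (Suc N)})"
  define P where "P = (\<lambda>c. D ` {x \<in> L. regular S (Suc N) x \<and> below S N x = c})"
  define J where "J = (\<lambda>c. {l \<in> labels S N. \<exists>x\<in>L. regular S N x \<and> below S N x = c \<and> lval x l = x (Suc N)})"
  define K where "K = (\<lambda>l. below S N ` {x \<in> {x \<in> L. lval x l = x (Suc N)}. regular S N x})"
  have fR: "finite R" using finite_below[OF S] by (simp add: R_def)
  have fl: "finite (labels S N)" using finite_labels[OF S] .
  have fP: "finite (P c)" for c
    by (rule finite_subset[of _ "Pow (labels S N)"]) (auto simp: P_def D_def fl)
  have "bij_betw (\<lambda>(c, E). c(Suc N := E)) (Sigma R P) (below S (Suc N) ` {x \<in> L. regular S (Suc N) x})"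
    unfolding bij_betw_def
  proof
    show "inj_on (\<lambda>(c, E). c(Suc N := E)) (Sigma R P)"
    proof (rule inj_onI, clarify)
      fix c E c' E' assume h: "c \<in> R" "E \<in> P c" "c' \<in> R" "E' \<in> P c'" "c(Suc N := E) = c'(Suc N := E')"
      obtain x where x: "c = below S N x" "E = D x" using h by (auto simp: P_def)
      obtain y where y: "c' = below S N y" "E' = D y" using h by (auto simp: P_def)
      have "below S (Suc N) x = below S (Suc N) y" using h x y by (simp add: below_Suc D_def)
      thus "c = c' \<and> E = E'" using x y by (simp add: below_Suc_eq_iff D_def)
    qed
    show "(\<lambda>(c, E). c(Suc N := E)) ` Sigma R P = below S (Suc N) ` {x \<in> L. regular S (Suc N) x}"
    proof (intro equalityI subsetI)
      fix f assume "f \<in> below S (Suc N) ` {x \<in> L. regular S (Suc N) x}"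
      then obtain x where x: "x \<in> L" "regular S (Suc N) x" "f = below S (Suc N) x" by auto
      hence "(below S N x, D x) \<in> Sigma R P" by (auto simp: R_def P_def regular_Suc)
      thus "f \<in> (\<lambda>(c, E). c(Suc N := E)) ` Sigma R P"
        using x by (intro image_eqI[of _ _ "(below S N x, D x)"]) (auto simp: below_Suc D_def)
    qed (auto simp: P_def D_def below_Suc)
  qed
  hence "cell_count S (Suc N) L = card (Sigma R P)" unfolding cell_count_def by (rule bij_betw_same_card[symmetric])
  also have "\<dots> = (\<Sum>c\<in>R. card (P c))" using fR fP by (intro card_SigmaI) auto
  also have "\<dots> = (\<Sum>c\<in>R. 1 + card (J c))"
    unfolding P_def J_def D_def by (intro sum.cong refl card_positions[OF S L pr]) (simp_all add: R_def)
  also have "\<dots> = card R + (\<Sum>c\<in>R. card (J c))" by (simp only: sum.distrib card_eq_sum)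
  also have "(\<Sum>c\<in>R. card (J c)) = card (Sigma R J)"
    using fR fl by (intro card_SigmaI[symmetric]) (auto simp: J_def)
  also have "\<dots> = card (Sigma (labels S N) K)"
  proof (rule bij_betw_same_card[of prod.swap], unfold bij_betw_def, rule conjI)
    show "inj_on prod.swap (Sigma R J)" by (auto simp: inj_on_def)
    have "c \<in> R \<and> l \<in> J c \<longleftrightarrow> l \<in> labels S N \<and> c \<in> K l" for c l
    proof
      assume "c \<in> R \<and> l \<in> J c"
      then obtain x where "x \<in> L" "regular S N x" "below S N x = c" "lval x l = x (Suc N)" "l \<in> labels S N"
        unfolding J_def by blast
      thus "l \<in> labels S N \<and> c \<in> K l" unfolding K_def by auto
    next
      assume "l \<in> labels S N \<and> c \<in> K l"
      then obtain x where "x \<in> L" "regular S N x" "below S N x = c" "lval x l = x (Suc N)" "l \<in> labels S N"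
        unfolding K_def by auto
      thus "c \<in> R \<and> l \<in> J c" unfolding R_def J_def by auto
    qed
    note mem = this
    show "prod.swap ` Sigma R J = Sigma (labels S N) K"
    proof (intro equalityI subsetI)
      fix p assume "p \<in> prod.swap ` Sigma R J"
      then obtain c l where p: "p = (l, c)" "c \<in> R \<and> l \<in> J c" by auto
      show "p \<in> Sigma (labels S N) K" using mem[of c l] p by simp
    next
      fix p assume "p \<in> Sigma (labels S N) K"
      then obtain c l where p: "p = (l, c)" "l \<in> labels S N \<and> c \<in> K l" by auto
      show "p \<in> prod.swap ` Sigma R J" using mem[of c l] p by (intro image_eqI[of _ _ "(c, l)"]) auto
    qed
  qed
  also have "\<dots> = (\<Sum>l\<in>labels S N. card (K l))"
    using fl finite_below[OF S] by (intro card_SigmaI) (auto simp: K_def)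
  finally show ?thesis by (simp add: cell_count_def R_def K_def)
qed

section \<open>Generic subspaces\<close>

text \<open>Intersections of hyperplanes of the arrangement, graded by dimension; the sets are cylinders over the first \<open>N\<close>
coordinates. A generic subspace of codimension \<open>d\<close> is complementary to every flat of dimension \<open>d\<close>.\<close>

inductive flat :: "real set \<Rightarrow> nat \<Rightarrow> nat \<Rightarrow> (nat \<Rightarrow> real) set \<Rightarrow> bool" for S where
  flat_0: "flat S 0 0 UNIV"
| flat_free: "flat S N k F \<Longrightarrow> flat S (Suc N) (Suc k) F"
| flat_eq: "flat S N k F \<Longrightarrow> l \<in> labels S N \<Longrightarrow> flat S (Suc N) k {x \<in> F. x (Suc N) = lval x l}"

definition generic :: "real set \<Rightarrow> nat \<Rightarrow> nat \<Rightarrow> (nat \<Rightarrow> real) set \<Rightarrow> bool" where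
  "generic S N d L \<longleftrightarrow> lin_subspace L \<and> (\<forall>F. flat S N d F \<longrightarrow>
     (\<forall>x\<in>F \<inter> L. \<forall>i\<in>{1..N}. x i = 0) \<and>
     (\<forall>z. \<exists>f\<in>F. \<exists>y\<in>L. \<forall>i\<in>{1..N}. z i = f i + y i))"

lemma flat_cong: "flat S N k F \<Longrightarrow> x \<in> F \<Longrightarrow> (\<And>i. i \<in> {1..N} \<Longrightarrow> x i = y i) \<Longrightarrow> y \<in> F"
proof (induction arbitrary: x y rule: flat.induct)
  case (flat_eq N k F l)
  have "y \<in> F" using flat_eq.IH[of x y] flat_eq.prems by auto
  moreover have "lval x l = lval y l" using flat_eq.hyps(2) flat_eq.prems(2) by (intro lval_cong) auto
  ultimately show ?case using flat_eq.prems by auto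
qed auto

lemma zero_label: "(0, 0) \<in> labels S N"
  by (simp add: labels_def)

lemma flat_exists: "k \<le> N \<Longrightarrow> \<exists>F. flat S N k F"
proof (induction N arbitrary: k)
  case 0 thus ?case by (auto intro: flat_0)
next
  case (Suc N)
  show ?case
  proof (cases k)
    case 0
    thus ?thesis using Suc.IH[of 0] flat_eq[OF _ zero_label] by blast
  next
    case (Suc k')
    thus ?thesis using Suc.IH[of k'] Suc.prems flat_free by blast
  qed
qed

lemma flat_0_zero: "flat S N k F \<Longrightarrow> k = 0 \<Longrightarrow> x \<in> F \<Longrightarrow> i \<in> {1..N} \<Longrightarrow> x i = 0"
proof (induction arbitrary: i rule: flat.induct)
  case (flat_eq N k F l)
  have z: "x j = 0" if "j \<in> {1..N}" for j using flat_eq.IH[of j] flat_eq.prems that by auto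
  hence "lval x l = 0" using flat_eq.hyps(2) by (auto simp: lval_def labels_def)
  thus ?case using flat_eq.prems z by (cases "i = Suc N") auto
qed auto

lemma generic_lin_subspace: "generic S N d L \<Longrightarrow> lin_subspace L"
  by (simp add: generic_def)

lemma generic_zero: "generic S N d L \<Longrightarrow> flat S N d F \<Longrightarrow> x \<in> F \<Longrightarrow> x \<in> L \<Longrightarrow> i \<in> {1..N} \<Longrightarrow> x i = 0"
  unfolding generic_def by blast

lemma generic_split:
  assumes "generic S N d L" "flat S N d F"
  obtains f y where "f \<in> F" "y \<in> L" "\<And>i. i \<in> {1..N} \<Longrightarrow> z i = f i + y i"
  using assms unfolding generic_def by blast

lemma genI:
  assumes "lin_subspace L"
    "\<And>F x i. flat S N d F \<Longrightarrow> x \<in> F \<Longrightarrow> x \<in> L \<Longrightarrow> i \<in> {1..N} \<Longrightarrow> x i = 0"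
    "\<And>F z. flat S N d F \<Longrightarrow> \<exists>f\<in>F. \<exists>y\<in>L. \<forall>i\<in>{1..N}. z i = f i + y i"
  shows "generic S N d L"
  using assms unfolding generic_def by blast

text \<open>A flat in \<open>N\<close> coordinates is also a flat in \<open>Suc N\<close>
  coordinates with the last one free, one dimension higher. Complementarity to the latter, read on
  the first \<open>N\<close> coordinates, is complementarity to the former.\<close>

lemma generic_free: 
  assumes g: "generic S (Suc N) (Suc d) L" shows "generic S N d L"
proof (rule genI)
  show "lin_subspace L" using g by (rule generic_lin_subspace)
next
  fix F x i assume "flat S N d F" "x \<in> F" "x \<in> L" "i \<in> {1..N}"
  thus "x i = 0" using generic_zero[OF g flat_free, of F x i] by auto
next
  fix F z assume F: "flat S N d F"
  obtain f y where "f \<in> F" "y \<in> L" "\<And>i. i \<in> {1..Suc N} \<Longrightarrow> z i = f i + y i"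
    using generic_split[OF g flat_free[OF F], of z] by blast
  thus "\<exists>f\<in>F. \<exists>y\<in>L. \<forall>i\<in>{1..N}. z i = f i + y i" by (intro bexI[of _ f] bexI[of _ y]) auto
qed

lemma lin_subspace_hyperplane: "lin_subspace L \<Longrightarrow> lin_subspace {x \<in> L. lval x l = x i}"
  by (auto simp: lin_subspace_def lval_lin) (simp add: lval_def)

lemma generic_eq:
  assumes g: "generic S (Suc N) d L" and l: "l \<in> labels S N"
  shows "generic S N d {x \<in> L. lval x l = x (Suc N)}"
proof (rule genI)
  show "lin_subspace {x \<in> L. lval x l = x (Suc N)}" using generic_lin_subspace[OF g] by (rule lin_subspace_hyperplane)
next
  fix F x i assume "flat S N d F" "x \<in> F" "x \<in> {x \<in> L. lval x l = x (Suc N)}" "i \<in> {1..N}"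
  thus "x i = 0" using generic_zero[OF g flat_eq[OF _ l], of F x i] by auto
next
  fix F z assume F: "flat S N d F"
  \<comment> \<open>Lift \<open>z\<close> into the hyperplane of \<open>l\<close>; since the part
    \<open>f\<close> lies there as well, so does the part \<open>y\<close>.\<close>
  define z' where "z' = z(Suc N := lval z l)"
  have z': "lval z' l = lval z l" using l by (intro lval_cong[of _ S N]) (auto simp: z'_def)
  obtain f y where fy: "f \<in> {x \<in> F. x (Suc N) = lval x l}" "y \<in> L" "\<And>i. i \<in> {1..Suc N} \<Longrightarrow> z' i = f i + y i"
    using generic_split[OF g flat_eq[OF F l], of z'] by blast
  have "lval z' l = lval (\<lambda>i. 1 * f i + 1 * y i) l" using fy(3) l by (intro lval_cong[of _ S N]) auto
  also have "\<dots> = lval f l + lval y l" by (simp add: lval_lin[of 1 f 1 y, simplified])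
  finally have "lval y l = z' (Suc N) - f (Suc N)" using fy(1) z' by (simp add: z'_def)
  hence "lval y l = y (Suc N)" using fy(3)[of "Suc N"] by simp
  moreover have "z i = f i + y i" if "i \<in> {1..N}" for i using fy(3)[of i] that by (auto simp: z'_def)
  ultimately show "\<exists>f\<in>F. \<exists>y\<in>{x \<in> L. lval x l = x (Suc N)}. \<forall>i\<in>{1..N}. z i = f i + y i"
    using fy(1,2) by (intro bexI[of _ f] bexI[of _ y]) auto
qed

lemma generic_not_hyperplane:
  assumes g: "generic S (Suc N) d L" and l: "l \<in> labels S N" and d: "d \<le> N"
  shows "\<exists>y\<in>L. lval y l \<noteq> y (Suc N)"
proof -
  obtain F where F: "flat S N d F" using flat_exists[OF d] by blast
  \<comment> \<open>The last unit vector is off the hyperplane of \<open>l\<close>, while its part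
    in the flat is on it; hence the part in \<open>L\<close> is off it.\<close>
  define z where "z = (\<lambda>i. if i = Suc N then 1 else (0::real))"
  obtain f y where fy: "f \<in> {x \<in> F. x (Suc N) = lval x l}" "y \<in> L" "\<And>i. i \<in> {1..Suc N} \<Longrightarrow> z i = f i + y i"
    using generic_split[OF g flat_eq[OF F l], of z] by blast
  have "lval z l = lval (\<lambda>i. 1 * f i + 1 * y i) l" using fy(3) l by (intro lval_cong[of _ S N]) auto
  also have "\<dots> = lval f l + lval y l" by (simp add: lval_lin[of 1 f 1 y, simplified])
  finally have "lval f l + lval y l = 0" using l by (auto simp: z_def lval_def labels_def)
  moreover have "f (Suc N) + y (Suc N) = 1" using fy(3)[of "Suc N"] by (simp add: z_def)
  ultimately show ?thesis using fy(1,2) by (intro bexI[of _ y]) auto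
qed

text \<open>There is no variable for \<open>j = 0\<close> because one coordinate leaves no choice:
  codimension 0 meets both cells and codimension 1 meets none, which is the distribution
  concentrated at 0.\<close>

fun bern_sum :: "nat \<Rightarrow> nat \<Rightarrow> nat pmf" where
  "bern_sum q 0 = return_pmf 0"
| "bern_sum q (Suc N) = (if N = 0 then return_pmf 0 else
     bind_pmf (bern_sum q N) (\<lambda>y. map_pmf (\<lambda>b. if b then Suc y else y) (bernoulli_pmf (1 / (2 + real q * real N)))))"

lemma set_bern_sum: "N > 0 \<Longrightarrow> set_pmf (bern_sum q N) \<subseteq> {..<N}"
proof (induction N)
  case (Suc N)
  show ?case
  proof (cases "N = 0")
    case False
    hence "set_pmf (bern_sum q N) \<subseteq> {..<N}" using Suc by simp
    thus ?thesis using False by (auto split: if_splits)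
  qed simp
qed simp

lemma finite_set_bern_sum: "finite (set_pmf (bern_sum q N))"
proof (cases "N = 0")
  case False thus ?thesis using set_bern_sum[of N q] finite_subset by blast
qed simp

lemma bern_sum_expect:
  fixes h :: "nat \<Rightarrow> 'b :: {banach, second_countable_topology}" and q N :: nat
  assumes N: "N > 0"
  defines "p \<equiv> 1 / (2 + real q * real N)"
  shows "measure_pmf.expectation (bern_sum q (Suc N)) h =
     measure_pmf.expectation (bern_sum q N) (\<lambda>y. p *\<^sub>R h (Suc y) + (1 - p) *\<^sub>R h y)"
proof -
  have "(0::real) \<le> real q * real N" by simp
  hence p: "0 \<le> p" "p \<le> 1" unfolding p_def by (auto simp: divide_le_eq_1)
  have "measure_pmf.expectation (bern_sum q (Suc N)) h =
     measure_pmf.expectation (bern_sum q N) (\<lambda>y. measure_pmf.expectation (map_pmf (\<lambda>b. if b then Suc y else y) (bernoulli_pmf p)) h)"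
    using N by (simp add: p_def pmf_expectation_bind[OF finite_set_bern_sum _ subset_refl] integral_measure_pmf[OF finite_set_bern_sum])
  also have "\<dots> = measure_pmf.expectation (bern_sum q N) (\<lambda>y. p *\<^sub>R h (Suc y) + (1 - p) *\<^sub>R h y)"
    using p by (simp add: integral_measure_pmf[of UNIV] UNIV_bool add.commute)
  finally show ?thesis .
qed

definition bless :: "nat \<Rightarrow> nat \<Rightarrow> nat \<Rightarrow> real" where
  "bless q N d = measure_pmf.prob (bern_sum q N) {..<d}"

lemma bless_0: "bless q N 0 = 0"
  by (simp add: bless_def)

lemma bless_ge: "N > 0 \<Longrightarrow> N \<le> d \<Longrightarrow> bless q N d = 1"
  unfolding bless_def using set_bern_sum[of N q] by (intro measure_pmf.prob_eq_1[THEN iffD2]) (auto intro!: AE_pmfI)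

lemma bless_expect: "bless q N d = measure_pmf.expectation (bern_sum q N) (indicator {..<d})"
  by (simp add: bless_def)

text \<open>Condition on the last Bernoulli variable. The coefficients on both sides add up to
  \<open>2 + q * N\<close>, so the recurrence passes to \<open>1 - bless\<close>; multiplied by
  \<open>total_cells\<close> it becomes the recursion of the cell counts.\<close>

lemma bless_Suc:
  assumes "N > 0"
  shows "(2 + real q * real N) * bless q (Suc N) (Suc d) = bless q N d + (1 + real q * real N) * bless q N (Suc d)"
proof -
  let ?p = "1 / (2 + real q * real N)"
  have int: "integrable (measure_pmf (bern_sum q N)) f" for f :: "nat \<Rightarrow> real"
    by (rule integrable_measure_pmf_finite[OF finite_set_bern_sum])
  have "bless q (Suc N) (Suc d) = measure_pmf.expectation (bern_sum q N) (\<lambda>y. ?p * indicator {..<Suc d} (Suc y) + (1 - ?p) * indicator {..<Suc d} y)"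
    unfolding bless_expect bern_sum_expect[OF assms] by simp
  also have "\<dots> = ?p * measure_pmf.expectation (bern_sum q N) (indicator {..<d}) + (1 - ?p) * measure_pmf.expectation (bern_sum q N) (indicator {..<Suc d})"
  proof -
    have i: "indicator {..<Suc d} (Suc y) = (indicator {..<d} y :: real)" for y by (auto simp: indicator_def)
    show ?thesis unfolding i using int by (subst Bochner_Integration.integral_add) simp_all
  qed
  finally have e: "bless q (Suc N) (Suc d) = ?p * bless q N d + (1 - ?p) * bless q N (Suc d)" by (simp add: bless_expect)
  have nz: "2 + real q * real N \<noteq> 0" by (smt (verit) mult_nonneg_nonneg of_nat_0_le_iff)
  define c where "c = 2 + real q * real N"
  have c: "c \<noteq> 0" "1 + real q * real N = c - 1" using nz by (simp_all add: c_def)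
  have "c * (1 / c * A + (1 - 1 / c) * B) = A + (c - 1) * B" for A B :: real using c(1) by (simp add: field_simps)
  thus ?thesis unfolding e c(2) c_def[symmetric] .
qed

definition total_cells :: "nat \<Rightarrow> nat \<Rightarrow> real" where
  "total_cells q N = (\<Prod>j<N. 2 + real q * real j)"

lemma cell_count_eq:
  assumes S: "sign_set S"
  shows "generic S N d L \<Longrightarrow> d \<le> N \<Longrightarrow> real (cell_count S N L) = total_cells (card S) N * (1 - bless (card S) N d)"
proof (induction N arbitrary: d L)
  case 0
  have "(\<lambda>i. 0) \<in> {x \<in> L. regular S 0 x}" using generic_lin_subspace[OF 0(1)] by (auto simp: lin_subspace_def regular_def)
  moreover have "below S 0 x = below S 0 y" for x y by (simp add: below_def restrict_def)
  ultimately have "below S 0 ` {x \<in> L. regular S 0 x} = {below S 0 (\<lambda>i. 0)}" by blast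
  thus ?case using 0 by (simp add: cell_count_def total_cells_def bless_0)
next
  case (Suc N)
  let ?q = "card S"
  show ?case
  proof (cases "d = Suc N")
    case True
    \<comment> \<open>In full codimension the whole space is a flat, so \<open>L\<close> vanishes on
      all coordinates and has no regular point. The recursion does not apply here, since
      \<open>L\<close> lies in every hyperplane.\<close>
    have fl: "\<exists>F. flat S (Suc N) d F \<and> F = UNIV"
    proof -
      have "flat S k k UNIV" for k by (induction k) (auto intro: flat_0 flat_free)
      thus ?thesis using True by blast
    qed
    have "\<not> regular S (Suc N) x" if "x \<in> L" for x
    proof -
      have "x 1 = 0" using generic_zero[OF Suc.prems(1), of UNIV x 1] fl that by auto
      hence "lval x (0, 0) = x 1" by (simp add: lval_def)
      thus ?thesis unfolding regular_def using zero_label[of S "1 - 1"] by force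
    qed
    hence "{x \<in> L. regular S (Suc N) x} = {}" by blast
    hence "cell_count S (Suc N) L = 0" unfolding cell_count_def by (simp only: image_empty card.empty)
    thus ?thesis using True by (simp add: bless_ge)
  next
    case False
    hence d: "d \<le> N" using Suc.prems by simp
    note g = Suc.prems(1)
    have "cell_count S (Suc N) L = cell_count S N L + (\<Sum>l\<in>labels S N. cell_count S N {x \<in> L. lval x l = x (Suc N)})"
      using cell_count_Suc[OF S generic_lin_subspace[OF g] generic_not_hyperplane[OF g _ d]] .
    also have "real \<dots> = real (cell_count S N L) + (\<Sum>l\<in>labels S N. total_cells ?q N * (1 - bless ?q N d))"
      using Suc.IH[OF generic_eq[OF g] d] by (simp add: of_nat_sum)
    also have "\<dots> = real (cell_count S N L) + (1 + real ?q * real N) * (total_cells ?q N * (1 - bless ?q N d))"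
      using card_labels[OF S, of N] by simp
    finally have e: "real (cell_count S (Suc N) L) = \<dots>" .
    have t: "total_cells ?q (Suc N) = (2 + real ?q * real N) * total_cells ?q N" by (simp add: total_cells_def)
    show ?thesis
    proof (cases d)
      case 0
      \<comment> \<open>Codimension 0 cannot drop; flats are lifted by the equation
        \<open>x (Suc N) = 0\<close> instead of by a free coordinate.\<close>
      have "generic S N 0 L"
      proof (rule genI)
        show "lin_subspace L" using g by (rule generic_lin_subspace)
      next
        fix F x i assume "flat S N 0 F" "x \<in> F" "i \<in> {1..N}"
        thus "x i = 0" using flat_0_zero by blast
      next
        fix F z assume F: "flat S N 0 F"
        have g0: "generic S (Suc N) 0 L" using g 0 by simp
        obtain f y where "f \<in> F" "y \<in> L" "\<And>i. i \<in> {1..Suc N} \<Longrightarrow> z i = f i + y i"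
          using generic_split[OF g0 flat_eq[OF F zero_label], of z] by blast
        thus "\<exists>f\<in>F. \<exists>y\<in>L. \<forall>i\<in>{1..N}. z i = f i + y i" by (intro bexI[of _ f] bexI[of _ y]) auto
      qed
      hence "real (cell_count S N L) = total_cells ?q N" using Suc.IH[of 0 L] by (simp add: bless_0)
      thus ?thesis using e t 0 by (simp add: bless_0 algebra_simps)
    next
      case (Suc d')
      have "generic S N d' L" using g Suc generic_free by blast
      hence "real (cell_count S N L) = total_cells ?q N * (1 - bless ?q N d')" using Suc.IH[of d' L] d Suc by simp
      moreover have "N > 0" using d Suc by simp
      hence "(2 + real ?q * real N) * bless ?q (Suc N) d = bless ?q N d' + (1 + real ?q * real N) * bless ?q N d"
        using bless_Suc[of N ?q d'] Suc by simp
      hence "total_cells ?q N * ((2 + real ?q * real N) * bless ?q (Suc N) d) = total_cells ?q N * (bless ?q N d' + (1 + real ?q * real N) * bless ?q N d)"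
        by simp
      ultimately show ?thesis using e t by (simp add: algebra_simps)
    qed
  qed
qed

section \<open>Central limit theorem for the Bernoulli sum\<close>

definition bprob :: "nat \<Rightarrow> nat \<Rightarrow> real" where "bprob q j = 1 / (2 + real q * real j)"

lemma bprob_bounds:
  assumes "q > 0" "j > 0"
  shows "0 < bprob q j" "bprob q j \<le> 1 / (real j + 2)" "bprob q j \<le> 1 / 3"
proof -
  have qj: "real q * real j \<ge> real j" using assms by (simp add: mult_le_cancel_right1)
  have j: "real j \<ge> 1" using assms by simp
  show "0 < bprob q j" unfolding bprob_def by (rule divide_pos_pos) (use qj j in linarith)+
  show "bprob q j \<le> 1 / (real j + 2)" unfolding bprob_def by (rule frac_le) (use qj j in linarith)+
  show "bprob q j \<le> 1 / 3" unfolding bprob_def by (rule frac_le) (use qj j in linarith)+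
qed

lemma bern_sum_char:
  "measure_pmf.expectation (bern_sum q N) (\<lambda>y. iexp (\<theta> * real y)) = (\<Prod>j\<in>{1..<N}. 1 + bprob q j * (iexp \<theta> - 1))"
proof (induction N)
  case (Suc N)
  show ?case
  proof (cases "N = 0")
    case False
    have e: "bprob q N *\<^sub>R iexp (\<theta> * real (Suc y)) + (1 - bprob q N) *\<^sub>R iexp (\<theta> * real y)
       = (1 + bprob q N * (iexp \<theta> - 1)) * iexp (\<theta> * real y)" for y
      by (simp add: scaleR_conv_of_real algebra_simps exp_add)
    have "measure_pmf.expectation (bern_sum q (Suc N)) (\<lambda>y. iexp (\<theta> * real y)) =
       measure_pmf.expectation (bern_sum q N) (\<lambda>y. (1 + bprob q N * (iexp \<theta> - 1)) * iexp (\<theta> * real y))"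
      using False by (subst bern_sum_expect) (simp_all only: e bprob_def[symmetric] neq0_conv)
    also have "\<dots> = (1 + bprob q N * (iexp \<theta> - 1)) * (\<Prod>j\<in>{1..<N}. 1 + bprob q j * (iexp \<theta> - 1))"
      by (simp only: integral_mult_right_zero Suc.IH)
    also have "\<dots> = (\<Prod>j\<in>{1..<Suc N}. 1 + bprob q j * (iexp \<theta> - 1))"
      using False by (subst prod.atLeastLessThan_Suc) (simp_all add: mult.commute)
    finally show ?thesis .
  qed simp
qed simp

text \<open>Telescoping against \<open>1 / (j + 1) - 1 / (j + 2)\<close>. The bound is uniform in
  \<open>N\<close> and controls the total error of the Poisson approximation.\<close>

lemma sum_bprob_square:
  assumes "q > 0"
  shows "(\<Sum>j\<in>{1..<N}. (bprob q j)\<^sup>2) \<le> 1"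
proof -
  have "(\<Sum>j\<in>{1..<Suc N}. (bprob q j)\<^sup>2) \<le> 1 - 1 / (real N + 2)" for N
  proof (induction N)
    case (Suc N)
    have "(bprob q (Suc N))\<^sup>2 \<le> (1 / (real (Suc N) + 2))\<^sup>2"
      using bprob_bounds[OF assms, of "Suc N"] by (intro power_mono) auto
    also have "\<dots> = 1 / ((real N + 3) * (real N + 3))" by (simp add: power2_eq_square field_simps)
    also have "\<dots> \<le> 1 / ((real N + 2) * (real N + 3))" by (intro divide_left_mono mult_right_mono) auto
    also have "\<dots> = 1 / (real N + 2) - 1 / (real N + 3)" by (simp add: field_simps)
    finally show ?case using Suc by (simp add: algebra_simps)
  qed simp
  from this[of N] have h: "(\<Sum>j\<in>{1..<Suc N}. (bprob q j)\<^sup>2) \<le> 1" by (smt (verit) divide_nonneg_nonneg of_nat_0_le_iff)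
  have "(\<Sum>j\<in>{1..<N}. (bprob q j)\<^sup>2) \<le> (\<Sum>j\<in>{1..<Suc N}. (bprob q j)\<^sup>2)"
    by (intro sum_mono2) auto
  thus ?thesis using h by linarith
qed

text \<open>The exponential is the characteristic function of a Poisson variable with the same mean.
  Each factor costs a multiple of the square of \<open>bprob q j * \<theta>\<close>, and the squares
  of the parameters are summable, so the error is uniform in \<open>N\<close> and vanishes with
  \<open>\<theta>\<close>.\<close>

lemma bern_sum_char_approx:
  assumes q: "q > 0"
  shows "cmod ((\<Prod>j\<in>{1..<N}. 1 + bprob q j * (iexp \<theta> - 1)) - exp ((\<Sum>j\<in>{1..<N}. bprob q j) * (iexp \<theta> - 1))) \<le> exp 1 * \<theta>\<^sup>2"
proof -
  define w where "w = iexp \<theta> - 1"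
  have w: "cmod w \<le> \<bar>\<theta>\<bar>" "cmod w \<le> 2" "Re w \<le> 0"
    using iexp_approx1[of \<theta> 0] norm_triangle_ineq4[of "iexp \<theta>" 1] complex_Re_le_cmod[of "iexp \<theta>"] by (auto simp: w_def)
  have "cmod ((\<Prod>j\<in>{1..<N}. 1 + bprob q j * w) - (\<Prod>j\<in>{1..<N}. exp (bprob q j * w)))
    \<le> (\<Sum>j\<in>{1..<N}. cmod ((1 + bprob q j * w) - exp (bprob q j * w)))"
  proof (rule norm_prod_diff)
    fix j assume "j \<in> {1..<N}"
    hence p: "0 < bprob q j" "bprob q j \<le> 1" using bprob_bounds[OF q, of j] by auto
    \<comment> \<open>A convex combination of two points of the unit circle. With
      \<open>Re w \<le> 0\<close> for the exponentials, all factors have modulus at most one, as the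
      factorwise comparison of products requires.\<close>
    have "1 + bprob q j * w = of_real (1 - bprob q j) + of_real (bprob q j) * iexp \<theta>"
      by (simp add: w_def algebra_simps)
    hence "cmod (1 + bprob q j * w) \<le> cmod (of_real (1 - bprob q j)) + cmod (of_real (bprob q j) * iexp \<theta>)"
      by (metis norm_triangle_ineq)
    also have "\<dots> = 1" using p by (simp add: norm_mult del: of_real_diff)
    finally show "cmod (1 + bprob q j * w) \<le> 1" .
    show "cmod (exp (bprob q j * w)) \<le> 1" using p w(3) by (simp add: mult_le_0_iff)
  qed
  also have "\<dots> \<le> (\<Sum>j\<in>{1..<N}. exp 1 * \<theta>\<^sup>2 * (bprob q j)\<^sup>2)"
  proof (rule sum_mono)
    fix j assume "j \<in> {1..<N}"
    hence p: "0 < bprob q j" "bprob q j \<le> 1 / 3" using bprob_bounds[OF q, of j] by auto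
    let ?z = "bprob q j * w"
    have nz: "cmod ?z = bprob q j * cmod w" using p by (simp add: norm_mult)
    have "\<bar>Re ?z\<bar> \<le> cmod ?z" by (rule abs_Re_le_cmod)
    also have "\<dots> \<le> 1/3 * 2" unfolding nz using p w by (intro mult_mono) auto
    finally have re: "\<bar>Re ?z\<bar> \<le> 1" by simp
    have "cmod (exp ?z - (\<Sum>k\<le>1. ?z ^ k / fact k)) \<le> exp \<bar>Re ?z\<bar> * cmod ?z ^ Suc 1 / fact 1"
      by (rule Taylor_exp)
    hence "cmod ((1 + ?z) - exp ?z) \<le> exp \<bar>Re ?z\<bar> * (cmod ?z)\<^sup>2"
      by (simp add: norm_minus_commute numeral_2_eq_2 del: Re_complex_of_real)
    also have "\<dots> \<le> exp 1 * (bprob q j * \<bar>\<theta>\<bar>)\<^sup>2"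
      unfolding nz using re p w by (intro mult_mono power_mono) auto
    finally show "cmod ((1 + ?z) - exp ?z) \<le> exp 1 * \<theta>\<^sup>2 * (bprob q j)\<^sup>2"
      by (simp add: power_mult_distrib algebra_simps)
  qed
  also have "\<dots> = exp 1 * \<theta>\<^sup>2 * (\<Sum>j\<in>{1..<N}. (bprob q j)\<^sup>2)" by (simp add: sum_distrib_left)
  also have "\<dots> \<le> exp 1 * \<theta>\<^sup>2 * 1" using sum_bprob_square[OF q] by (intro mult_left_mono) auto
  also have "(\<Prod>j\<in>{1..<N}. exp (bprob q j * w)) = exp ((\<Sum>j\<in>{1..<N}. bprob q j) * w)"
    by (simp add: exp_sum[symmetric] sum_distrib_right)
  finally show ?thesis by (simp add: w_def)
qed

text \<open>For both values of \<open>q\<close> the sum is an affine function of a harmonic number.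
  A bounded deviation of the mean from \<open>ln N / q\<close> disappears after division by the
  standard deviation.\<close>

lemma sum_bprob_asymp:
  assumes "q = 1 \<or> q = 2"
  shows "convergent (\<lambda>N. (\<Sum>j\<in>{1..<N}. bprob q j) - ln (real N) / real q)"
proof -
  have h: "(\<lambda>N. harm N - ln (real N)) \<longlonglongrightarrow> (euler_mascheroni :: real)"
    using euler_mascheroni_LIMSEQ .
  from assms show ?thesis
  proof
    assume q: "q = 1"
    have e: "(\<Sum>j\<in>{1..<N}. bprob q j) = harm (Suc N) - 3 / 2" if "N > 0" for N
      using that
    proof (induction N)
      case (Suc N)
      show ?case
      proof (cases "N = 0")
        case True thus ?thesis by (simp add: harm_Suc harm_expand)
      next
        case False
        hence "(\<Sum>j\<in>{1..<Suc N}. bprob q j) = (\<Sum>j\<in>{1..<N}. bprob q j) + bprob q N" by simp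
        moreover have "bprob q N = inverse (real (Suc (Suc N)))" by (simp add: bprob_def q inverse_eq_divide)
        moreover have "harm (Suc (Suc N)) = harm (Suc N) + inverse (real (Suc (Suc N)))" by (rule harm_Suc)
        ultimately show ?thesis using Suc.IH False by simp
      qed
    qed simp
    have "(\<lambda>N. (harm (Suc N) - ln (real (Suc N))) + (ln (real (Suc N)) - ln (real N)) - 3/2) \<longlonglongrightarrow> euler_mascheroni + 0 - 3/2"
    proof (intro tendsto_intros)
      show "(\<lambda>N. harm (Suc N) - ln (real (Suc N))) \<longlonglongrightarrow> (euler_mascheroni :: real)"
        using LIMSEQ_Suc[OF h] .
      show "(\<lambda>N. ln (real (Suc N)) - ln (real N)) \<longlonglongrightarrow> 0" by real_asymp
    qed
    moreover have "\<forall>\<^sub>F N in sequentially. (harm (Suc N) - ln (real (Suc N))) + (ln (real (Suc N)) - ln (real N)) - 3/2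
       = (\<Sum>j\<in>{1..<N}. bprob q j) - ln (real N) / real q"
      using eventually_gt_at_top[of 0] by eventually_elim (simp only: e, simp add: q)
    ultimately show ?thesis by (intro convergentI) (rule Lim_transform_eventually)
  next
    assume q: "q = 2"
    have e: "(\<Sum>j\<in>{1..<N}. bprob q j) = (harm N - 1) / 2" if "N > 0" for N
      using that
    proof (induction N)
      case (Suc N)
      show ?case
      proof (cases "N = 0")
        case True thus ?thesis by (simp add: harm_Suc harm_expand)
      next
        case False
        hence "(\<Sum>j\<in>{1..<Suc N}. bprob q j) = (\<Sum>j\<in>{1..<N}. bprob q j) + bprob q N" by simp
        moreover have "bprob q N = inverse (real (Suc N)) / 2" by (simp add: bprob_def q inverse_eq_divide field_simps)
        moreover have "harm (Suc N) = harm N + inverse (real (Suc N))" by (rule harm_Suc)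
        ultimately show ?thesis using Suc.IH False by simp
      qed
    qed simp
    have "(\<lambda>N. ((harm N - ln (real N)) - 1) / 2) \<longlonglongrightarrow> (euler_mascheroni - 1) / 2"
      using h by (intro tendsto_intros) auto
    moreover have "\<forall>\<^sub>F N in sequentially. ((harm N - ln (real N)) - 1) / 2
       = (\<Sum>j\<in>{1..<N}. bprob q j) - ln (real N) / real q"
      using eventually_gt_at_top[of 0] by eventually_elim (simp only: e, simp add: q field_simps)
    ultimately show ?thesis by (intro convergentI) (rule Lim_transform_eventually)
  qed
qed

text \<open>For \<open>th = t / sqrt lam\<close>, the Poisson exponent
  \<open>lam * (iexp th - 1)\<close> is \<open>\<i> * t * sqrt lam - t^2 / 2\<close> up to a third
  order term of size \<open>\<bar>t\<bar>^3 / sqrt lam\<close>. The centring factor removes the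
  first summand, and replacing the exact mean \<open>s\<close> by \<open>lam\<close> costs a bounded
  multiple of \<open>w\<close>, which tends to zero.\<close>

lemma bern_sum_char_limit:
  assumes q: "q = 1 \<or> q = 2"
  defines "lam \<equiv> \<lambda>N. ln (real N) / real q"
  shows "(\<lambda>N. iexp (- t * sqrt (lam N)) * measure_pmf.expectation (bern_sum q N) (\<lambda>y. iexp (t / sqrt (lam N) * real y)))
     \<longlonglongrightarrow> exp (- (t^2) / 2)"
proof -
  define th where "th = (\<lambda>N. t / sqrt (lam N))"
  define s where "s = (\<lambda>N. \<Sum>j\<in>{1..<N}. bprob q j)"
  define w where "w = (\<lambda>N. iexp (th N) - 1)"
  have q0: "q > 0" using q by auto
  have lam: "filterlim lam at_top sequentially" using q0 unfolding lam_def by real_asymp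
  have pos: "\<forall>\<^sub>F N in sequentially. lam N > 0" using lam by (simp add: filterlim_at_top_dense)
  have sq: "filterlim (\<lambda>N. sqrt (lam N)) at_top sequentially"
    using filterlim_compose[OF sqrt_at_top lam] .
  have th: "th \<longlonglongrightarrow> 0" unfolding th_def
    by (rule real_tendsto_divide_at_top[OF tendsto_const sq])
  have w0: "w \<longlonglongrightarrow> 0" unfolding w_def using th by (auto intro!: tendsto_eq_intros)
  have sl: "convergent (\<lambda>N. s N - lam N)" using sum_bprob_asymp[OF q] by (simp add: s_def lam_def)
  \<comment> \<open>The normalised characteristic function with the Bernoulli product replaced by
    its Poisson approximation.\<close>
  define E where "E = (\<lambda>N. iexp (- t * sqrt (lam N)) * exp (s N * w N))"
  have lim1: "(\<lambda>N. (w N - \<i> * th N + (th N)\<^sup>2 / 2) * lam N) \<longlonglongrightarrow> 0"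
  proof (rule Lim_null_comparison)
    show "\<forall>\<^sub>F N in sequentially. norm ((w N - \<i> * th N + (th N)\<^sup>2 / 2) * lam N) \<le> \<bar>t\<bar>^3 / sqrt (lam N)"
      using pos
    proof eventually_elim
      case (elim N)
      have "cmod (iexp (th N) - (\<Sum>k\<le>2. (\<i> * th N)^k / fact k)) \<le> \<bar>th N\<bar>^Suc 2 / fact (Suc 2)"
        by (rule iexp_approx1)
      hence "cmod (w N - \<i> * th N + (th N)\<^sup>2 / 2) \<le> \<bar>th N\<bar>^3 / 6"
        by (simp add: numeral_2_eq_2 numeral_3_eq_3 w_def fact_numeral algebra_simps power_mult_distrib)
      also have "\<dots> \<le> \<bar>th N\<bar>^3" by simp
      finally have "norm ((w N - \<i> * th N + (th N)\<^sup>2 / 2) * lam N) \<le> \<bar>th N\<bar>^3 * lam N"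
        using elim by (simp add: norm_mult mult_right_mono)
      also have "\<bar>th N\<bar>^3 * lam N = \<bar>t\<bar>^3 / sqrt (lam N)"
      proof -
        have "lam N = sqrt (lam N) ^ 2" using elim by simp
        thus ?thesis using elim unfolding th_def
          by (simp add: power_divide abs_divide power2_eq_square power3_eq_cube field_simps del: real_sqrt_pow2)
      qed
      finally show ?case .
    qed
    show "(\<lambda>N. \<bar>t\<bar>^3 / sqrt (lam N)) \<longlonglongrightarrow> 0"
      by (rule real_tendsto_divide_at_top[OF tendsto_const sq])
  qed
  have lim2: "(\<lambda>N. w N * (s N - lam N)) \<longlonglongrightarrow> 0"
  proof -
    obtain c where "(\<lambda>N. s N - lam N) \<longlonglongrightarrow> c" using sl by (auto simp: convergent_def)
    hence "(\<lambda>N. w N * complex_of_real (s N - lam N)) \<longlonglongrightarrow> 0 * of_real c" using w0 by (intro tendsto_intros)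
    thus ?thesis by simp
  qed
  have "(\<lambda>N. exp ((w N - \<i> * th N + (th N)\<^sup>2 / 2) * lam N + w N * (s N - lam N) - t\<^sup>2 / 2)) \<longlonglongrightarrow> exp (0 + 0 - complex_of_real (t\<^sup>2 / 2))"
    using lim1 lim2 by (intro tendsto_intros) auto
  moreover have "\<forall>\<^sub>F N in sequentially. exp ((w N - \<i> * th N + (th N)\<^sup>2 / 2) * lam N + w N * (s N - lam N) - t\<^sup>2 / 2) = E N"
    using pos
  proof eventually_elim
    case (elim N)
    have 1: "th N * lam N = t * sqrt (lam N)" using elim unfolding th_def
      by (simp add: field_simps)
    have 2: "(th N)\<^sup>2 * lam N = t\<^sup>2" using elim unfolding th_def by (simp add: power_divide)
    have "(w N - \<i> * th N + (th N)\<^sup>2 / 2) * lam N + w N * (s N - lam N) - t\<^sup>2 / 2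
       = w N * s N - \<i> * of_real (th N * lam N) + of_real ((th N)\<^sup>2 * lam N) / 2 - t\<^sup>2 / 2"
      by (simp add: algebra_simps)
    also have "\<dots> = w N * s N - \<i> * of_real (t * sqrt (lam N))" unfolding 1 2 by simp
    finally have "exp ((w N - \<i> * th N + (th N)\<^sup>2 / 2) * lam N + w N * (s N - lam N) - t\<^sup>2 / 2)
        = exp (w N * s N - \<i> * of_real (t * sqrt (lam N)))" by (rule arg_cong)
    thus ?case unfolding E_def by (simp add: exp_add[symmetric] algebra_simps)
  qed
  ultimately have "E \<longlonglongrightarrow> exp (0 + 0 - complex_of_real (t\<^sup>2 / 2))" by (rule Lim_transform_eventually)
  hence E: "E \<longlonglongrightarrow> exp (- complex_of_real (t\<^sup>2 / 2))" by simp
  define A where "A = (\<lambda>N. iexp (- t * sqrt (lam N)) * measure_pmf.expectation (bern_sum q N) (\<lambda>y. iexp (t / sqrt (lam N) * real y)))"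
  have "(\<lambda>N. A N - E N) \<longlonglongrightarrow> 0"
  proof (rule Lim_null_comparison)
    show "\<forall>\<^sub>F N in sequentially. norm (A N - E N) \<le> exp 1 * (th N)\<^sup>2"
    proof (intro always_eventually allI)
      fix N
      have "A N - E N = iexp (- t * sqrt (lam N)) * ((\<Prod>j\<in>{1..<N}. 1 + bprob q j * (iexp (th N) - 1)) - exp (s N * w N))"
      proof -
        have thN: "t / sqrt (lam N) = th N" by (simp add: th_def)
        show ?thesis unfolding A_def E_def thN bern_sum_char by (simp only: right_diff_distrib)
      qed
      hence "norm (A N - E N) = norm ((\<Prod>j\<in>{1..<N}. 1 + bprob q j * (iexp (th N) - 1)) - exp (s N * w N))"
        by (simp only: norm_mult norm_exp_i_times mult_1_left)
      also have "\<dots> \<le> exp 1 * (th N)\<^sup>2" using bern_sum_char_approx[OF q0, where N = N and \<theta> = "th N"] by (simp add: s_def w_def)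
      finally show "norm (A N - E N) \<le> exp 1 * (th N)\<^sup>2" .
    qed
    show "(\<lambda>N. exp 1 * (th N)\<^sup>2) \<longlonglongrightarrow> 0" using th by (auto intro!: tendsto_eq_intros)
  qed
  from tendsto_add[OF this E] have "A \<longlonglongrightarrow> exp (- complex_of_real (t\<^sup>2 / 2))" by simp
  also have "exp (- complex_of_real (t\<^sup>2 / 2)) = complex_of_real (exp (- (t\<^sup>2) / 2))"
    by (metis exp_of_real of_real_minus minus_divide_left)
  finally show ?thesis by (simp only: A_def)
qed

lemma bless_limit:
  assumes q: "q = 1 \<or> q = 2"
    and d: "(\<lambda>N. (real (d N) - ln (real N) / real q) / sqrt (ln (real N) / real q)) \<longlonglongrightarrow> a"
  shows "(\<lambda>N. bless q N (d N)) \<longlonglongrightarrow> (LBINT t:{..a}. std_normal_density t)"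
proof -
  define lam where "lam = (\<lambda>N. ln (real N) / real q)"
  define Z where "Z = (\<lambda>N y. (real y - lam N) / sqrt (lam N))"
  define \<mu> where "\<mu> = (\<lambda>N. distr (measure_pmf (bern_sum q N)) borel (Z N))"
  have q0: "q > 0" using q by auto
  have lam: "filterlim lam at_top sequentially" using q0 unfolding lam_def by real_asymp
  have pos: "\<forall>\<^sub>F N in sequentially. lam N > 0" using lam by (simp add: filterlim_at_top_dense)
  interpret std: real_distribution std_normal_distribution by (rule real_dist_normal_dist)
  have rd: "real_distribution (\<mu> N)" for N unfolding \<mu>_def
    by (auto simp: real_distribution_def real_distribution_axioms_def intro!: measure_pmf.prob_space_distr)
  have w: "weak_conv_m \<mu> std_normal_distribution"
  proof (rule levy_continuity[OF rd real_dist_normal_dist])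
    fix t
    have "\<forall>\<^sub>F N in sequentially. iexp (- t * sqrt (lam N)) * measure_pmf.expectation (bern_sum q N) (\<lambda>y. iexp (t / sqrt (lam N) * real y)) = char (\<mu> N) t"
      using pos
    proof eventually_elim
      case (elim N)
      have e: "iexp (t * Z N y) = iexp (- t * sqrt (lam N)) * iexp (t / sqrt (lam N) * real y)" for y
      proof -
        have "t * Z N y = t / sqrt (lam N) * real y - t * (lam N / sqrt (lam N))"
          by (simp add: Z_def diff_divide_distrib right_diff_distrib)
        also have "lam N / sqrt (lam N) = sqrt (lam N)" using elim by (simp add: real_div_sqrt)
        finally have eq: "t * Z N y = - t * sqrt (lam N) + t / sqrt (lam N) * real y" by simp
        have "iexp (a + b) = iexp a * iexp b" for a b :: real by (simp add: exp_add distrib_left)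
        thus ?thesis unfolding eq .
      qed
      have "char (\<mu> N) t = measure_pmf.expectation (bern_sum q N) (\<lambda>y. iexp (t * Z N y))"
        unfolding char_def \<mu>_def by (subst integral_distr) auto
      also have "\<dots> = iexp (- t * sqrt (lam N)) * measure_pmf.expectation (bern_sum q N) (\<lambda>y. iexp (t / sqrt (lam N) * real y))"
        unfolding e by (rule integral_mult_right_zero)
      finally show ?case by simp
    qed
    with bern_sum_char_limit[OF q, of t] show "(\<lambda>N. char (\<mu> N) t) \<longlonglongrightarrow> char std_normal_distribution t"
      unfolding char_std_normal_distribution lam_def by (rule Lim_transform_eventually)
  qed
  have atom: "measure std_normal_distribution {x} = 0" for x
  proof -
    have "emeasure std_normal_distribution {x} = (\<integral>\<^sup>+t. ennreal (std_normal_density t) * indicator {x} t \<partial>lborel)"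
      by (rule emeasure_density) auto
    also have "\<dots> = 0" using AE_lborel_singleton[of x] by (subst nn_integral_0_iff_AE) auto
    finally show ?thesis by (simp add: measure_def)
  qed
  have cont: "isCont (cdf std_normal_distribution) x" for x
    using atom std.isCont_cdf by simp
  have conv: "(\<lambda>N. cdf (\<mu> N) x) \<longlonglongrightarrow> cdf std_normal_distribution x" for x
    using w cont by (simp add: weak_conv_m_def weak_conv_def)
  \<comment> \<open>Weak convergence concerns fixed levels, whereas the normalised level
    \<open>an N\<close> moves. It is eventually below every fixed \<open>x > a\<close> and above
    every \<open>x < a\<close>; continuity of the limit at \<open>a\<close> closes the gap.\<close>
  define an where "an = (\<lambda>N. (real (d N) - lam N) / sqrt (lam N))"
  have an: "an \<longlonglongrightarrow> a" using d by (simp add: an_def lam_def)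
  have cdfm: "cdf (\<mu> N) x = measure_pmf.prob (bern_sum q N) {y. Z N y \<le> x}" for N x
    unfolding cdf_def \<mu>_def by (subst measure_distr) (auto intro!: arg_cong[where f = "measure_pmf.prob (bern_sum q N)"])
  have lt: "y < d N \<longleftrightarrow> Z N y < an N" if "lam N > 0" for N y
    using that by (simp add: Z_def an_def divide_less_cancel)
  have lo: "\<forall>\<^sub>F N in sequentially. cdf (\<mu> N) x \<le> bless q N (d N)" if "x < a" for x
    using order_tendstoD(1)[OF an that] pos
  proof eventually_elim
    case (elim N)
    have "y < d N" if "Z N y \<le> x" for y unfolding lt[OF elim(2)] using elim(1) that by linarith
    hence "{y. Z N y \<le> x} \<subseteq> {..<d N}" by blast
    thus ?case unfolding cdfm bless_def by (rule measure_pmf.finite_measure_mono) simp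
  qed
  have hi: "\<forall>\<^sub>F N in sequentially. bless q N (d N) \<le> cdf (\<mu> N) x" if "x > a" for x
    using order_tendstoD(2)[OF an that] pos
  proof eventually_elim
    case (elim N)
    have "Z N y \<le> x" if "y < d N" for y using that elim(1) unfolding lt[OF elim(2)] by linarith
    hence "{..<d N} \<subseteq> {y. Z N y \<le> x}" by blast
    thus ?case unfolding cdfm bless_def by (rule measure_pmf.finite_measure_mono) simp
  qed
  have "(\<lambda>N. bless q N (d N)) \<longlonglongrightarrow> cdf std_normal_distribution a"
  proof (rule order_tendstoI)
    fix c assume c: "c < cdf std_normal_distribution a"
    have "\<forall>\<^sub>F x in at_left a. c < cdf std_normal_distribution x"
      using cont[of a] c unfolding isCont_def filterlim_at_split by (blast intro: order_tendstoD(1))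
    moreover have "\<forall>\<^sub>F x in at_left a. x < a" by (simp add: eventually_at_filter)
    ultimately have "\<forall>\<^sub>F x in at_left a. c < cdf std_normal_distribution x \<and> x < a" by eventually_elim simp
    then obtain x where x: "c < cdf std_normal_distribution x" "x < a"
      using eventually_happens'[OF trivial_limit_at_left_real] by blast
    show "\<forall>\<^sub>F N in sequentially. c < bless q N (d N)"
      using order_tendstoD(1)[OF conv x(1)] lo[OF x(2)] by eventually_elim simp
  next
    fix c assume c: "cdf std_normal_distribution a < c"
    have "\<forall>\<^sub>F x in at_right a. cdf std_normal_distribution x < c"
      using cont[of a] c unfolding isCont_def filterlim_at_split by (blast intro: order_tendstoD(2))
    moreover have "\<forall>\<^sub>F x in at_right a. a < x" by (rule eventually_at_right_less)
    ultimately have "\<forall>\<^sub>F x in at_right a. cdf std_normal_distribution x < c \<and> a < x" by eventually_elim simp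
    then obtain x where x: "cdf std_normal_distribution x < c" "a < x"
      using eventually_happens'[OF trivial_limit_at_right_real] by blast
    show "\<forall>\<^sub>F N in sequentially. bless q N (d N) < c"
      using order_tendstoD(2)[OF conv x(1)] hi[OF x(2)] by eventually_elim simp
  qed
  moreover have "cdf std_normal_distribution a = (LBINT t:{..a}. std_normal_density t)"
  proof -
    have "emeasure std_normal_distribution {..a} = (\<integral>\<^sup>+t. ennreal (indicator {..a} t *\<^sub>R std_normal_density t) \<partial>lborel)"
      by (subst emeasure_density) (auto intro!: nn_integral_cong simp: indicator_def)
    also have "\<dots> = ennreal (LBINT t:{..a}. std_normal_density t)" unfolding set_lebesgue_integral_def
      by (intro nn_integral_eq_integral integrable_mult_indicator) auto
    finally show ?thesis unfolding cdf_def measure_def by (simp add: set_lebesgue_integral_def)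
  qed
  ultimately show ?thesis by simp
qed

section \<open>Kernels of vector tuples\<close>

definition signed_sum :: "(nat \<Rightarrow> real) \<Rightarrow> (nat \<Rightarrow> nat) \<Rightarrow> (nat \<Rightarrow> nat \<Rightarrow> real) \<Rightarrow> nat \<Rightarrow> nat \<Rightarrow> real" where
  "signed_sum \<epsilon> \<sigma> v k j = (\<Sum>i\<in>{1..k}. \<epsilon> i * v (\<sigma> i) j)"

definition kernel :: "nat \<Rightarrow> (nat \<Rightarrow> nat \<Rightarrow> real) \<Rightarrow> nat \<Rightarrow> (nat \<Rightarrow> real) set" where
  "kernel d v N = {x. \<forall>j<d. (\<Sum>i\<in>{1..N}. x i * v i j) = 0}"

definition sperms :: "real set \<Rightarrow> nat \<Rightarrow> ((nat \<Rightarrow> nat) \<times> (nat \<Rightarrow> real)) set" where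
  "sperms E n = {\<sigma>. \<sigma> permutes {1..n}} \<times> ({1..n} \<rightarrow>\<^sub>E E)"

section \<open>Linear dependence and points in general position\<close>

lemma dependent_exists:
  fixes v :: "'k \<Rightarrow> nat \<Rightarrow> real"
  assumes "finite K" "d < card K"
  shows "\<exists>c. (\<exists>k\<in>K. c k \<noteq> 0) \<and> (\<forall>j<d. (\<Sum>k\<in>K. c k * v k j) = 0)"
  using assms
proof (induction d arbitrary: K v)
  case 0
  hence "K \<noteq> {}" by auto
  thus ?case by (intro exI[of _ "\<lambda>_. 1"]) auto
next
  case (Suc d)
  show ?case
  proof (cases "\<forall>k\<in>K. v k d = 0")
    case True
    obtain c where "\<exists>k\<in>K. c k \<noteq> 0" "\<forall>j<d. (\<Sum>k\<in>K. c k * v k j) = 0"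
      using Suc.IH[of K v] Suc.prems by auto
    thus ?thesis using True by (intro exI[of _ c]) (auto simp: less_Suc_eq)
  next
    case False
    then obtain p where p: "p \<in> K" "v p d \<noteq> 0" by auto
    define K' where "K' = K - {p}"
    \<comment> \<open>Gaussian elimination: the pivot \<open>p\<close> clears coordinate
      \<open>d\<close> of all remaining vectors.\<close>
    define v' where "v' = (\<lambda>k j. v k j - v k d / v p d * v p j)"
    have K': "finite K'" "d < card K'" using Suc.prems p by (auto simp: K'_def)
    obtain c where c: "\<exists>k\<in>K'. c k \<noteq> 0" "\<forall>j<d. (\<Sum>k\<in>K'. c k * v' k j) = 0"
      using Suc.IH[OF K'] by blast
    define c' where "c' = c(p := - (\<Sum>k\<in>K'. c k * v k d) / v p d)"
    have K: "K = insert p K'" "p \<notin> K'" using p by (auto simp: K'_def)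
    have s: "(\<Sum>k\<in>K. c' k * v k j) = (\<Sum>k\<in>K'. c k * v' k j)" for j
    proof -
      have "(\<Sum>k\<in>K. c' k * v k j) = c' p * v p j + (\<Sum>k\<in>K'. c k * v k j)"
        unfolding K(1) using K' K(2) by (simp add: c'_def) (intro sum.cong, auto)
      also have "c' p * v p j = - (\<Sum>k\<in>K'. c k * (v k d / v p d * v p j))"
        by (simp add: c'_def sum_distrib_right sum_divide_distrib sum_negf mult.assoc)
      finally show ?thesis by (simp add: v'_def algebra_simps sum_subtractf)
    qed
    have "(\<Sum>k\<in>K. c' k * v k j) = 0" if "j < Suc d" for j
    proof (cases "j = d")
      case True
      have "v' k d = 0" for k using p by (simp add: v'_def)
      thus ?thesis using s[of d] True by simp
    next
      case False thus ?thesis using c(2) s[of j] that by auto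
    qed
    moreover have "\<exists>k\<in>K. c' k \<noteq> 0" using c(1) K by (auto simp: c'_def)
    ultimately show ?thesis by blast
  qed
qed

lemma lin_indep_span:
  assumes li: "lin_indep_fam d v K" and K: "finite K" "card K = d"
  shows "\<exists>c. \<forall>j<d. (\<Sum>k\<in>K. c k * v k j) = b j"
proof -
  \<comment> \<open>The target \<open>b\<close> is adjoined under the label \<open>None\<close>. The
    resulting \<open>d + 1\<close> vectors are dependent, and independence of \<open>K\<close>
    forces a nonzero coefficient at \<open>None\<close>.\<close>
  define v' where "v' = (\<lambda>k. case k of None \<Rightarrow> b | Some k \<Rightarrow> v k)"
  have "d < card (insert None (Some ` K))" using K by (simp add: card_image)
  then obtain c where c: "\<exists>k\<in>insert None (Some ` K). c k \<noteq> 0"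
      "\<forall>j<d. (\<Sum>k\<in>insert None (Some ` K). c k * v' k j) = 0"
    using dependent_exists[of "insert None (Some ` K)" d v'] K by auto
  have s: "c None * b j + (\<Sum>k\<in>K. c (Some k) * v k j) = 0" if "j < d" for j
    using c(2) that K by (auto simp: v'_def sum.reindex)
  have nz: "c None \<noteq> 0"
  proof
    assume h: "c None = 0"
    hence "\<forall>k\<in>K. c (Some k) = 0" using li s unfolding lin_indep_fam_def by (auto dest!: spec[of _ "\<lambda>k. c (Some k)"])
    thus False using c(1) h by auto
  qed
  have "(\<Sum>k\<in>K. (- c (Some k) / c None) * v k j) = b j" if "j < d" for j
  proof -
    have "(\<Sum>k\<in>K. (- c (Some k) / c None) * v k j) = - (\<Sum>k\<in>K. c (Some k) * v k j) / c None"
      by (simp add: sum_divide_distrib sum_negf)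
    also have "\<dots> = b j" using s[OF that] nz by (simp add: field_simps)
    finally show ?thesis .
  qed
  thus ?thesis by (intro exI[of _ "\<lambda>k. - c (Some k) / c None"]) auto
qed

text \<open>General position upgrades nonnegative weights to positive ones: the support of a convex
  relation has at least \<open>d\<close> points, so it contains a spanning set, and that set can
  absorb a small increase of all other weights. Positive weights will correspond to open
  chambers.\<close>

lemma zero_in_conv_pos:
  assumes ind: "any_d_indep d v I" and I: "finite I" "d \<le> card I" and z: "zero_in_conv d v I"
  shows "\<exists>w. (\<forall>k\<in>I. w k > 0) \<and> (\<forall>j<d. (\<Sum>k\<in>I. w k * v k j) = 0)"
proof -
  obtain w where w: "\<forall>k\<in>I. w k \<ge> 0" "(\<Sum>k\<in>I. w k) = 1" "\<forall>j<d. (\<Sum>k\<in>I. w k * v k j) = 0"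
    using z by (auto simp: zero_in_conv_def)
  define K0 where "K0 = {k\<in>I. w k \<noteq> 0}"
  have fin0: "finite K0" using I by (simp add: K0_def)
  have "d \<le> card K0"
  proof (rule ccontr)
    assume "\<not> d \<le> card K0"
    then obtain K where K: "K0 \<subseteq> K" "K \<subseteq> I" "card K = d"
      using exists_subset_between[of K0 d I] I by (auto simp: K0_def not_le)
    have "(\<Sum>k\<in>K. w k * v k j) = (\<Sum>k\<in>I. w k * v k j)" for j
      using K I by (intro sum.mono_neutral_left) (auto simp: K0_def)
    hence "\<forall>k\<in>K. w k = 0" using ind K w(3) by (auto simp: any_d_indep_def lin_indep_fam_def)
    hence "\<forall>k\<in>I. w k = 0" using K by (auto simp: K0_def)
    thus False using w(2) by simp
  qed
  then obtain K where K: "K \<subseteq> K0" "card K = d" "finite K"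
    using obtain_subset_with_card_n[of d K0] fin0 by auto
  have KI: "K \<subseteq> I" using K by (auto simp: K0_def)
  obtain c where c: "\<forall>j<d. (\<Sum>k\<in>K. c k * v k j) = - (\<Sum>k\<in>I. v k j)"
    using lin_indep_span[of d v K "\<lambda>j. - (\<Sum>k\<in>I. v k j)"] ind K KI by (auto simp: any_d_indep_def)
  \<comment> \<open>By the choice of \<open>c\<close> these are the coefficients of a linear
    relation. A small multiple of it raises every weight outside \<open>K\<close>; on
    \<open>K\<close>, where \<open>c'\<close> may be negative, the weights are positive
    already.\<close>
  define c' where "c' = (\<lambda>k. 1 + (if k \<in> K then c k else 0))"
  have "\<forall>\<^sub>F \<delta> in at_right 0. \<forall>k\<in>I. w k + \<delta> * c' k > 0"
  proof (intro eventually_ball_finite ballI I)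
    fix k assume k: "k \<in> I"
    show "\<forall>\<^sub>F \<delta> in at_right 0. w k + \<delta> * c' k > 0"
    proof (cases "k \<in> K")
      case True
      hence "w k > 0" using K w(1) k by (auto simp: K0_def less_le)
      moreover have "((\<lambda>\<delta>. w k + \<delta> * c' k) \<longlongrightarrow> w k) (at_right 0)" by (auto intro!: tendsto_eq_intros)
      ultimately show ?thesis by (rule order_tendstoD(1)[rotated])
    next
      case False
      have "\<forall>\<^sub>F \<delta> in at_right 0. (\<delta>::real) > 0" by (rule eventually_at_right_less)
      thus ?thesis by eventually_elim (use w(1) k False in \<open>auto simp: c'_def intro: add_nonneg_pos\<close>)
    qed
  qed
  then obtain \<delta> where \<delta>: "\<forall>k\<in>I. w k + \<delta> * c' k > 0"
    using eventually_happens'[OF trivial_limit_at_right_real] by blast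
  have "(\<Sum>k\<in>I. (w k + \<delta> * c' k) * v k j) = 0" if j: "j < d" for j
  proof -
    have e: "(w k + \<delta> * c' k) * v k j = w k * v k j + \<delta> * (v k j + (if k \<in> K then c k * v k j else 0))" for k
      by (simp add: c'_def algebra_simps)
    have "(\<Sum>k\<in>I. if k \<in> K then c k * v k j else 0) = (\<Sum>k\<in>K. c k * v k j)"
      using I KI by (simp add: sum.If_cases Int_absorb1)
    thus ?thesis unfolding e using w(3) c j by (simp add: sum.distrib sum_distrib_left[symmetric])
  qed
  thus ?thesis using \<delta> by (intro exI[of _ "\<lambda>k. w k + \<delta> * c' k"]) blast
qed

text \<open>With \<open>h\<close> the identity (type A) or the absolute value (type B).\<close>

lemma flat_vals:
  assumes h: "h 0 = (0::real)" "\<And>s t. s \<in> S \<Longrightarrow> h (s * t) = h t"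
  shows "flat S N k F \<Longrightarrow> x \<in> F \<Longrightarrow> card ((\<lambda>i. h (x i)) ` {1..N} - {0}) \<le> k"
proof (induction rule: flat.induct)
  case (flat_free N k F)
  have "(\<lambda>i. h (x i)) ` {1..Suc N} - {0} \<subseteq> insert (h (x (Suc N))) ((\<lambda>i. h (x i)) ` {1..N} - {0})"
    by (auto simp: atLeastAtMostSuc_conv)
  hence "card ((\<lambda>i. h (x i)) ` {1..Suc N} - {0}) \<le> card (insert (h (x (Suc N))) ((\<lambda>i. h (x i)) ` {1..N} - {0}))"
    by (intro card_mono) auto
  also have "\<dots> \<le> Suc (card ((\<lambda>i. h (x i)) ` {1..N} - {0}))" by (intro card_insert_le_m1) auto
  finally show ?case using flat_free by simp
next
  case (flat_eq N k F l)
  have "h (x (Suc N)) = 0 \<or> h (x (Suc N)) \<in> (\<lambda>i. h (x i)) ` {1..N}"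
    using flat_eq.hyps(2) flat_eq.prems h by (auto simp: labels_def lval_def)
  hence "(\<lambda>i. h (x i)) ` {1..Suc N} - {0} = (\<lambda>i. h (x i)) ` {1..N} - {0}"
    by (auto simp: atLeastAtMostSuc_conv)
  thus ?case using flat_eq by simp
qed simp

text \<open>The grading \<open>k\<close> is a genuine dimension: the flat contains \<open>k\<close>
  vectors that are independent on the first \<open>N\<close> coordinates. A free coordinate
  contributes a unit vector; an equation determines the new entry of each old vector.\<close>

lemma flat_param:
  "flat S N k F \<Longrightarrow> \<exists>b :: nat \<Rightarrow> nat \<Rightarrow> real. \<forall>y. (\<lambda>i. \<Sum>m<k. y m * b m i) \<in> F \<and>
     ((\<forall>i\<in>{1..N}. (\<Sum>m<k. y m * b m i) = 0) \<longrightarrow> (\<forall>m<k. y m = 0))"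
proof (induction rule: flat.induct)
  case (flat_free N k F)
  then obtain b :: "nat \<Rightarrow> nat \<Rightarrow> real" where b: "\<And>y. (\<lambda>i. \<Sum>m<k. y m * b m i) \<in> F"
     "\<And>y. (\<forall>i\<in>{1..N}. (\<Sum>m<k. y m * b m i) = 0) \<Longrightarrow> (\<forall>m<k. y m = 0)" by blast
  define b' where "b' = (\<lambda>m i. if m = k then (if i = Suc N then 1 else 0) else if i = Suc N then 0 else b m i)"
  have s: "(\<Sum>m<Suc k. y m * b' m i) = (if i = Suc N then y k else (\<Sum>m<k. y m * b m i))" for y i
    by (simp add: b'_def)
  have "(\<lambda>i. \<Sum>m<Suc k. y m * b' m i) \<in> F" for y
    unfolding s by (rule flat_cong[OF flat_free.hyps b(1)[of y]]) auto
  moreover have "\<forall>m<Suc k. y m = 0" if "\<forall>i\<in>{1..Suc N}. (\<Sum>m<Suc k. y m * b' m i) = 0" for y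
  proof -
    have "y k = 0" using that s[of y "Suc N"] by auto
    moreover have "\<forall>m<k. y m = 0" using that unfolding s by (intro b(2)) force
    ultimately show ?thesis by (auto simp: less_Suc_eq)
  qed
  ultimately show ?case by blast
next
  case (flat_eq N k F l)
  then obtain b :: "nat \<Rightarrow> nat \<Rightarrow> real" where b: "\<And>y. (\<lambda>i. \<Sum>m<k. y m * b m i) \<in> F"
     "\<And>y. (\<forall>i\<in>{1..N}. (\<Sum>m<k. y m * b m i) = 0) \<Longrightarrow> (\<forall>m<k. y m = 0)" by blast
  define b' where "b' = (\<lambda>m i. if i = Suc N then lval (b m) l else b m i)"
  have ls: "lval (\<lambda>i. \<Sum>m<k. y m * b m i) l = (\<Sum>m<k. y m * lval (b m) l)" for y
    by (simp add: lval_def sum_distrib_left mult.left_commute)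
  have e: "(\<Sum>m<k. y m * b' m i) = (\<Sum>m<k. y m * b m i)" if "i \<noteq> Suc N" for y i using that by (simp add: b'_def)
  have "(\<lambda>i. \<Sum>m<k. y m * b' m i) \<in> {x \<in> F. x (Suc N) = lval x l}" for y
  proof -
    have "(\<lambda>i. \<Sum>m<k. y m * b' m i) \<in> F"
      by (rule flat_cong[OF flat_eq.hyps(1) b(1)[of y]]) (auto simp: b'_def)
    moreover have "lval (\<lambda>i. \<Sum>m<k. y m * b' m i) l = lval (\<lambda>i. \<Sum>m<k. y m * b m i) l"
      using flat_eq.hyps(2) by (intro lval_cong[of _ S N]) (auto simp: b'_def)
    ultimately show ?thesis using ls[of y] by (simp add: b'_def)
  qed
  moreover have "\<forall>m<k. y m = 0" if "\<forall>i\<in>{1..Suc N}. (\<Sum>m<k. y m * b' m i) = 0" for y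
  proof (rule b(2), rule ballI)
    fix i assume "i \<in> {1..N}"
    thus "(\<Sum>m<k. y m * b m i) = 0" using e[of i y] that by force
  qed
  ultimately show ?case by blast
qed auto

text \<open>The kernel is cut out by \<open>d\<close> equations. Trivial intersection makes the
  corresponding linear map injective on a flat of dimension \<open>d\<close>, hence onto all of
  d-space, so every \<open>z\<close> can be moved into the kernel by subtracting an element of the
  flat.\<close>

lemma generic_kernel:
  assumes I: "\<And>F x i. flat S N d F \<Longrightarrow> x \<in> F \<Longrightarrow> x \<in> kernel d v N \<Longrightarrow> i \<in> {1..N} \<Longrightarrow> x i = 0"
  shows "generic S N d (kernel d v N)"
proof (rule genI)
  have lin: "(\<Sum>i\<in>{1..N}. (a * x i + b * y i) * v i j) = a * (\<Sum>i\<in>{1..N}. x i * v i j) + b * (\<Sum>i\<in>{1..N}. y i * v i j)"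
    for a b x y j by (simp add: sum_distrib_left sum.distrib algebra_simps)
  show "lin_subspace (kernel d v N)" unfolding lin_subspace_def kernel_def mem_Collect_eq lin by simp
  show "x i = 0" if "flat S N d F" "x \<in> F" "x \<in> kernel d v N" "i \<in> {1..N}" for F x i using that by (rule I)
  fix F z assume F: "flat S N d F"
  obtain b :: "nat \<Rightarrow> nat \<Rightarrow> real" where b: "\<And>y. (\<lambda>i. \<Sum>m<d. y m * b m i) \<in> F"
     "\<And>y. (\<forall>i\<in>{1..N}. (\<Sum>m<d. y m * b m i) = 0) \<Longrightarrow> (\<forall>m<d. y m = 0)"
    using flat_param[OF F] by blast
  define V where "V = (\<lambda>m j. \<Sum>i\<in>{1..N}. b m i * v i j)"
  have V: "(\<Sum>m<d. y m * V m j) = (\<Sum>i\<in>{1..N}. (\<Sum>m<d. y m * b m i) * v i j)" for y j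
    unfolding V_def sum_distrib_left sum_distrib_right by (subst sum.swap) (simp add: mult.assoc)
  have "lin_indep_fam d V {..<d}"
    unfolding lin_indep_fam_def V
  proof (intro allI impI ballI)
    fix c :: "nat \<Rightarrow> real" and m assume h: "\<forall>j<d. (\<Sum>i\<in>{1..N}. (\<Sum>m<d. c m * b m i) * v i j) = 0" "m \<in> {..<d}"
    hence "(\<lambda>i. \<Sum>m<d. c m * b m i) \<in> kernel d v N" by (simp add: kernel_def)
    hence "\<forall>i\<in>{1..N}. (\<Sum>m<d. c m * b m i) = 0" using I[OF F b(1)[of c]] by blast
    thus "c m = 0" using b(2) h(2) by auto
  qed
  then obtain c where c: "\<forall>j<d. (\<Sum>m<d. c m * V m j) = (\<Sum>i\<in>{1..N}. z i * v i j)"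
    using lin_indep_span[of d V "{..<d}" "\<lambda>j. \<Sum>i\<in>{1..N}. z i * v i j"] by auto
  let ?f = "\<lambda>i. \<Sum>m<d. c m * b m i"
  have "(\<lambda>i. 1 * z i + (-1) * ?f i) \<in> kernel d v N"
    using c unfolding kernel_def mem_Collect_eq lin V by simp
  thus "\<exists>f\<in>F. \<exists>y\<in>kernel d v N. \<forall>i\<in>{1..N}. z i = f i + y i"
    using b(1)[of c] by (intro bexI[of _ ?f] bexI[of _ "\<lambda>i. 1 * z i + (-1) * ?f i"]) auto
qed

section \<open>Sorting permutations and Abel summation\<close>

lemma sorting_permutation:
  fixes f :: "nat \<Rightarrow> real"
  shows "\<exists>\<sigma>. \<sigma> permutes {1..n} \<and> (\<forall>i\<in>{1..n}. \<forall>j\<in>{1..n}. i \<le> j \<longrightarrow> f (\<sigma> j) \<le> f (\<sigma> i))"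
proof -
  define xs where "xs = sort_key (\<lambda>i. - f i) [1..<Suc n]"
  have xs: "length xs = n" "set xs = {1..n}" "distinct xs" "sorted (map (\<lambda>i. - f i) xs)"
    by (auto simp: xs_def simp del: upt_Suc)
  define \<sigma> where "\<sigma> = (\<lambda>i. if i \<in> {1..n} then xs ! (i - 1) else i)"
  have "bij_betw \<sigma> {1..n} {1..n}"
  proof -
    have "inj_on \<sigma> {1..n}" using xs(1,3) by (auto simp: inj_on_def \<sigma>_def nth_eq_iff_index_eq)
    moreover have "\<sigma> ` {1..n} \<subseteq> {1..n}" using xs(1,2) nth_mem[of _ xs] by (force simp: \<sigma>_def)
    ultimately show ?thesis unfolding bij_betw_def by (simp add: endo_inj_surj)
  qed
  hence "\<sigma> permutes {1..n}" by (rule bij_imp_permutes) (auto simp: \<sigma>_def)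
  moreover have "f (\<sigma> j) \<le> f (\<sigma> i)" if "i \<in> {1..n}" "j \<in> {1..n}" "i \<le> j" for i j
    using sorted_nth_mono[OF xs(4), of "i - 1" "j - 1"] that xs(1) by (auto simp: \<sigma>_def)
  ultimately show ?thesis by blast
qed

text \<open>Exactly \<open>i - 1\<close> entries exceed \<open>f (\<sigma> i)\<close>, so positions
  are ranks, and ranks depend only on the order relation.\<close>

lemma decreasing_permutation_unique:
  fixes f g :: "nat \<Rightarrow> real"
  assumes s: "\<sigma> permutes {1..n}" "\<tau> permutes {1..n}"
    and f: "\<And>i j. i \<in> {1..n} \<Longrightarrow> j \<in> {1..n} \<Longrightarrow> i < j \<Longrightarrow> f (\<sigma> j) < f (\<sigma> i)"
    and g: "\<And>i j. i \<in> {1..n} \<Longrightarrow> j \<in> {1..n} \<Longrightarrow> i < j \<Longrightarrow> g (\<tau> j) < g (\<tau> i)"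
    and fg: "\<And>i j. i \<in> {1..n} \<Longrightarrow> j \<in> {1..n} \<Longrightarrow> f i < f j \<longleftrightarrow> g i < g j"
  shows "\<sigma> = \<tau>"
proof -
  have rank: "card {j\<in>{1..n}. f j > f (\<sigma> i)} = i - 1"
    if p: "\<sigma> permutes {1..n}"
      and dec: "\<And>i j. i \<in> {1..n} \<Longrightarrow> j \<in> {1..n} \<Longrightarrow> i < j \<Longrightarrow> f (\<sigma> j) < f (\<sigma> i)"
      and i: "i \<in> {1..n}"
    for f :: "nat \<Rightarrow> real" and \<sigma> i
  proof -
    have "{j\<in>{1..n}. f j > f (\<sigma> i)} = \<sigma> ` {1..<i}"
    proof (intro equalityI subsetI)
      fix j assume j: "j \<in> {j\<in>{1..n}. f j > f (\<sigma> i)}"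
      then obtain k where k: "k \<in> {1..n}" "j = \<sigma> k" using permutes_image[OF p] by blast
      have "\<not> i \<le> k" using dec[OF i k(1)] j k by (cases "i = k") auto
      thus "j \<in> \<sigma> ` {1..<i}" using k by auto
    next
      fix j assume "j \<in> \<sigma> ` {1..<i}"
      then obtain k where k: "k \<in> {1..<i}" "j = \<sigma> k" by auto
      thus "j \<in> {j\<in>{1..n}. f j > f (\<sigma> i)}" using dec[of k i] i permutes_in_image[OF p, of k] by auto
    qed
    moreover have "inj_on \<sigma> {1..<i}" using permutes_inj[OF p] by (auto simp: inj_on_def)
    ultimately show ?thesis by (simp add: card_image)
  qed
  show ?thesis
  proof
    fix i show "\<sigma> i = \<tau> i"
    proof (cases "i \<in> {1..n}")
      case True
      hence "\<sigma> i \<in> {1..n}" using permutes_in_image[OF s(1)] by blast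
      then obtain k where k: "k \<in> {1..n}" "\<sigma> i = \<tau> k" using permutes_image[OF s(2)] by blast
      have "{j\<in>{1..n}. f j > f (\<sigma> i)} = {j\<in>{1..n}. g j > g (\<tau> k)}"
        using fg \<open>\<sigma> i \<in> {1..n}\<close> unfolding k(2) by blast
      hence "i - 1 = k - 1" using rank[where f = f and i = i, OF s(1) f True] rank[where f = g and i = k, OF s(2) g k(1)] by simp
      hence "i = k" using True k(1) by auto
      thus ?thesis using k by simp
    qed (use s in \<open>auto simp: permutes_def\<close>)
  qed
qed

lemma abel_sum:
  fixes b s :: "nat \<Rightarrow> real"
  shows "(\<Sum>k\<in>{1..m}. (b k - b (Suc k)) * (\<Sum>i\<in>{1..k}. s i)) = (\<Sum>i\<in>{1..m}. b i * s i) - b (Suc m) * (\<Sum>i\<in>{1..m}. s i)"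
  by (induction m) (simp_all add: algebra_simps)

text \<open>A nonincreasing sequence never returns to a value it has left, so each strict step
  brings a new value.\<close>

lemma antimono_steps_card:
  fixes b :: "nat \<Rightarrow> real"
  assumes "\<And>i. i \<in> {1..m} \<Longrightarrow> b (Suc i) \<le> b i"
  shows "Suc (card {k\<in>{1..m}. b k \<noteq> b (Suc k)}) \<le> card (b ` {1..Suc m})"
  using assms
proof (induction m)
  case (Suc m)
  have IH: "Suc (card {k\<in>{1..m}. b k \<noteq> b (Suc k)}) \<le> card (b ` {1..Suc m})" using Suc by auto
  have anti: "i \<le> j \<Longrightarrow> j \<le> Suc m \<Longrightarrow> 1 \<le> i \<Longrightarrow> b j \<le> b i" for i j
  proof (induction rule: dec_induct)
    case (step j) thus ?case using Suc.prems[of j] by force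
  qed simp
  show ?case
  proof (cases "b (Suc m) = b (Suc (Suc m))")
    case True
    hence "{k\<in>{1..Suc m}. b k \<noteq> b (Suc k)} = {k\<in>{1..m}. b k \<noteq> b (Suc k)}" by (auto simp: le_Suc_eq)
    moreover have "b ` {1..Suc (Suc m)} = b ` {1..Suc m}" using True by (auto simp: atLeastAtMostSuc_conv)
    ultimately show ?thesis using IH by simp
  next
    case False
    have lt: "b (Suc (Suc m)) < b (Suc m)" using False Suc.prems[of "Suc m"] by auto
    have "{k\<in>{1..Suc m}. b k \<noteq> b (Suc k)} = insert (Suc m) {k\<in>{1..m}. b k \<noteq> b (Suc k)}" using False by (auto simp: le_Suc_eq)
    moreover have "b (Suc (Suc m)) \<notin> b ` {1..Suc m}" using anti[of _ "Suc m"] lt by force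
    moreover have "b ` {1..Suc (Suc m)} = insert (b (Suc (Suc m))) (b ` {1..Suc m})" by (auto simp: atLeastAtMostSuc_conv)
    ultimately show ?thesis using IH by simp
  qed
qed simp

text \<open>Abel summation turns an element of the kernel with few distinct values into a short linear relation between
partial sums.\<close>

lemma few_values_constant:
  assumes ind: "any_d_indep d v {1..m}" and d: "d \<le> m"
    and b: "\<And>i. i \<in> {1..m} \<Longrightarrow> b (Suc i) \<le> (b i :: real)"
    and c: "card (b ` {1..Suc m}) \<le> Suc d"
    and z: "\<And>j. j < d \<Longrightarrow> (\<Sum>k\<in>{1..m}. (b k - b (Suc k)) * v k j) = 0"
    and i: "i \<in> {1..Suc m}"
  shows "b i = b (Suc m)"
proof -
  define K0 where "K0 = {k\<in>{1..m}. b k \<noteq> b (Suc k)}"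
  have "card K0 \<le> d" using antimono_steps_card[of m b] b c by (simp add: K0_def)
  \<comment> \<open>Independence is assumed for exactly \<open>d\<close> vectors, so the set of
    jumps is filled up with indices whose coefficient is zero.\<close>
  hence "\<exists>K. K0 \<subseteq> K \<and> K \<subseteq> {1..m} \<and> card K = d"
    using d by (intro exists_subset_between) (auto simp: K0_def)
  then obtain K where K: "K0 \<subseteq> K" "K \<subseteq> {1..m}" "card K = d" by blast
  have "(\<Sum>k\<in>K. (b k - b (Suc k)) * v k j) = (\<Sum>k\<in>{1..m}. (b k - b (Suc k)) * v k j)" for j
    using K by (intro sum.mono_neutral_left) (auto simp: K0_def)
  hence "\<forall>j<d. (\<Sum>k\<in>K. (b k - b (Suc k)) * v k j) = 0" using z by simp
  moreover have "lin_indep_fam d v K" using ind K by (simp add: any_d_indep_def)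
  ultimately have "\<forall>k\<in>K. b k - b (Suc k) = 0"
    unfolding lin_indep_fam_def by (elim allE[of _ "\<lambda>k. b k - b (Suc k)"]) (rule mp)
  hence e: "b k = b (Suc k)" if "k \<in> {1..m}" for k using K that by (auto simp: K0_def)
  have "i \<le> Suc m" "1 \<le> i" using i by auto
  thus ?thesis
  proof (induction rule: inc_induct)
    case (step k) thus ?case using e[of k] by auto
  qed simp
qed

section \<open>Cells and Weyl chambers\<close>

lemma cell_count_eq_card:
  assumes ex: "\<And>x. x \<in> L \<Longrightarrow> regular S N x \<Longrightarrow> \<exists>g\<in>G. C g x"
    and reg: "\<And>g x. g \<in> G \<Longrightarrow> C g x \<Longrightarrow> regular S N x"
    and eq: "\<And>g h x y. g \<in> G \<Longrightarrow> h \<in> G \<Longrightarrow> C g x \<Longrightarrow> C h y \<Longrightarrow> below S N x = below S N y \<longleftrightarrow> g = h"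
  shows "cell_count S N L = card {g\<in>G. \<exists>x\<in>L. C g x}"
proof -
  define p where "p = (\<lambda>g. SOME x. x \<in> L \<and> C g x)"
  have p: "p g \<in> L" "C g (p g)" if "\<exists>x\<in>L. C g x" for g
    using someI_ex[of "\<lambda>x. x \<in> L \<and> C g x"] that by (auto simp: p_def)
  have "bij_betw (\<lambda>g. below S N (p g)) {g\<in>G. \<exists>x\<in>L. C g x} (below S N ` {x \<in> L. regular S N x})"
    unfolding bij_betw_def
  proof
    show "inj_on (\<lambda>g. below S N (p g)) {g\<in>G. \<exists>x\<in>L. C g x}"
      using eq p by (intro inj_onI) blast
    show "(\<lambda>g. below S N (p g)) ` {g\<in>G. \<exists>x\<in>L. C g x} = below S N ` {x \<in> L. regular S N x}"
    proof (intro equalityI subsetI)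
      fix c assume "c \<in> (\<lambda>g. below S N (p g)) ` {g\<in>G. \<exists>x\<in>L. C g x}"
      then obtain g where g: "g \<in> G" "\<exists>x\<in>L. C g x" "c = below S N (p g)" by blast
      thus "c \<in> below S N ` {x \<in> L. regular S N x}" using p[OF g(2)] reg[OF g(1)] by blast
    next
      fix c assume "c \<in> below S N ` {x \<in> L. regular S N x}"
      then obtain x where x: "x \<in> L" "regular S N x" "c = below S N x" by blast
      then obtain g where g: "g \<in> G" "C g x" using ex by blast
      hence g': "\<exists>x\<in>L. C g x" using x by blast
      have "below S N (p g) = c" using eq[OF g(1) g(1) p(2)[OF g'] g(2)] x by simp
      thus "c \<in> (\<lambda>g. below S N (p g)) ` {g\<in>G. \<exists>x\<in>L. C g x}" using g(1) g' by blast
    qed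
  qed
  thus ?thesis unfolding cell_count_def by (rule bij_betw_same_card[symmetric])
qed

text \<open>One format for both types: \<open>s\<close> reads a sign, and \<open>h\<close> is the
  quantity that has to decrease along the permutation. Type B takes the sign and the absolute value.
  Type A takes a constant sign and sets the last entry to \<open>0\<close>, which chooses a
  representative modulo constant vectors.\<close>

definition chamber :: "nat \<Rightarrow> ((nat \<Rightarrow> real) \<Rightarrow> nat \<Rightarrow> real) \<Rightarrow> ((nat \<Rightarrow> real) \<Rightarrow> nat \<Rightarrow> real)
    \<Rightarrow> (nat \<Rightarrow> nat) \<times> (nat \<Rightarrow> real) \<Rightarrow> (nat \<Rightarrow> real) \<Rightarrow> bool" where
  "chamber n s h g x \<longleftrightarrow> (\<forall>i\<in>{1..n}. snd g i = s x (fst g i)) \<and>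
     (\<forall>i\<in>{1..n}. \<forall>j\<in>{1..n}. i < j \<longrightarrow> h x (fst g j) < h x (fst g i))"

section \<open>Cells as sign patterns together with an ordering: type B and the general
  correspondence\<close>

lemma sign_set_B: "sign_set {1, -1}" and sign_set_A: "sign_set {1}"
  by (auto simp: sign_set_def)

lemma regular_B:
  "regular {1, -1} n x \<longleftrightarrow> (\<forall>i\<in>{1..n}. x i \<noteq> 0) \<and> (\<forall>i\<in>{1..n}. \<forall>j\<in>{1..n}. i \<noteq> j \<longrightarrow> \<bar>x i\<bar> \<noteq> \<bar>x j\<bar>)"
  (is "_ \<longleftrightarrow> ?R")
proof
  assume r: "regular {1, -1} n x"
  have nz: "x i \<noteq> 0" if "i \<in> {1..n}" for i
    using r that zero_label[of "{1,-1}" "i - 1"] by (force simp: regular_def lval_def)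
  have lt: "\<bar>x i\<bar> \<noteq> \<bar>x j\<bar>" if "i \<in> {1..n}" "j \<in> {1..n}" "i < j" for i j
  proof -
    have "(1, i) \<in> labels {1,-1} (j - 1)" "(-1, i) \<in> labels {1,-1} (j - 1)" using that by (auto simp: labels_def)
    hence "lval x (1, i) \<noteq> x j" "lval x (-1, i) \<noteq> x j" using r that(2) by (auto simp: regular_def)
    thus ?thesis by (auto simp: lval_def abs_if split: if_splits)
  qed
  have "\<bar>x i\<bar> \<noteq> \<bar>x j\<bar>" if "i \<in> {1..n}" "j \<in> {1..n}" "i \<noteq> j" for i j
    using lt[of i j] lt[of j i] that by (cases "i < j") auto
  thus ?R using nz by blast
next
  assume R: ?R
  show "regular {1, -1} n x" unfolding regular_def
  proof (intro ballI)
    fix i l assume i: "i \<in> {1..n}" and l: "l \<in> labels {1,-1} (i - 1)"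
    consider "l = (0,0)" | s j where "l = (s, j)" "s = 1 \<or> s = -1" "j \<in> {1..i - 1}"
      using l by (auto simp: labels_def)
    thus "lval x l \<noteq> x i"
    proof cases
      case 1 thus ?thesis using R i by (auto simp: lval_def)
    next
      case 2
      hence "\<bar>x j\<bar> \<noteq> \<bar>x i\<bar>" using R i by force
      thus ?thesis using 2 by (auto simp: lval_def)
    qed
  qed
qed

lemma below_B:
  assumes r: "regular {1, -1} n x" "regular {1, -1} n y"
  shows "below {1, -1} n x = below {1, -1} n y \<longleftrightarrow>
    (\<forall>i\<in>{1..n}. sgn (x i) = sgn (y i)) \<and> (\<forall>i\<in>{1..n}. \<forall>j\<in>{1..n}. \<bar>x i\<bar> < \<bar>x j\<bar> \<longleftrightarrow> \<bar>y i\<bar> < \<bar>y j\<bar>)"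
    (is "_ \<longleftrightarrow> ?R")
proof
  assume e: "below {1, -1} n x = below {1, -1} n y"
  note ord = below_eq_order[OF sign_set_B r e]
  have nz: "x i \<noteq> 0" "y i \<noteq> 0" if "i \<in> {1..n}" for i using r that by (auto simp: regular_B)
  have s: "sgn (x i) = sgn (y i)" if i: "i \<in> {1..n}" for i
  proof -
    have "lval x (0,0) < lval x (1,i) \<longleftrightarrow> lval y (0,0) < lval y (1,i)"
      using i by (intro ord) (auto simp: labels_def)
    thus ?thesis using nz[OF i] by (auto simp: lval_def sgn_if)
  qed
  have "\<bar>x i\<bar> < \<bar>x j\<bar> \<longleftrightarrow> \<bar>y i\<bar> < \<bar>y j\<bar>" if ij: "i \<in> {1..n}" "j \<in> {1..n}" for i j
  proof -
    \<comment> \<open>The label \<open>(sgn (x i), i)\<close> has the value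
      \<open>\<bar>x i\<bar>\<close> at \<open>x\<close>, and the value
      \<open>\<bar>y i\<bar>\<close> at \<open>y\<close> because the signs agree.\<close>
    have "lval x (sgn (x i), i) < lval x (sgn (x j), j) \<longleftrightarrow> lval y (sgn (x i), i) < lval y (sgn (x j), j)"
      using ij nz by (intro ord) (auto simp: labels_def sgn_if)
    moreover have "lval x (sgn (x k), k) = \<bar>x k\<bar>" "lval y (sgn (x k), k) = \<bar>y k\<bar>" if "k \<in> {1..n}" for k
      using s[OF that] by (auto simp: lval_def abs_sgn mult.commute)
    ultimately show ?thesis using ij by simp
  qed
  thus ?R using s by blast
next
  assume R: ?R
  show "below {1, -1} n x = below {1, -1} n y" unfolding below_eq_iff
  proof (intro ballI)
    fix i l assume i: "i \<in> {1..n}" and l: "l \<in> labels {1,-1} (i - 1)"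
    have pos: "x k > 0 \<longleftrightarrow> y k > 0" "x k < 0 \<longleftrightarrow> y k < 0" "x k \<noteq> 0" "y k \<noteq> 0" if "k \<in> {1..n}" for k
    proof -
      have "sgn (x k) = sgn (y k)" using R that by blast
      thus "x k > 0 \<longleftrightarrow> y k > 0" "x k < 0 \<longleftrightarrow> y k < 0" by (auto simp: sgn_if split: if_splits)
      show "x k \<noteq> 0" "y k \<noteq> 0" using r that by (auto simp: regular_B)
    qed
    consider "l = (0,0)" | s j where "l = (s, j)" "s = 1 \<or> s = -1" "j \<in> {1..i - 1}"
      using l by (auto simp: labels_def)
    thus "lval x l < x i \<longleftrightarrow> lval y l < y i"
    proof cases
      case 1 thus ?thesis using pos[OF i] by (auto simp: lval_def)
    next
      case 2
      hence j: "j \<in> {1..n}" "i \<noteq> j" using i by auto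
      have "\<bar>x j\<bar> < \<bar>x i\<bar> \<longleftrightarrow> \<bar>y j\<bar> < \<bar>y i\<bar>" "\<bar>x i\<bar> < \<bar>x j\<bar> \<longleftrightarrow> \<bar>y i\<bar> < \<bar>y j\<bar>" using R i j by blast+
      moreover have "\<bar>x i\<bar> \<noteq> \<bar>x j\<bar>" "\<bar>y i\<bar> \<noteq> \<bar>y j\<bar>" using r i j by (auto simp: regular_B)
      ultimately have "(\<bar>x j\<bar> < \<bar>x i\<bar> \<and> \<bar>y j\<bar> < \<bar>y i\<bar>) \<or> (\<bar>x i\<bar> < \<bar>x j\<bar> \<and> \<bar>y i\<bar> < \<bar>y j\<bar>)" by linarith
      moreover have "(x k > 0 \<and> y k > 0) \<or> (x k < 0 \<and> y k < 0)" if "k \<in> {1..n}" for k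
        using pos[OF that] by linarith
      note this[OF i] this[OF j(1)]
      ultimately have "s * x j < x i \<longleftrightarrow> s * y j < y i" using 2(2)
        by (elim disjE conjE) auto
      thus ?thesis using 2 by (simp add: lval_def)
    qed
  qed
qed

lemma spermsD:
  assumes "g \<in> sperms E n"
  shows "fst g permutes {1..n}" "i \<in> {1..n} \<Longrightarrow> snd g i \<in> E" "fst g ` {1..n} = {1..n}"
    "i \<in> {1..n} \<Longrightarrow> fst g i \<in> {1..n}"
proof -
  show p: "fst g permutes {1..n}" using assms by (auto simp: sperms_def)
  show "i \<in> {1..n} \<Longrightarrow> snd g i \<in> E" using assms by (auto simp: sperms_def)
  show "fst g ` {1..n} = {1..n}" using permutes_image[OF p] .
  show "i \<in> {1..n} \<Longrightarrow> fst g i \<in> {1..n}" using permutes_in_image[OF p] by blast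
qed

text \<open>A regular point lies in exactly one chamber: sorting by \<open>h\<close> gives the
  permutation, and reading \<open>s\<close> along it gives the signs. These data and the information
  stored in a cell determine each other.\<close>

lemma cell_count_chambers:
  assumes r: "\<And>x. regular S N x \<longleftrightarrow> (\<forall>i\<in>{1..n}. s x i \<in> E) \<and> inj_on (h x) {1..n}"
    and b: "\<And>x y. regular S N x \<Longrightarrow> regular S N y \<Longrightarrow> below S N x = below S N y \<longleftrightarrow>
      (\<forall>i\<in>{1..n}. s x i = s y i) \<and> (\<forall>i\<in>{1..n}. \<forall>j\<in>{1..n}. h x i < h x j \<longleftrightarrow> h y i < h y j)"
  shows "cell_count S N L = card {g \<in> sperms E n. \<exists>x\<in>L. chamber n s h g x}"
proof -
  have dec: "h x (fst g j) < h x (fst g i)" if "i \<in> {1..n}" "j \<in> {1..n}" "i < j" "chamber n s h g x" for g x i j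
    using that unfolding chamber_def by blast
  have sg: "snd g i = s x (fst g i)" if "i \<in> {1..n}" "chamber n s h g x" for g x i
    using that unfolding chamber_def by blast
  have reg: "regular S N x" if g: "g \<in> sperms E n" and c: "chamber n s h g x" for g x
    unfolding r
  proof (intro conjI ballI inj_onI)
    fix i assume "i \<in> {1..n}"
    then obtain p where p: "p \<in> {1..n}" "i = fst g p" using spermsD(3)[OF g] by blast
    show "s x i \<in> E" unfolding p(2) using spermsD(2)[OF g p(1)] sg[OF p(1) c] by simp
    fix j assume j: "j \<in> {1..n}" "h x i = h x j"
    obtain q where q: "q \<in> {1..n}" "j = fst g q" using j spermsD(3)[OF g] by blast
    have "\<not> p < q" "\<not> q < p" using dec[OF p(1) q(1) _ c] dec[OF q(1) p(1) _ c] j(2) p(2) q(2) by auto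
    thus "i = j" using p(2) q(2) by (simp add: not_less_iff_gr_or_eq)
  qed
  show ?thesis
  proof (rule cell_count_eq_card[OF _ reg])
    fix x assume x: "regular S N x"
    obtain \<sigma> where p: "\<sigma> permutes {1..n}" "\<forall>i\<in>{1..n}. \<forall>j\<in>{1..n}. i \<le> j \<longrightarrow> h x (\<sigma> j) \<le> h x (\<sigma> i)"
      using sorting_permutation[of n "h x"] by blast
    define g where "g = (\<sigma>, \<lambda>i\<in>{1..n}. s x (\<sigma> i))"
    have \<sigma>: "\<sigma> i \<in> {1..n}" if "i \<in> {1..n}" for i using that permutes_in_image[OF p(1)] by blast
    have "g \<in> sperms E n" using p(1) x \<sigma> unfolding r by (auto simp: g_def sperms_def)
    moreover have "h x (\<sigma> j) < h x (\<sigma> i)" if "i \<in> {1..n}" "j \<in> {1..n}" "i < j" for i j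
    proof -
      have "\<sigma> i \<noteq> \<sigma> j" using that permutes_inj[OF p(1)] by (auto simp: inj_eq)
      hence "h x (\<sigma> j) \<noteq> h x (\<sigma> i)" using x \<sigma> that unfolding r inj_on_def by metis
      thus ?thesis using p(2) that less_imp_le by (metis order_le_less)
    qed
    ultimately show "\<exists>g\<in>sperms E n. chamber n s h g x" by (intro bexI[of _ g]) (auto simp: chamber_def g_def)
  next
    fix g g' x y assume gh: "g \<in> sperms E n" "g' \<in> sperms E n" and c: "chamber n s h g x" "chamber n s h g' y"
    show "below S N x = below S N y \<longleftrightarrow> g = g'"
    proof
      assume "below S N x = below S N y"
      hence e: "\<forall>i\<in>{1..n}. s x i = s y i" "\<And>i j. i \<in> {1..n} \<Longrightarrow> j \<in> {1..n} \<Longrightarrow> h x i < h x j \<longleftrightarrow> h y i < h y j"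
        unfolding b[OF reg[OF gh(1) c(1)] reg[OF gh(2) c(2)]] by auto
      have f: "fst g = fst g'"
        using spermsD(1)[OF gh(1)] spermsD(1)[OF gh(2)] dec[OF _ _ _ c(1)] dec[OF _ _ _ c(2)] e(2)
        by (rule decreasing_permutation_unique)
      have "snd g i = snd g' i" for i
      proof (cases "i \<in> {1..n}")
        case True
        thus ?thesis using sg[OF True c(1)] sg[OF True c(2)] e(1) f spermsD(4)[OF gh(1) True] by simp
      next
        case False thus ?thesis using gh by (auto simp: sperms_def PiE_def extensional_def)
      qed
      thus "g = g'" using f by (auto intro: prod_eqI)
    next
      assume "g = g'"
      hence cy: "chamber n s h g y" using c(2) by simp
      have "s x i = s y i" if i: "i \<in> {1..n}" for i
      proof -
        obtain p where p: "p \<in> {1..n}" "i = fst g p" using i spermsD(3)[OF gh(1)] by blast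
        show ?thesis unfolding p(2) using sg[OF p(1) c(1)] sg[OF p(1) cy] by simp
      qed
      moreover have "h x i < h x j \<longleftrightarrow> h y i < h y j" if i: "i \<in> {1..n}" and j: "j \<in> {1..n}" for i j
      proof -
        obtain p where p: "p \<in> {1..n}" "i = fst g p" using i spermsD(3)[OF gh(1)] by blast
        obtain q where q: "q \<in> {1..n}" "j = fst g q" using j spermsD(3)[OF gh(1)] by blast
        have "h x i < h x j \<longleftrightarrow> q < p" if "chamber n s h g x" for x
          using dec[OF p(1) q(1) _ that] dec[OF q(1) p(1) _ that] unfolding p(2) q(2)
          by (cases p q rule: linorder_cases) auto
        from this[OF c(1)] this[OF cy] show ?thesis by (rule trans[OF _ sym])
      qed
      ultimately show "below S N x = below S N y"
        unfolding b[OF reg[OF gh(1) c(1)] reg[OF gh(2) c(2)]] by blast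
    qed
  qed
qed

abbreviation chamberB :: "nat \<Rightarrow> (nat \<Rightarrow> nat) \<times> (nat \<Rightarrow> real) \<Rightarrow> (nat \<Rightarrow> real) \<Rightarrow> bool" where
  "chamberB n \<equiv> chamber n (\<lambda>x i. sgn (x i)) (\<lambda>x i. \<bar>x i\<bar>)"

abbreviation chamberA :: "nat \<Rightarrow> (nat \<Rightarrow> nat) \<times> (nat \<Rightarrow> real) \<Rightarrow> (nat \<Rightarrow> real) \<Rightarrow> bool" where
  "chamberA n \<equiv> chamber n (\<lambda>x i. 1) (\<lambda>x. x(n := 0))"

lemma cell_count_B: "cell_count {1, -1} n L = card {g \<in> sperms {1, -1} n. \<exists>x\<in>L. chamberB n g x}"
proof (rule cell_count_chambers[OF _ below_B])
  show "regular {1, -1} n x \<longleftrightarrow> (\<forall>i\<in>{1..n}. sgn (x i) \<in> {1, -1}) \<and> inj_on (\<lambda>i. \<bar>x i\<bar>) {1..n}" for x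
  proof -
    have "sgn (x i) \<in> {1, -1} \<longleftrightarrow> x i \<noteq> 0" for i by (simp add: sgn_if)
    thus ?thesis unfolding regular_B inj_on_def by (simp only:) blast
  qed
qed

section \<open>Type A: the threshold zero in the role of the last coordinate\<close>

lemma lab_A:
  assumes "i \<in> {1..Suc N}"
  obtains l where "l \<in> labels {1} N" "\<And>x. lval x l = (x(Suc N := 0)) i"
proof (cases "i = Suc N")
  case True thus ?thesis using that[of "(0,0)"] zero_label by (auto simp: lval_def)
next
  case False thus ?thesis using that[of "(1,i)"] assms by (auto simp: lval_def labels_def)
qed

lemma regular_A:
  "regular {1} N x \<longleftrightarrow> inj_on (x(Suc N := 0)) {1..Suc N}"
proof
  assume r: "regular {1} N x"
  have "(x(Suc N := 0)) i \<noteq> (x(Suc N := 0)) j" if "i \<in> {1..Suc N}" "j \<in> {1..Suc N}" "i < j" for i j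
  proof (cases "j = Suc N")
    case True
    have "lval x (0,0) \<noteq> x i" using r that True zero_label[of "{1}" "i - 1"] by (force simp: regular_def)
    thus ?thesis using True that by (auto simp: lval_def)
  next
    case False
    hence "(1, i) \<in> labels {1} (j - 1)" using that by (auto simp: labels_def)
    hence "lval x (1,i) \<noteq> x j" using r that False by (auto simp: regular_def)
    thus ?thesis using False that by (auto simp: lval_def)
  qed
  thus "inj_on (x(Suc N := 0)) {1..Suc N}" by (intro linorder_inj_onI) auto
next
  assume i: "inj_on (x(Suc N := 0)) {1..Suc N}"
  show "regular {1} N x" unfolding regular_def
  proof (intro ballI)
    fix i l assume h: "i \<in> {1..N}" "l \<in> labels {1} (i - 1)"
    consider "l = (0,0)" | j where "l = (1, j)" "j \<in> {1..i - 1}"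
      using h by (auto simp: labels_def)
    thus "lval x l \<noteq> x i"
    proof cases
      case 1 thus ?thesis using inj_onD[OF i, of i "Suc N"] h by (auto simp: lval_def)
    next
      case 2
      hence j: "j \<in> {1..N}" "i \<noteq> j" using h by auto
      thus ?thesis using inj_onD[OF i, of i j] h 2 by (auto simp: lval_def)
    qed
  qed
qed

lemma below_A:
  assumes r: "regular {1} N x" "regular {1} N y"
  shows "below {1} N x = below {1} N y \<longleftrightarrow>
    (\<forall>i\<in>{1..Suc N}. \<forall>j\<in>{1..Suc N}. (x(Suc N := 0)) i < (x(Suc N := 0)) j \<longleftrightarrow> (y(Suc N := 0)) i < (y(Suc N := 0)) j)"
    (is "_ \<longleftrightarrow> ?R")
proof
  assume e: "below {1} N x = below {1} N y"
  show ?R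
  proof (intro ballI)
    fix i j assume i: "i \<in> {1..Suc N}" and j: "j \<in> {1..Suc N}"
    obtain l where l: "l \<in> labels {1} N" "\<And>x. lval x l = (x(Suc N := 0)) i" using lab_A[OF i] by blast
    obtain m where m: "m \<in> labels {1} N" "\<And>x. lval x m = (x(Suc N := 0)) j" using lab_A[OF j] by blast
    show "(x(Suc N := 0)) i < (x(Suc N := 0)) j \<longleftrightarrow> (y(Suc N := 0)) i < (y(Suc N := 0)) j"
      using below_eq_order[OF sign_set_A r e l(1) m(1)] unfolding l(2) m(2) .
  qed
next
  assume R: ?R
  show "below {1} N x = below {1} N y" unfolding below_eq_iff
  proof (intro ballI)
    fix i l assume h: "i \<in> {1..N}" "l \<in> labels {1} (i - 1)"
    consider "l = (0,0)" | j where "l = (1, j)" "j \<in> {1..i - 1}"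
      using h by (auto simp: labels_def)
    thus "lval x l < x i \<longleftrightarrow> lval y l < y i"
    proof cases
      case 1 thus ?thesis using R[rule_format, of "Suc N" i] h by (auto simp: lval_def)
    next
      case 2
      hence j: "j \<in> {1..N}" using h by auto
      thus ?thesis using R[rule_format, of j i] h 2 by (auto simp: lval_def)
    qed
  qed
qed

lemma cell_count_A: "cell_count {1} N L = card {g \<in> sperms {1} (Suc N). \<exists>x\<in>L. chamberA (Suc N) g x}"
proof (rule cell_count_chambers)
  show "regular {1} N x \<longleftrightarrow> (\<forall>i\<in>{1..Suc N}. 1 \<in> {1 :: real}) \<and> inj_on (x(Suc N := 0)) {1..Suc N}" for x
    unfolding regular_A by blast
qed (unfold below_A, blast)

section \<open>Counting chambers that meet a generic kernel\<close>

lemma strict_decreasing: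
  fixes b :: "nat \<Rightarrow> real"
  assumes "\<And>i. i \<in> {1..m} \<Longrightarrow> b (Suc i) < b i" and "1 \<le> i" "i < j" "j \<le> Suc m"
  shows "b j < b i"
  using assms(3,4)
proof (induction j rule: less_induct)
  case (less j)
  then obtain k where k: "j = Suc k" "i \<le> k" by (cases j) auto
  have "b j < b k" using assms(1)[of k] k less.prems assms(2) by auto
  thus ?case using less.IH[of k] k less.prems by (cases "i = k") auto
qed

lemma zero_in_convI:
  assumes I: "finite I" "I \<noteq> {}" and w: "\<And>k. k \<in> I \<Longrightarrow> w k > 0"
    and z: "\<And>j. j < d \<Longrightarrow> (\<Sum>k\<in>I. w k * v k j) = 0"
  shows "zero_in_conv d v I"
proof -
  define W where "W = (\<Sum>k\<in>I. w k)"
  have W: "W > 0" unfolding W_def using I w by (intro sum_pos) auto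
  have "(\<Sum>k\<in>I. w k / W) = 1" using W by (simp add: sum_divide_distrib[symmetric] W_def)
  moreover have "(\<Sum>k\<in>I. w k / W * v k j) = 0" if "j < d" for j
    using z[OF that] by (simp add: sum_divide_distrib[symmetric])
  ultimately show ?thesis unfolding zero_in_conv_def using w W
    by (intro exI[of _ "\<lambda>k. w k / W"]) (auto intro: less_imp_le)
qed

lemma tail_sum:
  fixes w :: "nat \<Rightarrow> real"
  assumes w: "\<And>k. k \<in> {1..m} \<Longrightarrow> w k > 0"
  defines "b \<equiv> \<lambda>i. \<Sum>k\<in>{i..m}. w k"
  shows "b (Suc m) = 0" "\<And>i. i \<in> {1..m} \<Longrightarrow> b i - b (Suc i) = w i"
    "\<And>i j. 1 \<le> i \<Longrightarrow> i < j \<Longrightarrow> j \<le> Suc m \<Longrightarrow> b j < b i"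
proof -
  show "b (Suc m) = 0" by (simp add: b_def)
  show e: "b i - b (Suc i) = w i" if "i \<in> {1..m}" for i
    using that by (simp add: b_def sum.atLeast_Suc_atMost)
  show "b j < b i" if "1 \<le> i" "i < j" "j \<le> Suc m" for i j
  proof (rule strict_decreasing[of m b, OF _ that])
    fix k assume "k \<in> {1..m}"
    thus "b (Suc k) < b k" using e[of k] w[of k] by simp
  qed
qed

lemma abel_signed_sum:
  "(\<Sum>k\<in>{1..m}. (b k - b (Suc k)) * signed_sum \<epsilon> \<sigma> v k j) =
     (\<Sum>i\<in>{1..m}. b i * (\<epsilon> i * v (\<sigma> i) j)) - b (Suc m) * signed_sum \<epsilon> \<sigma> v m j"
  unfolding signed_sum_def by (rule abel_sum)

lemma sum_perm:
  fixes f :: "nat \<Rightarrow> real"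
  assumes "\<sigma> permutes {1..n}"
  shows "(\<Sum>i\<in>{1..n}. f (\<sigma> i)) = (\<Sum>i\<in>{1..n}. f i)"
  using sum.permute[OF assms, of f] by (simp add: comp_def)

text \<open>Abel summation turns hull weights into gaps: the weight of the partial sum
  \<open>k\<close> is the difference of the absolute values at positions \<open>k\<close> and
  \<open>k + 1\<close> of the sorted kernel vector, the sequence ending in \<open>0\<close>.
  Positive weights thus describe the open chamber, and \<open>zero_in_conv_pos\<close> supplies
  positivity.\<close>

lemma zero_in_conv_chamberB:
  assumes g: "g \<in> sperms {1, -1} n" and n: "n > 0" and d: "d \<le> n"
    and ind: "any_d_indep d (signed_sum (snd g) (fst g) v) {1..n}"
  shows "zero_in_conv d (signed_sum (snd g) (fst g) v) {1..n} \<longleftrightarrow> (\<exists>x\<in>kernel d v n. chamberB n g x)"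
proof -
  obtain \<sigma> \<epsilon> where ge: "g = (\<sigma>, \<epsilon>)" by (cases g)
  have p: "\<sigma> permutes {1..n}" and e: "\<And>i. i \<in> {1..n} \<Longrightarrow> \<epsilon> i = 1 \<or> \<epsilon> i = -1"
    using spermsD(1,2)[OF g] ge by auto
  show ?thesis
  proof
    assume "zero_in_conv d (signed_sum (snd g) (fst g) v) {1..n}"
    then obtain w where w: "\<And>k. k \<in> {1..n} \<Longrightarrow> w k > 0" "\<And>j. j < d \<Longrightarrow> (\<Sum>k\<in>{1..n}. w k * signed_sum \<epsilon> \<sigma> v k j) = 0"
      using zero_in_conv_pos[OF ind] d unfolding ge fst_conv snd_conv by (metis card_atLeastAtMost diff_Suc_1 finite_atLeastAtMost)
    define b where "b = (\<lambda>i. \<Sum>k\<in>{i..n}. w k)"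
    have b: "b (Suc n) = 0" "\<And>i. i \<in> {1..n} \<Longrightarrow> b i - b (Suc i) = w i"
      "\<And>i j. 1 \<le> i \<Longrightarrow> i < j \<Longrightarrow> j \<le> Suc n \<Longrightarrow> b j < b i"
      using tail_sum[of n w, OF w(1)] unfolding b_def by blast+
    define x where "x = (\<lambda>i. \<epsilon> (inv \<sigma> i) * b (inv \<sigma> i))"
    have x: "x (\<sigma> i) = \<epsilon> i * b i" for i by (simp add: x_def permutes_inverses(2)[OF p])
    have bpos: "b i > 0" if "i \<in> {1..n}" for i using b(3)[of i "Suc n"] b(1) that by auto
    have ax: "\<bar>x (\<sigma> i)\<bar> = b i" "\<epsilon> i = sgn (x (\<sigma> i))" if "i \<in> {1..n}" for i
      using e[OF that] bpos[OF that] by (auto simp: x abs_mult sgn_mult)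
    have "chamberB n g x" unfolding chamber_def ge using ax b(3) by auto
    moreover have "(\<Sum>i\<in>{1..n}. x i * v i j) = 0" if "j < d" for j
    proof -
      have "(\<Sum>i\<in>{1..n}. x i * v i j) = (\<Sum>i\<in>{1..n}. x (\<sigma> i) * v (\<sigma> i) j)"
        by (rule sum_perm[OF p, symmetric])
      also have "\<dots> = (\<Sum>i\<in>{1..n}. b i * (\<epsilon> i * v (\<sigma> i) j))" by (simp add: x mult_ac)
      also have "\<dots> = (\<Sum>k\<in>{1..n}. (b k - b (Suc k)) * signed_sum \<epsilon> \<sigma> v k j)"
        unfolding abel_signed_sum b(1) by simp
      also have "\<dots> = (\<Sum>k\<in>{1..n}. w k * signed_sum \<epsilon> \<sigma> v k j)" by (intro sum.cong) (auto simp: b(2))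
      finally show ?thesis using w(2)[OF that] by simp
    qed
    ultimately show "\<exists>x\<in>kernel d v n. chamberB n g x" by (intro bexI[of _ x]) (auto simp: kernel_def)
  next
    assume "\<exists>x\<in>kernel d v n. chamberB n g x"
    then obtain x where x: "x \<in> kernel d v n" "chamberB n g x" by blast
    \<comment> \<open>The final value \<open>0\<close> removes the boundary term of Abel summation
      and makes the last weight the smallest absolute value.\<close>
    define b where "b = (\<lambda>i. if i \<in> {1..n} then \<bar>x (\<sigma> i)\<bar> else 0)"
    have sg: "\<epsilon> i = sgn (x (\<sigma> i))" if "i \<in> {1..n}" for i using x(2) that by (auto simp: chamber_def ge)
    have bs: "b i * \<epsilon> i = x (\<sigma> i)" if "i \<in> {1..n}" for i
      using that by (simp add: b_def sg abs_mult_sgn)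
    have dec: "b (Suc i) < b i" if i: "i \<in> {1..n}" for i
    proof (cases "i = n")
      case True
      have "x (\<sigma> i) \<noteq> 0" using e[OF i] sg[OF i] by auto
      thus ?thesis using True i by (simp add: b_def)
    next
      case False thus ?thesis using x(2) i by (auto simp: b_def chamber_def ge)
    qed
    show "zero_in_conv d (signed_sum (snd g) (fst g) v) {1..n}"
    proof (rule zero_in_convI[of _ "\<lambda>k. b k - b (Suc k)"])
      fix j assume j: "j < d"
      have "(\<Sum>k\<in>{1..n}. (b k - b (Suc k)) * signed_sum \<epsilon> \<sigma> v k j) = (\<Sum>i\<in>{1..n}. b i * (\<epsilon> i * v (\<sigma> i) j))"
        unfolding abel_signed_sum by (simp add: b_def)
      also have "\<dots> = (\<Sum>i\<in>{1..n}. x (\<sigma> i) * v (\<sigma> i) j)"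
        by (intro sum.cong) (simp_all add: bs mult.assoc[symmetric])
      also have "\<dots> = (\<Sum>i\<in>{1..n}. x i * v i j)" by (rule sum_perm[OF p])
      also have "\<dots> = 0" using x(1) j by (simp add: kernel_def)
      finally show "(\<Sum>k\<in>{1..n}. (b k - b (Suc k)) * signed_sum (snd g) (fst g) v k j) = 0" by (simp add: ge)
    qed (use n dec in auto)
  qed
qed

lemma zero_in_conv_chamberA:
  assumes g: "g \<in> sperms {1} (Suc N)" and N: "N > 0" and d: "d \<le> N"
    and ind: "any_d_indep d (signed_sum (snd g) (fst g) v) {1..N}"
    and vz: "\<And>j. j < d \<Longrightarrow> (\<Sum>i\<in>{1..Suc N}. v i j) = 0"
  shows "zero_in_conv d (signed_sum (snd g) (fst g) v) {1..N} \<longleftrightarrow> (\<exists>x\<in>kernel d v N. chamberA (Suc N) g x)"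
proof -
  obtain \<sigma> \<epsilon> where ge: "g = (\<sigma>, \<epsilon>)" by (cases g)
  have p: "\<sigma> permutes {1..Suc N}" and e: "\<And>i. i \<in> {1..Suc N} \<Longrightarrow> \<epsilon> i = 1"
    using spermsD(1,2)[OF g] ge by auto
  have total: "signed_sum \<epsilon> \<sigma> v (Suc N) j = 0" if "j < d" for j
  proof -
    have "signed_sum \<epsilon> \<sigma> v (Suc N) j = (\<Sum>i\<in>{1..Suc N}. v (\<sigma> i) j)"
      unfolding signed_sum_def using e by (intro sum.cong) auto
    also have "\<dots> = (\<Sum>i\<in>{1..Suc N}. v i j)" by (rule sum_perm[OF p])
    finally show ?thesis using vz[OF that] by simp
  qed
  \<comment> \<open>As the vectors sum to zero, the boundary term of Abel summation is exactly the
    missing summand with index \<open>Suc N\<close>.\<close>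
  have abel: "(\<Sum>k\<in>{1..N}. (b k - b (Suc k)) * signed_sum \<epsilon> \<sigma> v k j) = (\<Sum>i\<in>{1..Suc N}. b i * v (\<sigma> i) j)"
    if j: "j < d" for b j
  proof -
    have "(\<Sum>k\<in>{1..N}. (b k - b (Suc k)) * signed_sum \<epsilon> \<sigma> v k j)
        = (\<Sum>i\<in>{1..N}. b i * (\<epsilon> i * v (\<sigma> i) j)) - b (Suc N) * signed_sum \<epsilon> \<sigma> v N j" by (rule abel_signed_sum)
    also have "signed_sum \<epsilon> \<sigma> v N j = - (\<epsilon> (Suc N) * v (\<sigma> (Suc N)) j)"
      using total[OF j] by (simp add: signed_sum_def)
    also have "(\<Sum>i\<in>{1..N}. b i * (\<epsilon> i * v (\<sigma> i) j)) - b (Suc N) * - (\<epsilon> (Suc N) * v (\<sigma> (Suc N)) j)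
        = (\<Sum>i\<in>{1..Suc N}. b i * (\<epsilon> i * v (\<sigma> i) j))" by simp
    also have "\<dots> = (\<Sum>i\<in>{1..Suc N}. b i * v (\<sigma> i) j)" using e by (intro sum.cong) auto
    finally show ?thesis .
  qed
  show ?thesis
  proof
    assume "zero_in_conv d (signed_sum (snd g) (fst g) v) {1..N}"
    then obtain w where w: "\<And>k. k \<in> {1..N} \<Longrightarrow> w k > 0" "\<And>j. j < d \<Longrightarrow> (\<Sum>k\<in>{1..N}. w k * signed_sum \<epsilon> \<sigma> v k j) = 0"
      using zero_in_conv_pos[OF ind] d unfolding ge fst_conv snd_conv by (metis card_atLeastAtMost diff_Suc_1 finite_atLeastAtMost)
    define b where "b = (\<lambda>i. \<Sum>k\<in>{i..N}. w k)"
    have b: "b (Suc N) = 0" "\<And>i. i \<in> {1..N} \<Longrightarrow> b i - b (Suc i) = w i"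
      "\<And>i j. 1 \<le> i \<Longrightarrow> i < j \<Longrightarrow> j \<le> Suc N \<Longrightarrow> b j < b i"
      using tail_sum[of N w, OF w(1)] unfolding b_def by blast+
    define y where "y = (\<lambda>i. b (inv \<sigma> i))"
    \<comment> \<open>Because the vectors sum to zero, subtracting a constant from all entries
      preserves the relation. This constant makes the last entry vanish, so that only
      \<open>N\<close> coordinates remain.\<close>
    define x where "x = (\<lambda>i. y i - y (Suc N))"
    have y: "y (\<sigma> i) = b i" for i by (simp add: y_def permutes_inverses(2)[OF p])
    have xu: "x(Suc N := 0) = x" by (auto simp: x_def)
    have "chamberA (Suc N) g x" unfolding chamber_def xu ge using b(3) e by (auto simp: x_def y)
    moreover have "(\<Sum>i\<in>{1..N}. x i * v i j) = 0" if j: "j < d" for j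
    proof -
      have "(\<Sum>i\<in>{1..N}. x i * v i j) = (\<Sum>i\<in>{1..Suc N}. x i * v i j)" by (simp add: x_def)
      also have "\<dots> = (\<Sum>i\<in>{1..Suc N}. y i * v i j) - y (Suc N) * (\<Sum>i\<in>{1..Suc N}. v i j)"
        by (simp only: x_def left_diff_distrib sum_subtractf sum_distrib_left)
      also have "\<dots> = (\<Sum>i\<in>{1..Suc N}. y i * v i j)" using vz[OF j] by simp
      also have "\<dots> = (\<Sum>i\<in>{1..Suc N}. y (\<sigma> i) * v (\<sigma> i) j)" by (rule sum_perm[OF p, symmetric])
      also have "\<dots> = (\<Sum>k\<in>{1..N}. (b k - b (Suc k)) * signed_sum \<epsilon> \<sigma> v k j)" unfolding y abel[OF j] ..
      also have "\<dots> = (\<Sum>k\<in>{1..N}. w k * signed_sum \<epsilon> \<sigma> v k j)" by (intro sum.cong) (auto simp: b(2))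
      finally show ?thesis using w(2)[OF j] by simp
    qed
    ultimately show "\<exists>x\<in>kernel d v N. chamberA (Suc N) g x" by (intro bexI[of _ x]) (auto simp: kernel_def)
  next
    assume "\<exists>x\<in>kernel d v N. chamberA (Suc N) g x"
    then obtain x where x: "x \<in> kernel d v N" "chamberA (Suc N) g x" by blast
    define b where "b = (\<lambda>i. (x(Suc N := 0)) (\<sigma> i))"
    have dec: "b (Suc i) < b i" if i: "i \<in> {1..N}" for i
      using x(2) i unfolding b_def chamber_def ge by (auto simp del: fun_upd_apply)
    show "zero_in_conv d (signed_sum (snd g) (fst g) v) {1..N}"
    proof (rule zero_in_convI[of _ "\<lambda>k. b k - b (Suc k)"])
      fix j assume j: "j < d"
      have "(\<Sum>k\<in>{1..N}. (b k - b (Suc k)) * signed_sum \<epsilon> \<sigma> v k j) = (\<Sum>i\<in>{1..Suc N}. (x(Suc N := 0)) (\<sigma> i) * v (\<sigma> i) j)"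
        using abel[OF j, of b] by (simp only: b_def)
      also have "\<dots> = (\<Sum>i\<in>{1..Suc N}. (x(Suc N := 0)) i * v i j)" by (rule sum_perm[OF p])
      also have "\<dots> = (\<Sum>i\<in>{1..N}. x i * v i j)" by simp
      also have "\<dots> = 0" using x(1) j by (simp add: kernel_def)
      finally show "(\<Sum>k\<in>{1..N}. (b k - b (Suc k)) * signed_sum (snd g) (fst g) v k j) = 0" by (simp add: ge)
    qed (use N dec in auto)
  qed
qed

section \<open>Genericity of the kernel and the number of chambers it meets\<close>

lemma card_insert_zero:
  assumes "finite A" "card (A - {0 :: real}) \<le> d" "B \<subseteq> insert 0 A"
  shows "card B \<le> Suc d"
proof -
  have "card B \<le> card (insert 0 (A - {0}))" using assms by (intro card_mono) auto
  also have "\<dots> \<le> Suc (card (A - {0}))" by (rule card_insert_le_m1) auto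
  finally show ?thesis using assms(2) by linarith
qed

text \<open>A vector on a flat of dimension \<open>d\<close> has at most \<open>d\<close> nonzero
  absolute values. Sorted and closed with \<open>0\<close> they make at most \<open>d\<close> jumps,
  so the relation between partial sums obtained from the kernel is too short to be nontrivial, and
  all values equal the final \<open>0\<close>.\<close>

lemma generic_B:
  assumes d: "d \<le> n" and ind: "\<And>g. g \<in> sperms {1, -1} n \<Longrightarrow> any_d_indep d (signed_sum (snd g) (fst g) v) {1..n}"
  shows "generic {1, -1} n d (kernel d v n)"
proof (rule generic_kernel)
  fix F x i assume F: "flat {1, -1} n d F" "x \<in> F" and x: "x \<in> kernel d v n" and i: "i \<in> {1..n}"
  have vals: "card ((\<lambda>i. \<bar>x i\<bar>) ` {1..n} - {0}) \<le> d"
    by (rule flat_vals[OF _ _ F]) (auto simp: abs_mult)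
  obtain \<sigma> where s: "\<sigma> permutes {1..n}" "\<forall>i\<in>{1..n}. \<forall>j\<in>{1..n}. i \<le> j \<longrightarrow> \<bar>x (\<sigma> j)\<bar> \<le> \<bar>x (\<sigma> i)\<bar>"
    using sorting_permutation[of n "\<lambda>i. \<bar>x i\<bar>"] by blast
  \<comment> \<open>A zero entry receives the sign \<open>1\<close>, since a signed permutation has
    no zero signs; the product with the absolute value is unaffected.\<close>
  define \<epsilon> where "\<epsilon> = (\<lambda>i\<in>{1..n}. if x (\<sigma> i) < 0 then -1 else 1 :: real)"
  define b where "b = (\<lambda>i. if i \<in> {1..n} then \<bar>x (\<sigma> i)\<bar> else 0)"
  have "(\<sigma>, \<epsilon>) \<in> sperms {1, -1} n" using s(1) by (auto simp: sperms_def \<epsilon>_def)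
  note ind' = ind[OF this, unfolded fst_conv snd_conv]
  have "b j = b (Suc n)" if "j \<in> {1..Suc n}" for j
  proof (rule few_values_constant[OF ind' d _ _ _ that])
    show "b (Suc i) \<le> b i" if "i \<in> {1..n}" for i using s(2) that by (auto simp: b_def)
    show "card (b ` {1..Suc n}) \<le> Suc d"
      by (rule card_insert_zero[OF _ vals]) (use permutes_in_image[OF s(1)] in \<open>auto simp: b_def\<close>)
    show "(\<Sum>k\<in>{1..n}. (b k - b (Suc k)) * signed_sum \<epsilon> \<sigma> v k j) = 0" if j: "j < d" for j
    proof -
      have "(\<Sum>k\<in>{1..n}. (b k - b (Suc k)) * signed_sum \<epsilon> \<sigma> v k j) = (\<Sum>i\<in>{1..n}. b i * (\<epsilon> i * v (\<sigma> i) j))"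
        unfolding abel_signed_sum by (simp add: b_def)
      also have "\<dots> = (\<Sum>i\<in>{1..n}. x (\<sigma> i) * v (\<sigma> i) j)"
        by (intro sum.cong) (auto simp: b_def \<epsilon>_def)
      also have "\<dots> = (\<Sum>i\<in>{1..n}. x i * v i j)" by (rule sum_perm[OF s(1)])
      also have "\<dots> = 0" using x j by (simp add: kernel_def)
      finally show ?thesis .
    qed
  qed
  note const = this
  obtain p where p: "p \<in> {1..n}" "i = \<sigma> p" using i permutes_image[OF s(1)] by blast
  thus "x i = 0" using const[of p] by (auto simp: b_def)
qed

lemma generic_A:
  assumes d: "d \<le> N" and ind: "\<And>g. g \<in> sperms {1} (Suc N) \<Longrightarrow> any_d_indep d (signed_sum (snd g) (fst g) v) {1..N}"
    and vz: "\<And>j. j < d \<Longrightarrow> (\<Sum>i\<in>{1..Suc N}. v i j) = 0"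
  shows "generic {1} N d (kernel d v N)"
proof (rule generic_kernel)
  fix F x i assume F: "flat {1} N d F" "x \<in> F" and x: "x \<in> kernel d v N" and i: "i \<in> {1..N}"
  have vals: "card (x ` {1..N} - {0}) \<le> d"
    using flat_vals[of "\<lambda>x. x", OF _ _ F] by auto
  let ?x = "x(Suc N := 0)"
  obtain \<sigma> where s: "\<sigma> permutes {1..Suc N}" "\<forall>i\<in>{1..Suc N}. \<forall>j\<in>{1..Suc N}. i \<le> j \<longrightarrow> ?x (\<sigma> j) \<le> ?x (\<sigma> i)"
    using sorting_permutation[of "Suc N" ?x] by blast
  define \<epsilon> where "\<epsilon> = (\<lambda>i\<in>{1..Suc N}. 1 :: real)"
  define b where "b = (\<lambda>i. ?x (\<sigma> i))"
  have "(\<sigma>, \<epsilon>) \<in> sperms {1} (Suc N)" using s(1) by (auto simp: sperms_def \<epsilon>_def)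
  note ind' = ind[OF this, unfolded fst_conv snd_conv]
  have const: "b j = b (Suc N)" if "j \<in> {1..Suc N}" for j
  proof (rule few_values_constant[OF ind' d _ _ _ that])
    show "b (Suc i) \<le> b i" if "i \<in> {1..N}" for i
      unfolding b_def using that by (intro s(2)[rule_format]) auto
    have "b ` {1..Suc N} = ?x ` \<sigma> ` {1..Suc N}" unfolding b_def image_image ..
    also have "\<dots> = ?x ` {1..Suc N}" unfolding permutes_image[OF s(1)] ..
    also have "\<dots> \<subseteq> insert 0 (x ` {1..N})" by auto
    finally show "card (b ` {1..Suc N}) \<le> Suc d" by (rule card_insert_zero[OF _ vals, rotated]) auto
    show "(\<Sum>k\<in>{1..N}. (b k - b (Suc k)) * signed_sum \<epsilon> \<sigma> v k j) = 0" if j: "j < d" for j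
    proof -
      have "signed_sum \<epsilon> \<sigma> v (Suc N) j = (\<Sum>i\<in>{1..Suc N}. v (\<sigma> i) j)"
        unfolding signed_sum_def by (intro sum.cong) (auto simp: \<epsilon>_def)
      also have "\<dots> = 0" using sum_perm[OF s(1), of "\<lambda>i. v i j"] vz[OF j] by simp
      finally have w: "signed_sum \<epsilon> \<sigma> v N j = - v (\<sigma> (Suc N)) j" by (simp add: signed_sum_def \<epsilon>_def)
      have "(\<Sum>k\<in>{1..N}. (b k - b (Suc k)) * signed_sum \<epsilon> \<sigma> v k j)
        = (\<Sum>i\<in>{1..N}. b i * (\<epsilon> i * v (\<sigma> i) j)) + b (Suc N) * v (\<sigma> (Suc N)) j"
        unfolding abel_signed_sum w by simp
      also have "(\<Sum>i\<in>{1..N}. b i * (\<epsilon> i * v (\<sigma> i) j)) = (\<Sum>i\<in>{1..N}. b i * v (\<sigma> i) j)"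
        by (intro sum.cong) (auto simp: \<epsilon>_def)
      also have "(\<Sum>i\<in>{1..N}. b i * v (\<sigma> i) j) + b (Suc N) * v (\<sigma> (Suc N)) j = (\<Sum>i\<in>{1..Suc N}. ?x (\<sigma> i) * v (\<sigma> i) j)"
        unfolding b_def by (simp del: fun_upd_apply)
      also have "\<dots> = (\<Sum>i\<in>{1..Suc N}. ?x i * v i j)" by (rule sum_perm[OF s(1)])
      also have "\<dots> = 0" using x j by (simp add: kernel_def)
      finally show ?thesis .
    qed
  qed
  have ex: "\<exists>p\<in>{1..Suc N}. k = \<sigma> p" if "k \<in> {1..Suc N}" for k using that permutes_image[OF s(1)] by blast
  have "?x k = b (Suc N)" if k: "k \<in> {1..Suc N}" for k
  proof -
    obtain p where p: "p \<in> {1..Suc N}" "k = \<sigma> p" using ex[OF k] by blast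
    show ?thesis using const[OF p(1)] by (simp only: p(2) b_def)
  qed
  \<comment> \<open>All entries are equal, and the normalised one is \<open>0\<close>.\<close>
  from this[of i] this[of "Suc N"] show "x i = 0" using i by auto
qed

lemma card_sperms: "finite E \<Longrightarrow> card (sperms E n) = fact n * card E ^ n"
  by (simp add: sperms_def card_cartesian_product card_permutations card_PiE)

lemma finite_sperms: "finite E \<Longrightarrow> finite (sperms E n)"
  by (auto simp: sperms_def intro!: finite_cartesian_product finite_permutations finite_PiE)

lemma card_sperms_B: "real (card (sperms {1, -1} n)) = total_cells 2 n"
proof -
  have "total_cells 2 n = fact n * 2 ^ n" by (induction n) (auto simp: total_cells_def algebra_simps)
  thus ?thesis by (simp add: card_sperms)
qed

lemma card_sperms_A: "real (card (sperms {1} (Suc N))) = total_cells 1 N"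
proof -
  have "total_cells 1 N = fact (Suc N)" by (induction N) (auto simp: total_cells_def algebra_simps)
  thus ?thesis by (simp add: card_sperms del: fact_Suc One_nat_def)
qed

lemma count_B:
  assumes "n > 0" and d: "d \<le> n"
    and ind: "\<And>g. g \<in> sperms {1, -1} n \<Longrightarrow> any_d_indep d (signed_sum (snd g) (fst g) v) {1..n}"
  shows "real (card {g \<in> sperms {1, -1} n. zero_in_conv d (signed_sum (snd g) (fst g) v) {1..n}}) =
    real (card (sperms {1, -1} n)) * (1 - bless 2 n d)"
proof -
  have "{g \<in> sperms {1, -1} n. zero_in_conv d (signed_sum (snd g) (fst g) v) {1..n}} =
    {g \<in> sperms {1, -1} n. \<exists>x\<in>kernel d v n. chamberB n g x}"
    using zero_in_conv_chamberB[OF _ assms(1) d ind] by blast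
  thus ?thesis using cell_count_B[of n "kernel d v n"] cell_count_eq[OF sign_set_B generic_B[OF d ind] d]
    by (simp add: card_sperms_B numeral_2_eq_2)
qed

lemma count_A:
  assumes "N > 0" and d: "d \<le> N"
    and ind: "\<And>g. g \<in> sperms {1} (Suc N) \<Longrightarrow> any_d_indep d (signed_sum (snd g) (fst g) v) {1..N}"
    and vz: "\<And>j. j < d \<Longrightarrow> (\<Sum>i\<in>{1..Suc N}. v i j) = 0"
  shows "real (card {g \<in> sperms {1} (Suc N). zero_in_conv d (signed_sum (snd g) (fst g) v) {1..N}}) =
    real (card (sperms {1} (Suc N))) * (1 - bless 1 N d)"
proof -
  have "{g \<in> sperms {1} (Suc N). zero_in_conv d (signed_sum (snd g) (fst g) v) {1..N}} =
    {g \<in> sperms {1} (Suc N). \<exists>x\<in>kernel d v N. chamberA (Suc N) g x}"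
    using zero_in_conv_chamberA[OF _ assms(1) d ind vz] by blast
  thus ?thesis using cell_count_A[of N "kernel d v N"] cell_count_eq[OF sign_set_A generic_A[OF d ind vz] d]
    by (simp add: card_sperms_A)
qed

section \<open>Measurability and averaging\<close>

lemma bounded_subsequence_finite:
  fixes w :: "nat \<Rightarrow> 'k \<Rightarrow> real"
  assumes "finite K" and "\<And>m k. k \<in> K \<Longrightarrow> \<bar>w m k\<bar> \<le> B"
  shows "\<exists>r l. strict_mono r \<and> (\<forall>k\<in>K. (\<lambda>m. w (r m) k) \<longlonglongrightarrow> l k)"
  using assms
proof (induction K rule: finite_induct)
  case empty
  thus ?case by (intro exI[of _ id]) (auto simp: strict_mono_id)
next
  case (insert p K)
  then obtain r l where r: "strict_mono r" "\<forall>k\<in>K. (\<lambda>m. w (r m) k) \<longlonglongrightarrow> l k" by auto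
  have "bounded (range (\<lambda>m. w (r m) p))" using insert.prems[of p] by (intro boundedI[of _ B]) auto
  then obtain l' s where s: "strict_mono s" "((\<lambda>m. w (r m) p) \<circ> s) \<longlonglongrightarrow> l'"
    using bounded_imp_convergent_subsequence by blast
  have "(\<lambda>m. w ((r \<circ> s) m) k) \<longlonglongrightarrow> (l(p := l')) k" if "k \<in> insert p K" for k
  proof (cases "k = p")
    case True thus ?thesis using s(2) by (simp add: comp_def)
  next
    case False
    thus ?thesis using LIMSEQ_subseq_LIMSEQ[OF _ s(1), of "\<lambda>m. w (r m) k" "l k"] r(2) that by (auto simp: comp_def)
  qed
  thus ?case using strict_mono_o[OF r(1) s(1)] by blast
qed

text \<open>Membership of \<open>0\<close> in the hull quantifies over uncountably many weights; approximation by rational weights together with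
compactness makes it a measurable event.\<close>

definition almost_zero_in_conv :: "nat \<Rightarrow> (nat \<Rightarrow> nat \<Rightarrow> real) \<Rightarrow> nat set \<Rightarrow> real \<Rightarrow> (nat \<Rightarrow> real) \<Rightarrow> bool" where
  "almost_zero_in_conv d v K \<delta> q \<longleftrightarrow> \<bar>(\<Sum>k\<in>K. q k) - 1\<bar> < \<delta> \<and> (\<forall>j<d. \<bar>\<Sum>k\<in>K. q k * v k j\<bar> < \<delta>)"

lemma zero_in_conv_approx:
  assumes K: "finite K"
  shows "zero_in_conv d v K \<longleftrightarrow>
    (\<forall>m. \<exists>q\<in>K \<rightarrow>\<^sub>E (\<rat> \<inter> {0..}). almost_zero_in_conv d v K (1 / Suc m) q)"
proof
  assume "zero_in_conv d v K"
  then obtain w where w: "\<forall>k\<in>K. w k \<ge> 0" "(\<Sum>k\<in>K. w k) = 1" "\<forall>j<d. (\<Sum>k\<in>K. w k * v k j) = 0"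
    by (auto simp: zero_in_conv_def)
  show "\<forall>m. \<exists>q\<in>K \<rightarrow>\<^sub>E (\<rat> \<inter> {0..}). almost_zero_in_conv d v K (1 / Suc m) q"
  proof
    fix m
    define \<delta> where "\<delta> = 1 / real (Suc m)"
    \<comment> \<open>The same bound covers the coefficients \<open>1\<close> of the total weight
      and \<open>v k j\<close> of every coordinate, so one \<open>\<eta>\<close> controls all
      errors.\<close>
    define C where "C = (\<Sum>k\<in>K. 1 + (\<Sum>j<d. \<bar>v k j\<bar>))"
    define \<eta> where "\<eta> = \<delta> / (C + 1)"
    have C: "C \<ge> 0" unfolding C_def by (intro sum_nonneg add_nonneg_nonneg) auto
    have \<delta>: "\<delta> > 0" by (simp add: \<delta>_def)
    have \<eta>: "\<eta> > 0" "\<eta> * C < \<delta>" using C \<delta> by (auto simp: \<eta>_def field_simps)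
    \<comment> \<open>Approximation from above keeps the rational weights nonnegative.\<close>
    have "\<forall>k. \<exists>r\<in>\<rat>. w k < r \<and> r < w k + \<eta>" using \<eta> by (intro allI Rats_dense_in_real) auto
    then obtain r where r: "\<And>k. r k \<in> \<rat>" "\<And>k. w k < r k" "\<And>k. r k < w k + \<eta>" by metis
    have close: "\<bar>(\<Sum>k\<in>K. r k * c k) - (\<Sum>k\<in>K. w k * c k)\<bar> < \<delta>"
      if c: "\<And>k. k \<in> K \<Longrightarrow> \<bar>c k\<bar> \<le> 1 + (\<Sum>j<d. \<bar>v k j\<bar>)" for c :: "nat \<Rightarrow> real"
    proof -
      have "\<bar>(\<Sum>k\<in>K. r k * c k) - (\<Sum>k\<in>K. w k * c k)\<bar> = \<bar>\<Sum>k\<in>K. (r k - w k) * c k\<bar>"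
        by (simp add: sum_subtractf left_diff_distrib)
      also have "\<dots> \<le> (\<Sum>k\<in>K. \<bar>(r k - w k) * c k\<bar>)" by (rule sum_abs)
      also have "\<dots> \<le> (\<Sum>k\<in>K. \<eta> * (1 + (\<Sum>j<d. \<bar>v k j\<bar>)))"
      proof (rule sum_mono)
        fix k assume "k \<in> K"
        have "\<bar>r k - w k\<bar> \<le> \<eta>" using r(2)[of k] r(3)[of k] by linarith
        thus "\<bar>(r k - w k) * c k\<bar> \<le> \<eta> * (1 + (\<Sum>j<d. \<bar>v k j\<bar>))"
          unfolding abs_mult using c[OF \<open>k \<in> K\<close>] \<eta> by (intro mult_mono) auto
      qed
      also have "\<dots> = \<eta> * C" by (simp add: C_def sum_distrib_left)
      finally show ?thesis using \<eta> by linarith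
    qed
    have 1: "\<bar>(\<Sum>k\<in>K. r k) - 1\<bar> < \<delta>" using close[of "\<lambda>_. 1"] w(2) by (simp add: sum_nonneg)
    have 2: "\<bar>\<Sum>k\<in>K. r k * v k j\<bar> < \<delta>" if j: "j < d" for j
    proof -
      have "\<bar>v k j\<bar> \<le> 1 + (\<Sum>j<d. \<bar>v k j\<bar>)" for k
        using member_le_sum[of j "{..<d}" "\<lambda>j. \<bar>v k j\<bar>"] j by simp
      thus ?thesis using close[of "\<lambda>k. v k j"] w(3) j by simp
    qed
    have "restrict r K \<in> K \<rightarrow>\<^sub>E (\<rat> \<inter> {0..})"
    proof (rule PiE_I)
      fix k assume "k \<in> K"
      hence "0 \<le> r k" using w(1) r(2)[of k] by force
      thus "restrict r K k \<in> \<rat> \<inter> {0..}" using r(1) \<open>k \<in> K\<close> by simp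
    qed simp
    moreover have "almost_zero_in_conv d v K \<delta> (restrict r K)"
      using 1 2 by (simp add: almost_zero_in_conv_def)
    ultimately show "\<exists>q\<in>K \<rightarrow>\<^sub>E (\<rat> \<inter> {0..}). almost_zero_in_conv d v K (1 / Suc m) q"
      unfolding \<delta>_def by blast
  qed
next
  assume "\<forall>m. \<exists>q\<in>K \<rightarrow>\<^sub>E (\<rat> \<inter> {0..}). almost_zero_in_conv d v K (1 / Suc m) q"
  then obtain q where q: "\<And>m. q m \<in> K \<rightarrow>\<^sub>E (\<rat> \<inter> {0..})" "\<And>m. almost_zero_in_conv d v K (1 / Suc m) (q m)" by metis
  have nonneg: "q m k \<ge> 0" if "k \<in> K" for m k using q(1)[of m] that by auto
  have bd: "\<bar>q m k\<bar> \<le> 2" if k: "k \<in> K" for m k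
  proof -
    have "q m k \<le> (\<Sum>k\<in>K. q m k)" using member_le_sum[of k K "q m"] nonneg k K by auto
    also have "\<dots> \<le> 1 + 1 / Suc m" using q(2)[of m] unfolding almost_zero_in_conv_def by linarith
    also have "\<dots> \<le> 2" by simp
    finally show ?thesis using nonneg[OF k, of m] by simp
  qed
  obtain r l where r: "strict_mono r" "\<And>k. k \<in> K \<Longrightarrow> (\<lambda>m. q (r m) k) \<longlonglongrightarrow> l k"
    using bounded_subsequence_finite[OF K, of q 2] bd by blast
  have z: "(\<lambda>m. 1 / real (Suc (r m))) \<longlonglongrightarrow> 0"
    using LIMSEQ_subseq_LIMSEQ[OF LIMSEQ_Suc[OF lim_1_over_n] r(1)] by (simp add: comp_def)
  have "l k \<ge> 0" if "k \<in> K" for k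
    using LIMSEQ_le_const[OF r(2)[OF that], of 0] nonneg[OF that] by blast
  moreover have "(\<Sum>k\<in>K. l k) = 1"
  proof -
    have "(\<lambda>m. (\<Sum>k\<in>K. q (r m) k) - 1) \<longlonglongrightarrow> 0"
      by (rule Lim_null_comparison[OF _ z])
         (use q(2) in \<open>auto simp: almost_zero_in_conv_def intro!: always_eventually less_imp_le\<close>)
    moreover have "(\<lambda>m. (\<Sum>k\<in>K. q (r m) k) - 1) \<longlonglongrightarrow> (\<Sum>k\<in>K. l k) - 1"
      using r(2) by (intro tendsto_intros) auto
    ultimately have "(\<Sum>k\<in>K. l k) - 1 = 0" by (rule LIMSEQ_unique[rotated])
    thus ?thesis by simp
  qed
  moreover have "(\<Sum>k\<in>K. l k * v k j) = 0" if j: "j < d" for j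
  proof -
    have "(\<lambda>m. \<Sum>k\<in>K. q (r m) k * v k j) \<longlonglongrightarrow> 0"
      by (rule Lim_null_comparison[OF _ z])
         (use q(2) j in \<open>auto simp: almost_zero_in_conv_def intro!: always_eventually less_imp_le\<close>)
    moreover have "(\<lambda>m. \<Sum>k\<in>K. q (r m) k * v k j) \<longlonglongrightarrow> (\<Sum>k\<in>K. l k * v k j)"
      using r(2) by (intro tendsto_intros) auto
    ultimately show ?thesis by (rule LIMSEQ_unique[rotated])
  qed
  ultimately show "zero_in_conv d v K" unfolding zero_in_conv_def by blast
qed

lemma measurable_zero_in_conv:
  assumes K: "finite K" and V: "\<And>k j. k \<in> K \<Longrightarrow> j < d \<Longrightarrow> (\<lambda>\<omega>. V \<omega> k j) \<in> borel_measurable M"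
  shows "{\<omega> \<in> space M. zero_in_conv d (V \<omega>) K} \<in> sets M"
proof -
  let ?Q = "K \<rightarrow>\<^sub>E (\<rat> \<inter> {0..}) :: (nat \<Rightarrow> real) set"
  have Q: "countable ?Q" using K by (intro countable_PiE) (auto simp: countable_rat)
  have m: "{\<omega> \<in> space M. almost_zero_in_conv d (V \<omega>) K \<delta> q} \<in> sets M" for \<delta> q
  proof -
    have f: "(\<lambda>\<omega>. \<bar>\<Sum>k\<in>K. q k * V \<omega> k j\<bar>) \<in> borel_measurable M" if "j < d" for j
      using V that by (intro borel_measurable_abs borel_measurable_sum borel_measurable_times) auto
    have A: "{\<omega> \<in> space M. \<forall>j\<in>{..<d}. \<bar>\<Sum>k\<in>K. q k * V \<omega> k j\<bar> < \<delta>} \<in> sets M" (is "?A \<in> _")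
    proof (rule sets.sets_Collect_finite_All)
      fix j assume "j \<in> {..<d}"
      thus "{\<omega> \<in> space M. \<bar>\<Sum>k\<in>K. q k * V \<omega> k j\<bar> < \<delta>} \<in> sets M"
        using f[of j] by (intro borel_measurable_less borel_measurable_const) simp_all
    qed simp
    have "{\<omega> \<in> space M. almost_zero_in_conv d (V \<omega>) K \<delta> q} =
      (if \<bar>(\<Sum>k\<in>K. q k) - 1\<bar> < \<delta> then ?A else {})"
      unfolding almost_zero_in_conv_def by auto
    also have "\<dots> \<in> sets M" using A by simp
    finally show ?thesis .
  qed
  have "{\<omega> \<in> space M. zero_in_conv d (V \<omega>) K} =
    {\<omega> \<in> space M. \<forall>m. \<exists>q\<in>?Q. almost_zero_in_conv d (V \<omega>) K (1 / Suc m) q}"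
    using zero_in_conv_approx[OF K] by blast
  also have "\<dots> \<in> sets M"
    by (intro sets.sets_Collect_countable_All sets.sets_Collect_countable_Ex'[OF _ Q] m)
  finally show ?thesis .
qed

text \<open>The absolute coefficients of a nontrivial relation, normalised to sum one, are hull
  weights for the vectors with adjusted signs. There are finitely many sign patterns, so
  measurability of independence reduces to that of the hull event.\<close>

lemma not_lin_indep_iff:
  assumes K: "finite K"
  shows "\<not> lin_indep_fam d v K \<longleftrightarrow> (\<exists>s\<in>K \<rightarrow>\<^sub>E {-1, 1}. zero_in_conv d (\<lambda>k j. s k * v k j) K)"
proof
  assume "\<not> lin_indep_fam d v K"
  then obtain c p where c: "\<And>j. j < d \<Longrightarrow> (\<Sum>k\<in>K. c k * v k j) = 0" "p \<in> K" "c p \<noteq> 0"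
    unfolding lin_indep_fam_def by blast
  define s where "s = (\<lambda>k\<in>K. if c k < 0 then -1 else 1 :: real)"
  define W where "W = (\<Sum>k\<in>K. \<bar>c k\<bar>)"
  have "\<bar>c p\<bar> \<le> W" unfolding W_def using c(2) K by (intro member_le_sum) auto
  hence W: "W > 0" using c(3) by linarith
  have cs: "\<bar>c k\<bar> * (s k * x) = c k * x" if "k \<in> K" for k x using that by (simp add: s_def)
  have "zero_in_conv d (\<lambda>k j. s k * v k j) K" unfolding zero_in_conv_def
  proof (intro exI[of _ "\<lambda>k. \<bar>c k\<bar> / W"] conjI ballI allI impI)
    show "(\<Sum>k\<in>K. \<bar>c k\<bar> / W) = 1" using W by (simp add: sum_divide_distrib[symmetric] W_def)
    fix j assume j: "j < d"
    have "(\<Sum>k\<in>K. \<bar>c k\<bar> / W * (s k * v k j)) = (\<Sum>k\<in>K. c k * v k j) / W"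
      unfolding sum_divide_distrib by (intro sum.cong refl) (simp add: cs)
    thus "(\<Sum>k\<in>K. \<bar>c k\<bar> / W * (s k * v k j)) = 0" using c(1)[OF j] by simp
  qed (use W in auto)
  moreover have "s \<in> K \<rightarrow>\<^sub>E {-1, 1}" by (auto simp: s_def)
  ultimately show "\<exists>s\<in>K \<rightarrow>\<^sub>E {-1, 1}. zero_in_conv d (\<lambda>k j. s k * v k j) K" by blast
next
  assume "\<exists>s\<in>K \<rightarrow>\<^sub>E {-1, 1}. zero_in_conv d (\<lambda>k j. s k * v k j) K"
  then obtain s w where s: "s \<in> K \<rightarrow>\<^sub>E {-1, 1}" and w: "(\<Sum>k\<in>K. w k) = 1" "\<forall>j<d. (\<Sum>k\<in>K. w k * (s k * v k j)) = 0"
    unfolding zero_in_conv_def by blast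
  show "\<not> lin_indep_fam d v K"
  proof
    assume "lin_indep_fam d v K"
    moreover have "\<forall>j<d. (\<Sum>k\<in>K. (w k * s k) * v k j) = 0" using w(2) by (simp add: mult.assoc)
    ultimately have h: "\<forall>k\<in>K. w k * s k = 0"
      unfolding lin_indep_fam_def by (elim allE[of _ "\<lambda>k. w k * s k"]) (rule mp)
    have "w k = 0" if "k \<in> K" for k
    proof -
      have "s k \<in> {-1, 1}" using s that by blast
      moreover have "w k * s k = 0" using h that by blast
      ultimately show ?thesis by auto
    qed
    thus False using w(1) by simp
  qed
qed

lemma measurable_lin_indep:
  assumes K: "finite K" and V: "\<And>k j. k \<in> K \<Longrightarrow> j < d \<Longrightarrow> (\<lambda>\<omega>. V \<omega> k j) \<in> borel_measurable M"
  shows "{\<omega> \<in> space M. lin_indep_fam d (V \<omega>) K} \<in> sets M"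
proof -
  have fin: "finite (K \<rightarrow>\<^sub>E {-1, 1 :: real})" using K by (intro finite_PiE) auto
  have "{\<omega> \<in> space M. \<exists>s\<in>K \<rightarrow>\<^sub>E {-1, 1}. zero_in_conv d (\<lambda>k j. s k * V \<omega> k j) K} \<in> sets M"
    using V by (intro sets.sets_Collect_finite_Ex[OF _ fin] measurable_zero_in_conv[OF K]) auto
  hence "space M - {\<omega> \<in> space M. \<exists>s\<in>K \<rightarrow>\<^sub>E {-1, 1}. zero_in_conv d (\<lambda>k j. s k * V \<omega> k j) K} \<in> sets M"
    by (rule sets.compl_sets)
  also have "space M - {\<omega> \<in> space M. \<exists>s\<in>K \<rightarrow>\<^sub>E {-1, 1}. zero_in_conv d (\<lambda>k j. s k * V \<omega> k j) K}
    = {\<omega> \<in> space M. lin_indep_fam d (V \<omega>) K}"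
    using not_lin_indep_iff[OF K] by blast
  finally show ?thesis .
qed

lemma measurable_any_d_indep:
  assumes I: "finite I" and V: "\<And>k j. k \<in> I \<Longrightarrow> j < d \<Longrightarrow> (\<lambda>\<omega>. V \<omega> k j) \<in> borel_measurable M"
  shows "{\<omega> \<in> space M. any_d_indep d (V \<omega>) I} \<in> sets M"
proof -
  have "{\<omega> \<in> space M. \<forall>K\<in>{K. K \<subseteq> I \<and> card K = d}. lin_indep_fam d (V \<omega>) K} \<in> sets M"
    using I V by (intro sets.sets_Collect_finite_All measurable_lin_indep) (auto intro: finite_subset)
  thus ?thesis by (simp add: any_d_indep_def)
qed

section \<open>Events determined by the law of the tuple\<close>

definition lin_comb :: "nat \<Rightarrow> (nat \<Rightarrow> nat \<Rightarrow> real) \<Rightarrow> (nat \<Rightarrow> nat \<Rightarrow> real) \<Rightarrow> nat \<Rightarrow> nat \<Rightarrow> real" where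
  "lin_comb n A v k j = (\<Sum>i\<in>{1..n}. A k i * v i j)"

text \<open>Invariance is a statement about \<open>tuple_law\<close>, which sees only the entries
  with \<open>i \<in> {1..n}\<close> and \<open>j < d\<close>. A property can be transported if it
  ignores all other values and is measurable on the product space.\<close>

definition tuple_event :: "nat \<Rightarrow> nat \<Rightarrow> ((nat \<Rightarrow> nat \<Rightarrow> real) \<Rightarrow> bool) \<Rightarrow> bool" where
  "tuple_event n d P \<longleftrightarrow>
     (\<forall>v v'. (\<forall>i\<in>{1..n}. \<forall>j<d. v i j = v' i j) \<longrightarrow> P v = P v') \<and>
     {y \<in> space (PiM ({1..n} \<times> {..<d}) (\<lambda>_. borel :: real measure)). P (\<lambda>i j. y (i, j))}
       \<in> sets (PiM ({1..n} \<times> {..<d}) (\<lambda>_. borel))"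

lemma zero_in_conv_cong:
  assumes "\<And>k j. k \<in> K \<Longrightarrow> j < d \<Longrightarrow> v k j = v' k j"
  shows "zero_in_conv d v K = zero_in_conv d v' K"
proof -
  have "(\<forall>j<d. (\<Sum>k\<in>K. w k * v k j) = 0) \<longleftrightarrow> (\<forall>j<d. (\<Sum>k\<in>K. w k * v' k j) = 0)" for w
    using assms by (auto cong: sum.cong)
  thus ?thesis unfolding zero_in_conv_def by simp
qed

lemma any_d_indep_cong:
  assumes "\<And>k j. k \<in> I \<Longrightarrow> j < d \<Longrightarrow> v k j = v' k j"
  shows "any_d_indep d v I = any_d_indep d v' I"
proof -
  have "lin_indep_fam d v K = lin_indep_fam d v' K" if "K \<subseteq> I" for K
  proof -
    have "(\<forall>j<d. (\<Sum>k\<in>K. c k * v k j) = 0) \<longleftrightarrow> (\<forall>j<d. (\<Sum>k\<in>K. c k * v' k j) = 0)" for c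
    proof -
      have "(\<Sum>k\<in>K. c k * v k j) = (\<Sum>k\<in>K. c k * v' k j)" if "j < d" for j
        using assms[OF _ that] \<open>K \<subseteq> I\<close> by (intro sum.cong) auto
      thus ?thesis by simp
    qed
    thus ?thesis unfolding lin_indep_fam_def by simp
  qed
  thus ?thesis unfolding any_d_indep_def by auto
qed

lemma measurable_lin_comb:
  assumes "j < d"
  shows "(\<lambda>y. lin_comb n A (\<lambda>i j. y (i, j)) k j) \<in> borel_measurable (PiM ({1..n} \<times> {..<d}) (\<lambda>_. borel))"
  unfolding lin_comb_def using assms
  by (intro borel_measurable_sum borel_measurable_times borel_measurable_const measurable_component_singleton) auto

lemma lin_comb_cong: "(\<And>i. i \<in> {1..n} \<Longrightarrow> v i j = v' i j) \<Longrightarrow> lin_comb n A v k j = lin_comb n A v' k j"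
  by (simp add: lin_comb_def)

lemma tuple_event_zero_in_conv:
  assumes "finite K" and F: "\<And>v k j. k \<in> K \<Longrightarrow> F v k j = lin_comb n A v k j"
  shows "tuple_event n d (\<lambda>v. zero_in_conv d (F v) K)"
proof -
  have e: "zero_in_conv d (F v) K = zero_in_conv d (lin_comb n A v) K" for v
    using F by (intro zero_in_conv_cong) auto
  show ?thesis unfolding tuple_event_def e
    using assms(1) by (intro conjI allI impI zero_in_conv_cong lin_comb_cong measurable_zero_in_conv measurable_lin_comb) auto
qed

lemma tuple_event_any_d_indep:
  assumes "finite I" and F: "\<And>v k j. k \<in> I \<Longrightarrow> F v k j = lin_comb n A v k j"
  shows "tuple_event n d (\<lambda>v. any_d_indep d (F v) I)"
proof -
  have e: "any_d_indep d (F v) I = any_d_indep d (lin_comb n A v) I" for v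
    using F by (intro any_d_indep_cong) auto
  show ?thesis unfolding tuple_event_def e
    using assms(1) by (intro conjI allI impI any_d_indep_cong lin_comb_cong measurable_any_d_indep measurable_lin_comb) auto
qed

definition rv_tuple :: "'a measure \<Rightarrow> nat \<Rightarrow> nat \<Rightarrow> (nat \<Rightarrow> 'a \<Rightarrow> nat \<Rightarrow> real) \<Rightarrow> bool" where
  "rv_tuple M n d X \<longleftrightarrow> (\<forall>i\<in>{1..n}. \<forall>j<d. (\<lambda>\<omega>. X i \<omega> j) \<in> borel_measurable M)"

lemma tuple_event_law:
  assumes P: "tuple_event n d P" and X: "rv_tuple M n d X"
  shows "{\<omega> \<in> space M. P (\<lambda>i. X i \<omega>)} \<in> sets M"
    "measure M {\<omega> \<in> space M. P (\<lambda>i. X i \<omega>)} = measure (tuple_law M n d X)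
      {y \<in> space (PiM ({1..n} \<times> {..<d}) (\<lambda>_. borel :: real measure)). P (\<lambda>i j. y (i, j))}"
proof -
  let ?N = "PiM ({1..n} \<times> {..<d}) (\<lambda>_. borel :: real measure)"
  let ?T = "\<lambda>\<omega>. restrict (\<lambda>(i, j). X i \<omega> j) ({1..n} \<times> {..<d})"
  let ?A = "{y \<in> space ?N. P (\<lambda>i j. y (i, j))}"
  have T: "?T \<in> measurable M ?N"
    using X by (intro measurable_restrict) (auto simp: rv_tuple_def)
  have A: "?A \<in> sets ?N" using P by (simp add: tuple_event_def)
  have "P (\<lambda>i. X i \<omega>) = P (\<lambda>i j. ?T \<omega> (i, j))" for \<omega>
  proof -
    have "\<forall>v v'. (\<forall>i\<in>{1..n}. \<forall>j<d. v i j = v' i j) \<longrightarrow> P v = P v'" using P by (simp add: tuple_event_def)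
    thus ?thesis by (elim allE[of _ "\<lambda>i. X i \<omega>"] allE[of _ "\<lambda>i j. ?T \<omega> (i, j)"]) auto
  qed
  hence e: "{\<omega> \<in> space M. P (\<lambda>i. X i \<omega>)} = ?T -` ?A \<inter> space M"
    using measurable_space[OF T] by auto
  show "{\<omega> \<in> space M. P (\<lambda>i. X i \<omega>)} \<in> sets M" unfolding e using T A by (rule measurable_sets)
  show "measure M {\<omega> \<in> space M. P (\<lambda>i. X i \<omega>)} = measure (tuple_law M n d X) ?A"
    unfolding e tuple_law_def using T A by (rule measure_distr[symmetric])
qed

lemma tuple_event_eq_law:
  assumes "tuple_event n d P" "rv_tuple M n d X" "rv_tuple M n d Y" "tuple_law M n d X = tuple_law M n d Y"
  shows "measure M {\<omega> \<in> space M. P (\<lambda>i. X i \<omega>)} = measure M {\<omega> \<in> space M. P (\<lambda>i. Y i \<omega>)}"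
  using tuple_event_law(2)[OF assms(1,2)] tuple_event_law(2)[OF assms(1,3)] assms(4) by simp

lemma tuple_event_AE:
  assumes M: "prob_space M" and P: "tuple_event n d P" and X: "rv_tuple M n d X" and Y: "rv_tuple M n d Y"
    and law: "tuple_law M n d X = tuple_law M n d Y" and ae: "AE \<omega> in M. P (\<lambda>i. X i \<omega>)"
  shows "AE \<omega> in M. P (\<lambda>i. Y i \<omega>)"
proof -
  interpret prob_space M by fact
  have "prob {\<omega> \<in> space M. P (\<lambda>i. X i \<omega>)} = 1"
    using prob_Collect_eq_1[OF tuple_event_law(1)[OF P X]] ae by simp
  hence "prob {\<omega> \<in> space M. P (\<lambda>i. Y i \<omega>)} = 1" using tuple_event_eq_law[OF P X Y law] by simp
  thus ?thesis using prob_Collect_eq_1[OF tuple_event_law(1)[OF P Y]] by simp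
qed

section \<open>Counting events in expectation\<close>

lemma (in prob_space) sum_prob_eq_expectation_card:
  assumes G: "finite G" and A: "\<And>g. g \<in> G \<Longrightarrow> {\<omega> \<in> space M. Q g \<omega>} \<in> events"
  shows "(\<Sum>g\<in>G. prob {\<omega> \<in> space M. Q g \<omega>}) = expectation (\<lambda>\<omega>. real (card {g \<in> G. Q g \<omega>}))"
    "integrable M (\<lambda>\<omega>. real (card {g \<in> G. Q g \<omega>}))"
proof -
  have i: "integrable M (indicat_real {\<omega> \<in> space M. Q g \<omega>})" if "g \<in> G" for g
    using A[OF that] by (simp add: emeasure_eq_measure)
  have c: "real (card {g \<in> G. Q g \<omega>}) = (\<Sum>g\<in>G. indicator {\<omega> \<in> space M. Q g \<omega>} \<omega>)" if "\<omega> \<in> space M" for \<omega>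
    using G that by (simp add: indicator_def of_bool_def sum.If_cases Int_def)
  have "(\<Sum>g\<in>G. prob {\<omega> \<in> space M. Q g \<omega>}) = (\<Sum>g\<in>G. expectation (indicat_real {\<omega> \<in> space M. Q g \<omega>}))"
    by (intro sum.cong) (auto simp: A)
  also have "\<dots> = expectation (\<lambda>\<omega>. \<Sum>g\<in>G. indicator {\<omega> \<in> space M. Q g \<omega>} \<omega>)"
    using i by (intro Bochner_Integration.integral_sum[symmetric]) auto
  also have "\<dots> = expectation (\<lambda>\<omega>. real (card {g \<in> G. Q g \<omega>}))"
    by (intro Bochner_Integration.integral_cong) (auto simp: c)
  finally show "(\<Sum>g\<in>G. prob {\<omega> \<in> space M. Q g \<omega>}) = expectation (\<lambda>\<omega>. real (card {g \<in> G. Q g \<omega>}))" .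
  have "integrable M (\<lambda>\<omega>. \<Sum>g\<in>G. indicat_real {\<omega> \<in> space M. Q g \<omega>} \<omega>)" using i by auto
  thus "integrable M (\<lambda>\<omega>. real (card {g \<in> G. Q g \<omega>}))"
    by (subst Bochner_Integration.integrable_cong[OF refl c]) auto
qed

section \<open>Probabilities for the three types\<close>

definition psums :: "(nat \<Rightarrow> nat \<Rightarrow> real) \<Rightarrow> nat \<Rightarrow> nat \<Rightarrow> real" where
  "psums v k j = (\<Sum>i\<in>{1..k}. v i j)"

definition act :: "(nat \<Rightarrow> nat) \<times> (nat \<Rightarrow> real) \<Rightarrow> (nat \<Rightarrow> nat \<Rightarrow> real) \<Rightarrow> nat \<Rightarrow> nat \<Rightarrow> real" where
  "act g v i j = snd g i * v (fst g i) j"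

lemma psums_act: "psums (act g v) = signed_sum (snd g) (fst g) v"
  by (intro ext) (simp add: psums_def act_def signed_sum_def)

lemma psum_eq_psums: "psum X k \<omega> = psums (\<lambda>i. X i \<omega>) k"
  by (intro ext) (simp add: psum_def psums_def)

lemma psums_lin_comb: "k \<le> n \<Longrightarrow> psums v k j = lin_comb n (\<lambda>k i. of_bool (i \<le> k)) v k j"
  unfolding psums_def lin_comb_def by (intro sum.mono_neutral_cong_left) auto

lemma tuple_event_psums:
  assumes "m \<le> n"
  shows "tuple_event n d (\<lambda>v. zero_in_conv d (psums v) {1..m})"
    "tuple_event n d (\<lambda>v. any_d_indep d (psums v) {1..m})"
  using assms psums_lin_comb[of _ n]
  by (auto intro!: tuple_event_zero_in_conv[of _ psums] tuple_event_any_d_indep[of _ psums])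

lemma type_assms_rv:
  assumes "type_assms T n d M X"
  shows "prob_space M" "rv_tuple M n d X"
  using assms by (auto simp: type_assms_def rv_tuple_def)

lemma type_assms_act:
  assumes ta: "type_assms T n d M X" and P: "tuple_event n d P"
    and g: "fst g permutes {1..n}" "admissible_signs T n (snd g)"
  shows "{\<omega> \<in> space M. P (act g (\<lambda>i. X i \<omega>))} \<in> sets M"
    "measure M {\<omega> \<in> space M. P (act g (\<lambda>i. X i \<omega>))} = measure M {\<omega> \<in> space M. P (\<lambda>i. X i \<omega>)}"
    "(AE \<omega> in M. P (\<lambda>i. X i \<omega>)) \<Longrightarrow> AE \<omega> in M. P (act g (\<lambda>i. X i \<omega>))"
proof -
  let ?Y = "signed_perm (snd g) (fst g) X"
  have X: "rv_tuple M n d X" using type_assms_rv[OF ta] by simp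
  have Y: "rv_tuple M n d ?Y" unfolding rv_tuple_def
  proof (intro ballI allI impI)
    fix i j assume i: "i \<in> {1..n}" and j: "j < d"
    have "fst g i \<in> {1..n}" using i permutes_in_image[OF g(1)] by blast
    hence "(\<lambda>\<omega>. X (fst g i) \<omega> j) \<in> borel_measurable M" using X j by (simp add: rv_tuple_def)
    thus "(\<lambda>\<omega>. ?Y i \<omega> j) \<in> borel_measurable M" by (simp add: signed_perm_def)
  qed
  have law: "tuple_law M n d X = tuple_law M n d ?Y" using ta g by (simp add: type_assms_def)
  have e: "act g (\<lambda>i. X i \<omega>) = (\<lambda>i. ?Y i \<omega>)" for \<omega>
    by (intro ext) (simp add: act_def signed_perm_def)
  show "{\<omega> \<in> space M. P (act g (\<lambda>i. X i \<omega>))} \<in> sets M" unfolding e by (rule tuple_event_law(1)[OF P Y])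
  show "measure M {\<omega> \<in> space M. P (act g (\<lambda>i. X i \<omega>))} = measure M {\<omega> \<in> space M. P (\<lambda>i. X i \<omega>)}"
    unfolding e by (rule tuple_event_eq_law[OF P X Y law, symmetric])
  show "AE \<omega> in M. P (act g (\<lambda>i. X i \<omega>))" if "AE \<omega> in M. P (\<lambda>i. X i \<omega>)"
    unfolding e by (rule tuple_event_AE[OF type_assms_rv(1)[OF ta] P X Y law that])
qed

text \<open>Invariance makes the events equally likely, and the number of them that occur is almost
  surely constant. Its expectation therefore gives the common probability, whatever the
  distribution.\<close>

lemma (in prob_space) prob_by_averaging:
  assumes G: "finite G" "G \<noteq> {}" and A: "\<And>g. g \<in> G \<Longrightarrow> {\<omega> \<in> space M. Q g \<omega>} \<in> events"
    and p: "\<And>g. g \<in> G \<Longrightarrow> prob {\<omega> \<in> space M. Q g \<omega>} = p"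
    and c: "AE \<omega> in M. real (card {g \<in> G. Q g \<omega>}) = real (card G) * c"
  shows "p = c"
proof -
  have "real (card G) * p = (\<Sum>g\<in>G. prob {\<omega> \<in> space M. Q g \<omega>})" using p by simp
  also have "\<dots> = expectation (\<lambda>\<omega>. real (card {g \<in> G. Q g \<omega>}))"
    by (rule sum_prob_eq_expectation_card[OF G(1) A])
  also have "\<dots> = expectation (\<lambda>_. real (card G) * c)"
    using sum_prob_eq_expectation_card(2)[OF G(1) A] c by (intro integral_cong_AE) auto
  also have "\<dots> = real (card G) * c" by (simp add: prob_space)
  finally show ?thesis using G by simp
qed

lemma (in prob_space) prob_not:
  assumes "{\<omega> \<in> space M. P \<omega>} \<in> events"
  shows "prob {\<omega> \<in> space M. \<not> P \<omega>} = 1 - prob {\<omega> \<in> space M. P \<omega>}"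
proof -
  have "{\<omega> \<in> space M. \<not> P \<omega>} = space M - {\<omega> \<in> space M. P \<omega>}" by blast
  thus ?thesis using prob_compl[OF assms] by simp
qed

lemma sperms_nonempty: "E \<noteq> {} \<Longrightarrow> sperms E n \<noteq> {}"
  by (auto simp: sperms_def PiE_eq_empty_iff intro: permutes_id)

text \<open>The map \<open>e\<close> sends the averaging group to admissible transformations; it is
  the identity for types A and B, while in type D signed permutations of fewer vectors are extended.
  \<open>R\<close> holds an almost sure fact besides independence, namely the vanishing total in
  type A.\<close>

lemma prob_orbit_average:
  assumes ta: "type_assms T n d M X" and Q: "tuple_event n d Q" and I: "tuple_event n d I"
    and E: "finite E" "E \<noteq> {}"
    and adm: "\<And>g. g \<in> sperms E m \<Longrightarrow> fst (e g) permutes {1..n}" "\<And>g. g \<in> sperms E m \<Longrightarrow> admissible_signs T n (snd (e g))"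
    and ind: "AE \<omega> in M. I (\<lambda>i. X i \<omega>)" and R: "AE \<omega> in M. R (\<lambda>i. X i \<omega>)"
    and count: "\<And>v. R v \<Longrightarrow> (\<And>g. g \<in> sperms E m \<Longrightarrow> I (act (e g) v)) \<Longrightarrow>
      real (card {g \<in> sperms E m. Q (act (e g) v)}) = real (card (sperms E m)) * (1 - c)"
  shows "measure M {\<omega> \<in> space M. \<not> Q (\<lambda>i. X i \<omega>)} = c"
proof -
  interpret prob_space M by (rule type_assms_rv[OF ta])
  note act = type_assms_act[OF ta _ adm]
  have "AE \<omega> in M. \<forall>g\<in>sperms E m. I (act (e g) (\<lambda>i. X i \<omega>))"
    by (rule AE_finite_allI[OF finite_sperms[OF E(1)] act(3)[OF I _ _ ind]])
  hence AE: "AE \<omega> in M. real (card {g \<in> sperms E m. Q (act (e g) (\<lambda>i. X i \<omega>))}) = real (card (sperms E m)) * (1 - c)"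
    using R by eventually_elim (rule count, blast+)
  have "prob {\<omega> \<in> space M. Q (\<lambda>i. X i \<omega>)} = 1 - c"
    by (rule prob_by_averaging[OF finite_sperms[OF E(1)] sperms_nonempty[OF E(2)] act(1)[OF Q] act(2)[OF Q] AE])
  thus ?thesis using prob_not[OF tuple_event_law(1)[OF Q type_assms_rv(2)[OF ta]]] by simp
qed

lemma admissible_sperms:
  assumes "g \<in> sperms E n" "T = TypeA \<and> E = {1} \<or> T = TypeB \<and> E = {1, -1}"
  shows "admissible_signs T n (snd g)"
proof -
  have "snd g i \<in> E" if "i \<in> {1..n}" for i by (rule spermsD(2)[OF assms(1) that])
  thus ?thesis using assms(2) by (fastforce simp: admissible_signs_def)
qed

lemma prob_A:
  assumes ta: "type_assms TypeA n d M X" and d: "d > 0"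
  shows "measure M {\<omega> \<in> space M. \<not> zero_in_conv d (hull_pts TypeA X n \<omega>) (hull_idx TypeA n)} = bless 1 (n - 1) d"
proof -
  define N where "N = n - 1"
  have n: "n = Suc N" "d \<le> N" "N > 0" using ta d by (auto simp: type_assms_def N_def)
  have "measure M {\<omega> \<in> space M. \<not> zero_in_conv d (psums (\<lambda>i. X i \<omega>)) {1..N}} = bless 1 N d"
  proof (rule prob_orbit_average[OF ta tuple_event_psums(1) tuple_event_psums(2), where E = "{1}" and m = n and e = "\<lambda>g. g"])
    show "AE \<omega> in M. any_d_indep d (psums (\<lambda>i. X i \<omega>)) {1..N}"
      using ta by (simp add: type_assms_def psum_eq_psums N_def)
    show "AE \<omega> in M. \<forall>j<d. psums (\<lambda>i. X i \<omega>) n j = 0"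
      using ta by (simp add: type_assms_def psum_eq_psums)
    fix v assume "\<forall>j<d. psums v n j = 0" "\<And>g. g \<in> sperms {1} n \<Longrightarrow> any_d_indep d (psums (act g v)) {1..N}"
    thus "real (card {g \<in> sperms {1} n. zero_in_conv d (psums (act g v)) {1..N}}) = real (card (sperms {1} n)) * (1 - bless 1 N d)"
      unfolding psums_act n(1) by (intro count_A n(2,3)) (auto simp: psums_def)
  next
    show "fst g permutes {1..n}" "admissible_signs TypeA n (snd g)" if "g \<in> sperms {1} n" for g
      using spermsD(1)[OF that] admissible_sperms[OF that] by auto
  qed (auto simp: n(1))
  moreover have "hull_pts TypeA X n \<omega> = psums (\<lambda>i. X i \<omega>)" for \<omega>
    by (intro ext) (simp add: hull_pts_def psum_eq_psums)
  ultimately show ?thesis by (simp add: hull_idx_def N_def)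
qed

lemma prob_B:
  assumes ta: "type_assms TypeB n d M X" and d: "d > 0"
  shows "measure M {\<omega> \<in> space M. \<not> zero_in_conv d (hull_pts TypeB X n \<omega>) (hull_idx TypeB n)} = bless 2 n d"
proof -
  have n: "n > 0" "d \<le> n" using ta d by (auto simp: type_assms_def)
  have "measure M {\<omega> \<in> space M. \<not> zero_in_conv d (psums (\<lambda>i. X i \<omega>)) {1..n}} = bless 2 n d"
  proof (rule prob_orbit_average[OF ta tuple_event_psums(1) tuple_event_psums(2), where E = "{1, -1}" and m = n and e = "\<lambda>g. g"
      and R = "\<lambda>v. True"])
    show "AE \<omega> in M. any_d_indep d (psums (\<lambda>i. X i \<omega>)) {1..n}"
      using ta by (simp add: type_assms_def psum_eq_psums)
    fix v assume "\<And>g. g \<in> sperms {1, -1} n \<Longrightarrow> any_d_indep d (psums (act g v)) {1..n}"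
    thus "real (card {g \<in> sperms {1, -1} n. zero_in_conv d (psums (act g v)) {1..n}}) = real (card (sperms {1, -1} n)) * (1 - bless 2 n d)"
      unfolding psums_act by (intro count_B n)
  next
    show "fst g permutes {1..n}" "admissible_signs TypeB n (snd g)" if "g \<in> sperms {1, -1} n" for g
      using spermsD(1)[OF that] admissible_sperms[OF that] by auto
  qed auto
  moreover have "hull_pts TypeB X n \<omega> = psums (\<lambda>i. X i \<omega>)" for \<omega>
    by (intro ext) (simp add: hull_pts_def psum_eq_psums)
  ultimately show ?thesis by (simp add: hull_idx_def)
qed

section \<open>Type D: two type B hulls and their common wall\<close>

definition flip :: "nat \<Rightarrow> (nat \<Rightarrow> nat \<Rightarrow> real) \<Rightarrow> nat \<Rightarrow> nat \<Rightarrow> real" where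
  "flip n v = v(n := \<lambda>j. - v n j)"

definition hullD :: "nat \<Rightarrow> (nat \<Rightarrow> nat \<Rightarrow> real) \<Rightarrow> nat \<Rightarrow> nat \<Rightarrow> real" where
  "hullD n v k = (if k = n + 1 then (\<lambda>j. psums v (n - 1) j - v n j) else psums v k)"

text \<open>\<open>a\<close> and \<open>b\<close> are the weights of the two points \<open>S (m + 1)\<close> and \<open>S\<^sup>*\<close> that only type D has together.\<close>

definition convD :: "nat \<Rightarrow> nat \<Rightarrow> (nat \<Rightarrow> nat \<Rightarrow> real) \<Rightarrow> (nat \<Rightarrow> real) \<Rightarrow> real \<Rightarrow> real \<Rightarrow> bool" where
  "convD d m v w a b \<longleftrightarrow> (\<forall>k\<in>{1..m}. w k \<ge> 0) \<and> a \<ge> 0 \<and> b \<ge> 0 \<and> (\<Sum>k\<in>{1..m}. w k) + a + b = 1 \<and>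
     (\<forall>j<d. (\<Sum>k\<in>{1..m}. w k * psums v k j) + a * (psums v m j + v (Suc m) j) + b * (psums v m j - v (Suc m) j) = 0)"

lemma flip_flip: "flip n (flip n v) = v"
  by (auto simp: flip_def)

lemma psums_flip: "k < n \<Longrightarrow> psums (flip n v) k = psums v k"
  by (intro ext) (auto simp: psums_def flip_def intro!: sum.cong)

lemma psums_Suc: "psums v (Suc m) j = psums v m j + v (Suc m) j"
  by (simp add: psums_def)

lemma zero_in_conv_hullD:
  "zero_in_conv d (hullD (Suc m) v) {1..Suc m + 1} \<longleftrightarrow> (\<exists>w a b. convD d m v w a b)"
proof
  assume "zero_in_conv d (hullD (Suc m) v) {1..Suc m + 1}"
  then obtain w where w: "\<forall>k\<in>{1..Suc m + 1}. w k \<ge> 0" "(\<Sum>k\<in>{1..Suc m + 1}. w k) = 1"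
    "\<forall>j<d. (\<Sum>k\<in>{1..Suc m + 1}. w k * hullD (Suc m) v k j) = 0"
    unfolding zero_in_conv_def by blast
  have s: "(\<Sum>k\<in>{1..m}. w k * hullD (Suc m) v k j) = (\<Sum>k\<in>{1..m}. w k * psums v k j)" for j
    by (intro sum.cong) (auto simp: hullD_def)
  have "convD d m v w (w (Suc m)) (w (Suc (Suc m)))" unfolding convD_def
    using w(1,2) w(3) s by (auto simp: hullD_def psums_Suc)
  thus "\<exists>w a b. convD d m v w a b" by blast
next
  assume "\<exists>w a b. convD d m v w a b"
  then obtain w a b where w: "convD d m v w a b" by blast
  define w' where "w' = (\<lambda>k. if k = Suc m then a else if k = Suc (Suc m) then b else w k)"
  have s: "(\<Sum>k\<in>{1..m}. w' k * hullD (Suc m) v k j) = (\<Sum>k\<in>{1..m}. w k * psums v k j)"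
    "(\<Sum>k\<in>{1..m}. w' k) = (\<Sum>k\<in>{1..m}. w k)" for j
    by (intro sum.cong; simp add: hullD_def w'_def)+
  show "zero_in_conv d (hullD (Suc m) v) {1..Suc m + 1}" unfolding zero_in_conv_def
  proof (intro exI[of _ w'] conjI ballI allI impI)
    show "w' k \<ge> 0" if "k \<in> {1..Suc m + 1}" for k using w that by (auto simp: convD_def w'_def)
    show "(\<Sum>k\<in>{1..Suc m + 1}. w' k) = 1" using w s(2) by (simp add: convD_def w'_def)
    show "(\<Sum>k\<in>{1..Suc m + 1}. w' k * hullD (Suc m) v k j) = 0" if "j < d" for j
      using w s(1)[of j] that by (simp add: convD_def w'_def hullD_def psums_Suc)
  qed
qed

lemma zero_in_conv_last:
  "zero_in_conv d (psums v) {1..Suc m} \<longleftrightarrow> (\<exists>w a. convD d m v w a 0)"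
proof
  assume "zero_in_conv d (psums v) {1..Suc m}"
  then obtain w where "\<forall>k\<in>{1..Suc m}. w k \<ge> 0" "(\<Sum>k\<in>{1..Suc m}. w k) = 1"
    "\<forall>j<d. (\<Sum>k\<in>{1..Suc m}. w k * psums v k j) = 0"
    unfolding zero_in_conv_def by auto
  hence "convD d m v w (w (Suc m)) 0" unfolding convD_def by (auto simp: psums_Suc)
  thus "\<exists>w a. convD d m v w a 0" by blast
next
  assume "\<exists>w a. convD d m v w a 0"
  then obtain w a where w: "convD d m v w a 0" by blast
  have s: "(\<Sum>k\<in>{1..m}. (w(Suc m := a)) k * psums v k j) = (\<Sum>k\<in>{1..m}. w k * psums v k j)"
    "(\<Sum>k\<in>{1..m}. (w(Suc m := a)) k) = (\<Sum>k\<in>{1..m}. w k)" for j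
    by (intro sum.cong; simp)+
  show "zero_in_conv d (psums v) {1..Suc m}" unfolding zero_in_conv_def
  proof (intro exI[of _ "w(Suc m := a)"] conjI ballI allI impI)
    show "(w(Suc m := a)) k \<ge> 0" if "k \<in> {1..Suc m}" for k using w that by (auto simp: convD_def)
    show "(\<Sum>k\<in>{1..Suc m}. (w(Suc m := a)) k) = 1" using w s(2) by (simp add: convD_def)
    show "(\<Sum>k\<in>{1..Suc m}. (w(Suc m := a)) k * psums v k j) = 0" if "j < d" for j
      using w s(1)[of j] that by (simp add: convD_def psums_Suc)
  qed
qed

lemma convD_flip: "convD d m (flip (Suc m) v) w a b = convD d m v w b a"
proof -
  have "(\<Sum>k\<in>{1..m}. w k * psums (flip (Suc m) v) k j) = (\<Sum>k\<in>{1..m}. w k * psums v k j)" for j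
    by (intro sum.cong) (auto simp: psums_flip)
  moreover have "flip (Suc m) v (Suc m) j = - v (Suc m) j" for j by (simp add: flip_def)
  moreover have "psums (flip (Suc m) v) m = psums v m" by (simp add: psums_flip)
  ultimately show ?thesis unfolding convD_def by (auto simp: algebra_simps)
qed

lemma zero_in_conv_wall: "zero_in_conv d (psums v) {1..m} \<longleftrightarrow> (\<exists>w. convD d m v w 0 0)"
  unfolding zero_in_conv_def convD_def by simp

lemma sum_fun_upd_add:
  fixes w f :: "nat \<Rightarrow> real"
  assumes "m > 0"
  shows "(\<Sum>k\<in>{1..m}. (w(m := w m + c)) k * f k) = (\<Sum>k\<in>{1..m}. w k * f k) + c * f m"
proof -
  obtain l where l: "m = Suc l" using assms by (cases m) auto
  have "(\<Sum>k\<in>{1..l}. (w(m := w m + c)) k * f k) = (\<Sum>k\<in>{1..l}. w k * f k)"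
    by (intro sum.cong) (auto simp: l)
  thus ?thesis by (simp add: l algebra_simps)
qed

text \<open>The two extra points have the midpoint \<open>psums v m\<close>, so the common part
  \<open>b\<close> of their weights can be moved there with a factor of two. For
  \<open>m > 0\<close> this midpoint is itself one of the points.\<close>

lemma convD_reduce:
  assumes "m > 0" "convD d m v w a b" "b \<le> a"
  shows "convD d m v (w(m := w m + 2 * b)) (a - b) 0"
proof -
  have s: "(\<Sum>k\<in>{1..m}. (w(m := w m + 2 * b)) k) = (\<Sum>k\<in>{1..m}. w k) + 2 * b"
    using sum_fun_upd_add[OF assms(1), of w "2 * b" "\<lambda>_. 1"] by simp
  have f: "(\<Sum>k\<in>{1..m}. (w(m := w m + 2 * b)) k * psums v k j) = (\<Sum>k\<in>{1..m}. w k * psums v k j) + 2 * b * psums v m j" for j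
    by (rule sum_fun_upd_add[OF assms(1)])
  show ?thesis unfolding convD_def f s using assms(2,3) unfolding convD_def
    by (auto simp: algebra_simps)
qed

lemma zero_in_conv_hullD_iff:
  assumes "m > 0"
  shows "zero_in_conv d (hullD (Suc m) v) {1..Suc m + 1} \<longleftrightarrow>
    zero_in_conv d (psums v) {1..Suc m} \<or> zero_in_conv d (psums (flip (Suc m) v)) {1..Suc m}"
  unfolding zero_in_conv_hullD zero_in_conv_last convD_flip
proof
  assume "\<exists>w a b. convD d m v w a b"
  then obtain w a b where w: "convD d m v w a b" by blast
  show "(\<exists>w a. convD d m v w a 0) \<or> (\<exists>w a. convD d m v w 0 a)"
  proof (cases "b \<le> a")
    case True thus ?thesis using convD_reduce[OF assms w] by blast
  next
    case False
    have "convD d m (flip (Suc m) v) w b a" using w by (simp add: convD_flip)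
    from convD_reduce[OF assms this] False show ?thesis by (auto simp: convD_flip)
  qed
qed blast

text \<open>Take a relation with weight \<open>a\<close> on one extra point and a relation with
  weight \<open>b\<close> on the other. Mixed in the proportion \<open>b\<close> to
  \<open>a\<close>, they give both extra points the same weight, and these merge into the midpoint
  \<open>psums v m\<close>.\<close>

lemma zero_in_conv_wall_iff:
  assumes m: "m > 0"
  shows "zero_in_conv d (psums v) {1..m} \<longleftrightarrow>
    zero_in_conv d (psums v) {1..Suc m} \<and> zero_in_conv d (psums (flip (Suc m) v)) {1..Suc m}"
  unfolding zero_in_conv_last convD_flip zero_in_conv_wall[of d v m]
proof
  assume "(\<exists>w a. convD d m v w a 0) \<and> (\<exists>w a. convD d m v w 0 a)"
  then obtain w a w' b where w: "convD d m v w a 0" "convD d m v w' 0 b" by blast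
  show "\<exists>w. convD d m v w 0 0"
  proof (cases "a = 0 \<or> b = 0")
    case False
    hence ab: "a > 0" "b > 0" using w by (auto simp: convD_def)
    define u where "u = (\<lambda>k. (b * w k + a * w' k) / (a + b))"
    \<comment> \<open>In the mixture each extra point has weight \<open>a * b / (a + b)\<close>;
      both are moved to the midpoint.\<close>
    define c where "c = 2 * a * b / (a + b)"
    have us: "(\<Sum>k\<in>{1..m}. u k * f k) = (b * (\<Sum>k\<in>{1..m}. w k * f k) + a * (\<Sum>k\<in>{1..m}. w' k * f k)) / (a + b)" for f
      by (simp add: u_def sum_divide_distrib sum_distrib_left sum.distrib[symmetric] algebra_simps)
    have "convD d m v (u(m := u m + c)) 0 0" unfolding convD_def
    proof (intro conjI ballI allI impI)
      show "(u(m := u m + c)) k \<ge> 0" if "k \<in> {1..m}" for k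
        using w ab that by (auto simp: convD_def u_def c_def)
      have "(\<Sum>k\<in>{1..m}. (u(m := u m + c)) k * 1) = (\<Sum>k\<in>{1..m}. u k * 1) + c * 1"
        by (rule sum_fun_upd_add[OF m])
      also have "(\<Sum>k\<in>{1..m}. u k * 1) = (b * (\<Sum>k\<in>{1..m}. w k * 1) + a * (\<Sum>k\<in>{1..m}. w' k * 1)) / (a + b)"
        by (rule us)
      also have "(\<Sum>k\<in>{1..m}. w k * 1) = 1 - a" using w(1) by (simp add: convD_def)
      also have "(\<Sum>k\<in>{1..m}. w' k * 1) = 1 - b" using w(2) by (simp add: convD_def)
      also have "(b * (1 - a) + a * (1 - b)) / (a + b) + c * 1 = 1"
        using ab by (simp add: c_def add_divide_distrib[symmetric] algebra_simps)
      finally show "(\<Sum>k\<in>{1..m}. (u(m := u m + c)) k) + 0 + 0 = 1" by simp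
      fix j assume j: "j < d"
      have 1: "(\<Sum>k\<in>{1..m}. w k * psums v k j) = - a * (psums v m j + v (Suc m) j)"
        "(\<Sum>k\<in>{1..m}. w' k * psums v k j) = - b * (psums v m j - v (Suc m) j)"
        using w j by (auto simp: convD_def algebra_simps)
      have "(\<Sum>k\<in>{1..m}. (u(m := u m + c)) k * psums v k j) = (\<Sum>k\<in>{1..m}. u k * psums v k j) + c * psums v m j"
        by (rule sum_fun_upd_add[OF m])
      also have "(\<Sum>k\<in>{1..m}. u k * psums v k j)
        = (b * (\<Sum>k\<in>{1..m}. w k * psums v k j) + a * (\<Sum>k\<in>{1..m}. w' k * psums v k j)) / (a + b)"
        by (rule us)
      also have "\<dots> + c * psums v m j = (b * (- a * (psums v m j + v (Suc m) j)) + a * (- b * (psums v m j - v (Suc m) j))) / (a + b) + c * psums v m j"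
        unfolding 1 ..
      also have "\<dots> = 0" using ab by (simp add: c_def add_divide_distrib[symmetric] algebra_simps)
      finally show "(\<Sum>k\<in>{1..m}. (u(m := u m + c)) k * psums v k j) + 0 * (psums v m j + v (Suc m) j) + 0 * (psums v m j - v (Suc m) j) = 0"
        by simp
    qed (auto)
    thus ?thesis by blast
  qed (use w in blast)
qed blast

lemma any_d_indep_subset: "any_d_indep d v I \<Longrightarrow> J \<subseteq> I \<Longrightarrow> any_d_indep d v J"
  unfolding any_d_indep_def by blast

definition flipg :: "nat \<Rightarrow> (nat \<Rightarrow> nat) \<times> (nat \<Rightarrow> real) \<Rightarrow> (nat \<Rightarrow> nat) \<times> (nat \<Rightarrow> real)" where
  "flipg n g = (fst g, (snd g)(n := - snd g n))"

lemma flipg_flipg: "flipg n (flipg n g) = g"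
  by (simp add: flipg_def)

lemma act_flipg: "act (flipg n g) v = flip n (act g v)"
  by (intro ext) (simp add: act_def flipg_def flip_def)

lemma flipg_sperms:
  assumes "n > 0" "g \<in> sperms {1, -1} n"
  shows "flipg n g \<in> sperms {1, -1} n"
proof -
  have "snd g \<in> {1..n} \<rightarrow>\<^sub>E {1, -1}" using assms(2) by (auto simp: sperms_def)
  moreover have "- snd g n \<in> {1, -1}" using spermsD(2)[OF assms(2), of n] assms(1) by auto
  ultimately have "(snd g)(n := - snd g n) \<in> {1..n} \<rightarrow>\<^sub>E {1, -1}"
    using assms(1) by (auto simp: PiE_iff extensional_def)
  thus ?thesis using spermsD(1)[OF assms(2)] by (simp add: flipg_def sperms_def)
qed

lemma prod_signs:
  fixes f :: "nat \<Rightarrow> real"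
  assumes "\<And>i. i \<in> {1..m} \<Longrightarrow> f i = 1 \<or> f i = -1"
  shows "(\<Prod>i\<in>{1..m}. f i) = 1 \<or> (\<Prod>i\<in>{1..m}. f i) = -1"
  using assms
proof (induction m)
  case (Suc m)
  have "(\<Prod>i\<in>{1..m}. f i) = 1 \<or> (\<Prod>i\<in>{1..m}. f i) = -1" using Suc by auto
  moreover have "f (Suc m) = 1 \<or> f (Suc m) = -1" using Suc.prems[of "Suc m"] by simp
  ultimately show ?case by auto
qed simp

text \<open>Reversing the last sign changes the parity, so it represents the nontrivial coset of the
  type D group in the type B group.\<close>

lemma admissible_D_cases:
  assumes g: "g \<in> sperms {1, -1} (Suc m)"
  shows "admissible_signs TypeD (Suc m) (snd g) \<or> admissible_signs TypeD (Suc m) (snd (flipg (Suc m) g))"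
proof -
  have g': "flipg (Suc m) g \<in> sperms {1, -1} (Suc m)" using g by (intro flipg_sperms) auto
  have s: "snd h i = 1 \<or> snd h i = -1" if "h \<in> sperms {1, -1} (Suc m)" "i \<in> {1..Suc m}" for h i
    using spermsD(2)[OF that] by auto
  have "(\<Prod>i\<in>{1..m}. snd (flipg (Suc m) g) i) = (\<Prod>i\<in>{1..m}. snd g i)"
    by (intro prod.cong) (auto simp: flipg_def)
  hence "(\<Prod>i\<in>{1..Suc m}. snd (flipg (Suc m) g) i) = - (\<Prod>i\<in>{1..Suc m}. snd g i)"
    by (simp add: flipg_def)
  moreover have "(\<Prod>i\<in>{1..Suc m}. snd g i) = 1 \<or> (\<Prod>i\<in>{1..Suc m}. snd g i) = -1"
    using s[OF g] by (rule prod_signs)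
  ultimately have "(\<Prod>i\<in>{1..Suc m}. snd g i) = 1 \<or> (\<Prod>i\<in>{1..Suc m}. snd (flipg (Suc m) g) i) = 1"
    by linarith
  thus ?thesis unfolding admissible_signs_def using s[OF g] s[OF g'] by fastforce
qed

lemma tuple_event_hullD:
  "tuple_event (Suc m) d (\<lambda>v. zero_in_conv d (hullD (Suc m) v) {1..Suc m + 1})"
proof (rule tuple_event_zero_in_conv[where
    A = "\<lambda>k i. if k = Suc m + 1 then (if i = Suc m then -1 else 1) else of_bool (i \<le> k)"])
  fix v k j assume k: "k \<in> {1..Suc m + 1}"
  show "hullD (Suc m) v k j
      = lin_comb (Suc m) (\<lambda>k i. if k = Suc m + 1 then (if i = Suc m then -1 else 1) else of_bool (i \<le> k)) v k j"
  proof (cases "k = Suc m + 1")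
    case True
    have "(\<Sum>i\<in>{1..m}. v i j) = (\<Sum>i\<in>{1..m}. (if i = Suc m then -1 else 1) * v i j)"
      by (intro sum.cong) auto
    thus ?thesis using True by (simp add: hullD_def lin_comb_def psums_def)
  next
    case False
    thus ?thesis using psums_lin_comb[of k "Suc m" v j] k by (simp add: hullD_def lin_comb_def)
  qed
qed simp

lemma tuple_event_flip:
  "tuple_event (Suc m) d (\<lambda>v. any_d_indep d (psums (flip (Suc m) v)) {1..Suc m})"
proof (rule tuple_event_any_d_indep[where A = "\<lambda>k i. of_bool (i \<le> k) * (if i = Suc m then -1 else 1)"])
  fix v k j assume k: "k \<in> {1..Suc m}"
  have "psums (flip (Suc m) v) k j = lin_comb (Suc m) (\<lambda>k i. of_bool (i \<le> k)) (flip (Suc m) v) k j"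
    using k by (intro psums_lin_comb) auto
  also have "\<dots> = lin_comb (Suc m) (\<lambda>k i. of_bool (i \<le> k) * (if i = Suc m then -1 else 1)) v k j"
    unfolding lin_comb_def by (intro sum.cong) (auto simp: flip_def)
  finally show "psums (flip (Suc m) v) k j = lin_comb (Suc m) (\<lambda>k i. of_bool (i \<le> k) * (if i = Suc m then -1 else 1)) v k j" .
qed simp

lemma prob_wall_D:
  assumes ta: "type_assms TypeD (Suc m) d M X" and d: "d > 0" and m: "m > 0"
    and ind0: "AE \<omega> in M. any_d_indep d (psums (\<lambda>i. X i \<omega>)) {1..Suc m}"
  shows "measure M {\<omega> \<in> space M. \<not> zero_in_conv d (psums (\<lambda>i. X i \<omega>)) {1..m}} = bless 2 m d"
proof -
  interpret prob_space M by (rule type_assms_rv[OF ta])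
  have evz: "tuple_event (Suc m) d (\<lambda>v. zero_in_conv d (psums v) {1..m})" by (rule tuple_event_psums) simp
  have evi: "tuple_event (Suc m) d (\<lambda>v. any_d_indep d (psums v) {1..Suc m})" by (rule tuple_event_psums) simp
  note ev = tuple_event_law(1)[OF evz type_assms_rv(2)[OF ta]]
  have "d \<le> Suc m" using ta by (simp add: type_assms_def)
  then consider "d = Suc m" | "d \<le> m" by linarith
  thus ?thesis
  proof cases
    case 1
    \<comment> \<open>Here the \<open>m\<close> partial sums are part of an independent family of
      \<open>d\<close> vectors and admit no relation, in agreement with
      \<open>bless 2 m d = 1\<close>.\<close>
    have "AE \<omega> in M. \<not> zero_in_conv d (psums (\<lambda>i. X i \<omega>)) {1..m}"
      using ind0
    proof eventually_elim
      case (elim \<omega>)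
      let ?p = "psums (\<lambda>i. X i \<omega>)"
      show ?case
      proof
        assume "zero_in_conv d ?p {1..m}"
        then obtain w where w: "(\<Sum>k\<in>{1..m}. w k) = 1" "\<forall>j<d. (\<Sum>k\<in>{1..m}. w k * ?p k j) = 0"
          unfolding zero_in_conv_def by blast
        define w' where "w' = w(Suc m := 0)"
        have s: "(\<Sum>k\<in>{1..m}. w' k * ?p k j) = (\<Sum>k\<in>{1..m}. w k * ?p k j)" for j
          by (intro sum.cong) (auto simp: w'_def)
        have "lin_indep_fam d ?p {1..Suc m}" using elim 1 by (simp add: any_d_indep_def)
        moreover have "\<forall>j<d. (\<Sum>k\<in>{1..Suc m}. w' k * ?p k j) = 0"
          using w(2) s by (simp add: w'_def)
        ultimately have "\<forall>k\<in>{1..Suc m}. w' k = 0"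
          unfolding lin_indep_fam_def by (elim allE[of _ w']) (rule mp)
        hence "(\<Sum>k\<in>{1..m}. w k) = 0" by (intro sum.neutral) (force simp: w'_def)
        thus False using w(1) by simp
      qed
    qed
    hence "prob {\<omega> \<in> space M. zero_in_conv d (psums (\<lambda>i. X i \<omega>)) {1..m}} = 0"
      using prob_eq_0[OF ev] by (auto elim: AE_mp)
    thus ?thesis using 1 m prob_not[OF ev] by (simp add: bless_ge)
  next
    case 2
    \<comment> \<open>The sign of the last step does not affect the first \<open>m\<close> partial sums and can repair the parity.\<close>
    define ext where "ext = (\<lambda>g :: (nat \<Rightarrow> nat) \<times> (nat \<Rightarrow> real). (fst g, (snd g)(Suc m := \<Prod>i\<in>{1..m}. snd g i)))"
    have adm: "fst (ext g) permutes {1..Suc m}" "admissible_signs TypeD (Suc m) (snd (ext g))"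
      if g: "g \<in> sperms {1, -1} m" for g
    proof -
      show "fst (ext g) permutes {1..Suc m}"
        using permutes_subset[OF spermsD(1)[OF g], of "{1..Suc m}"] by (simp add: ext_def)
      have s: "snd g i = 1 \<or> snd g i = -1" if "i \<in> {1..m}" for i using spermsD(2)[OF g that] by auto
      have p: "(\<Prod>i\<in>{1..m}. snd g i) = 1 \<or> (\<Prod>i\<in>{1..m}. snd g i) = -1" using s by (rule prod_signs)
      have "(\<Prod>i\<in>{1..m}. snd (ext g) i) = (\<Prod>i\<in>{1..m}. snd g i)"
        by (intro prod.cong) (auto simp: ext_def)
      hence "(\<Prod>i\<in>{1..Suc m}. snd (ext g) i) = 1" using p by (auto simp: ext_def)
      moreover have "snd (ext g) i \<in> {-1, 1}" if "i \<in> {1..Suc m}" for i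
        using s[of i] p that by (cases "i = Suc m") (auto simp: ext_def)
      ultimately show "admissible_signs TypeD (Suc m) (snd (ext g))" by (simp add: admissible_signs_def)
    qed
    have psums_ext: "psums (act (ext g) v) k = psums (act g v) k" if "k \<le> m" for g v k
      using that by (intro ext) (auto simp: psums_def act_def ext_def intro!: sum.cong)
    have zic_ext: "zero_in_conv d (psums (act (ext g) v)) {1..m} = zero_in_conv d (psums (act g v)) {1..m}" for g v
      using psums_ext by (intro zero_in_conv_cong) auto
    show ?thesis
    proof (rule prob_orbit_average[OF ta evz evi _ _ adm ind0, where R = "\<lambda>v. True"])
      fix v assume h: "\<And>g. g \<in> sperms {1, -1} m \<Longrightarrow> any_d_indep d (psums (act (ext g) v)) {1..Suc m}"
      show "real (card {g \<in> sperms {1, -1} m. zero_in_conv d (psums (act (ext g) v)) {1..m}}) = real (card (sperms {1, -1} m)) * (1 - bless 2 m d)"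
        unfolding zic_ext unfolding psums_act
      proof (rule count_B[OF m 2])
        fix g assume "g \<in> sperms {1, -1} m"
        hence "any_d_indep d (psums (act (ext g) v)) {1..m}" by (intro any_d_indep_subset[OF h]) auto
        thus "any_d_indep d (signed_sum (snd g) (fst g) v) {1..m}"
          unfolding psums_act[symmetric] using psums_ext by (subst any_d_indep_cong) auto
      qed
    qed auto
  qed
qed

lemma prob_D:
  assumes ta: "type_assms TypeD n d M X" and d: "d > 0"
  shows "measure M {\<omega> \<in> space M. \<not> zero_in_conv d (hull_pts TypeD X n \<omega>) (hull_idx TypeD n)}
    = 2 * bless 2 n d - bless 2 (n - 1) d"
proof -
  interpret prob_space M by (rule type_assms_rv[OF ta])
  define m where "m = n - 1"
  have n: "n = Suc m" "m > 0" "d \<le> Suc m" using ta by (auto simp: type_assms_def m_def)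
  let ?v = "\<lambda>\<omega> i. X i \<omega>"
  let ?G = "sperms {1, -1} (Suc m)"
  let ?PD = "\<lambda>v. zero_in_conv d (hullD (Suc m) v) {1..Suc m + 1}"
  let ?W = "\<lambda>v. zero_in_conv d (psums v) {1..m}"
  let ?B = "\<lambda>v. zero_in_conv d (psums v) {1..Suc m}"
  let ?I = "\<lambda>v. any_d_indep d (psums v) {1..Suc m}"
  have ta': "type_assms TypeD (Suc m) d M X" using ta n by simp
  have finG: "finite ?G" by (simp add: finite_sperms)
  have evPD: "tuple_event (Suc m) d ?PD" by (rule tuple_event_hullD)
  have evW: "tuple_event (Suc m) d ?W" by (rule tuple_event_psums) simp
  have evI: "tuple_event (Suc m) d ?I" by (rule tuple_event_psums) simp
  have evF: "tuple_event (Suc m) d (\<lambda>v. ?I (flip (Suc m) v))" by (rule tuple_event_flip)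
  have ind0: "AE \<omega> in M. ?I (?v \<omega>)"
    using ta' by (simp add: type_assms_def psum_eq_psums)
  have ind1: "AE \<omega> in M. any_d_indep d (\<lambda>k. if k = Suc m then psum_star X (Suc m) \<omega> else psum X k \<omega>) {1..Suc m}"
    using ta' by (simp add: type_assms_def)
  have ind1': "AE \<omega> in M. ?I (flip (Suc m) (?v \<omega>))"
    using ind1
  proof eventually_elim
    case (elim \<omega>)
    have "psums (flip (Suc m) (?v \<omega>)) k j = (if k = Suc m then psum_star X (Suc m) \<omega> else psum X k \<omega>) j"
      if "k \<in> {1..Suc m}" for k j
    proof (cases "k = Suc m")
      case True
      have "psums (flip (Suc m) (?v \<omega>)) m = psums (?v \<omega>) m" by (rule psums_flip) simp
      thus ?thesis using True by (simp add: psums_Suc psum_star_def psum_eq_psums flip_def)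
    next
      case False thus ?thesis using that by (simp add: psums_flip psum_eq_psums)
    qed
    thus ?case using elim by (subst any_d_indep_cong) auto
  qed
  have PDflip: "?PD (flip (Suc m) v) = ?PD v" for v
    unfolding zero_in_conv_hullD_iff[OF n(2)] flip_flip by blast
  have Wflip: "?W (flip (Suc m) v) = ?W v" for v
    unfolding zero_in_conv_wall_iff[OF n(2)] flip_flip by blast
  \<comment> \<open>The average runs over the type B group, although the law is only invariant under
    type D. Every element is admissible up to a flip of the last step, and the hull and wall events
    do not change under that flip.\<close>
  have red: "\<exists>g'. fst g' permutes {1..Suc m} \<and> admissible_signs TypeD (Suc m) (snd g') \<and>
      (\<forall>v. act g v = act g' v \<or> act g v = flip (Suc m) (act g' v)) \<and> (g' = g \<or> g = flipg (Suc m) g')"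
    if g: "g \<in> ?G" for g
  proof -
    have "fst (flipg (Suc m) g) permutes {1..Suc m}" using spermsD(1)[OF g] by (simp add: flipg_def)
    moreover have "act g v = flip (Suc m) (act (flipg (Suc m) g) v)" for v
      by (simp add: act_flipg flip_flip)
    ultimately show ?thesis using admissible_D_cases[OF g] spermsD(1)[OF g] flipg_flipg[of "Suc m" g] by metis
  qed
  have inv: "{\<omega> \<in> space M. Q (act g (?v \<omega>))} \<in> events \<and>
       prob {\<omega> \<in> space M. Q (act g (?v \<omega>))} = prob {\<omega> \<in> space M. Q (?v \<omega>)}"
    if g: "g \<in> ?G" and Q: "tuple_event (Suc m) d Q" "\<And>v. Q (flip (Suc m) v) = Q v" for g Q
  proof -
    obtain g' where g': "fst g' permutes {1..Suc m}" "admissible_signs TypeD (Suc m) (snd g')"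
      "\<And>v. act g v = act g' v \<or> act g v = flip (Suc m) (act g' v)" using red[OF g] by blast
    have e: "Q (act g v) = Q (act g' v)" for v using g'(3)[of v] Q(2)[of "act g' v"] by (elim disjE) simp_all
    show ?thesis unfolding e by (intro conjI type_assms_act(1,2)[OF ta' Q(1) g'(1,2)])
  qed
  \<comment> \<open>Independence itself is not symmetric under the flip; for elements of the wrong
    parity it comes from the second family, the one containing \<open>psum_star\<close>.\<close>
  have ind: "AE \<omega> in M. \<forall>g\<in>?G. ?I (act g (?v \<omega>))"
  proof (rule AE_finite_allI[OF finG])
    fix g assume g: "g \<in> ?G"
    obtain g' where g': "fst g' permutes {1..Suc m}" "admissible_signs TypeD (Suc m) (snd g')"
      "g' = g \<or> g = flipg (Suc m) g'" using red[OF g] by blast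
    show "AE \<omega> in M. ?I (act g (?v \<omega>))"
      using g'(3) type_assms_act(3)[OF ta' evI g'(1,2) ind0] type_assms_act(3)[OF ta' evF g'(1,2) ind1']
      by (auto simp: act_flipg)
  qed
  let ?c = "real (card ?G) * (1 - bless 2 (Suc m) d)"
  \<comment> \<open>Inclusion and exclusion: the flip matches the two type B events, their union is
    the type D event and their intersection is the wall event. Only the sum of the two counts is
    found here; the probability of the wall event is supplied separately.\<close>
  have count: "AE \<omega> in M. real (card {g \<in> ?G. ?PD (act g (?v \<omega>))}) + real (card {g \<in> ?G. ?W (act g (?v \<omega>))}) = 2 * ?c"
    using ind
  proof eventually_elim
    case (elim \<omega>)
    define A where "A = {g \<in> ?G. ?B (act g (?v \<omega>))}"
    define A' where "A' = {g \<in> ?G. ?B (flip (Suc m) (act g (?v \<omega>)))}"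
    have cA: "real (card A) = ?c" unfolding A_def psums_act
      by (rule count_B) (use elim n in \<open>auto simp: psums_act\<close>)
    have "bij_betw (flipg (Suc m)) A A'"
      by (rule bij_betw_byWitness[where f' = "flipg (Suc m)"])
         (auto simp: A_def A'_def flipg_flipg flip_flip act_flipg flipg_sperms)
    hence cA': "card A' = card A" by (rule bij_betw_same_card[symmetric])
    have PD: "{g \<in> ?G. ?PD (act g (?v \<omega>))} = A \<union> A'"
      unfolding zero_in_conv_hullD_iff[OF n(2)] A_def A'_def by blast
    have W: "{g \<in> ?G. ?W (act g (?v \<omega>))} = A \<inter> A'"
      using zero_in_conv_wall_iff[OF n(2)] unfolding A_def A'_def by blast
    have "card A + card A' = card (A \<union> A') + card (A \<inter> A')"
      using finG by (intro card_Un_Int) (auto simp: A_def A'_def)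
    thus ?case unfolding PD W using cA cA' by linarith
  qed
  define p where "p = prob {\<omega> \<in> space M. ?PD (?v \<omega>)}"
  define w where "w = prob {\<omega> \<in> space M. ?W (?v \<omega>)}"
  have invPD: "{\<omega> \<in> space M. ?PD (act g (?v \<omega>))} \<in> events" "prob {\<omega> \<in> space M. ?PD (act g (?v \<omega>))} = p"
    if "g \<in> ?G" for g using inv[OF that evPD PDflip] unfolding p_def by blast+
  have invW: "{\<omega> \<in> space M. ?W (act g (?v \<omega>))} \<in> events" "prob {\<omega> \<in> space M. ?W (act g (?v \<omega>))} = w"
    if "g \<in> ?G" for g using inv[OF that evW Wflip] unfolding w_def by blast+
  have sPD: "(\<Sum>g\<in>?G. prob {\<omega> \<in> space M. ?PD (act g (?v \<omega>))})
      = expectation (\<lambda>\<omega>. real (card {g \<in> ?G. ?PD (act g (?v \<omega>))}))"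
    "integrable M (\<lambda>\<omega>. real (card {g \<in> ?G. ?PD (act g (?v \<omega>))}))"
    by (rule sum_prob_eq_expectation_card[OF finG invPD(1)], assumption)+
  have sW: "(\<Sum>g\<in>?G. prob {\<omega> \<in> space M. ?W (act g (?v \<omega>))})
      = expectation (\<lambda>\<omega>. real (card {g \<in> ?G. ?W (act g (?v \<omega>))}))"
    "integrable M (\<lambda>\<omega>. real (card {g \<in> ?G. ?W (act g (?v \<omega>))}))"
    by (rule sum_prob_eq_expectation_card[OF finG invW(1)], assumption)+
  have "real (card ?G) * p + real (card ?G) * w = (\<Sum>g\<in>?G. prob {\<omega> \<in> space M. ?PD (act g (?v \<omega>))}) + (\<Sum>g\<in>?G. prob {\<omega> \<in> space M. ?W (act g (?v \<omega>))})"
    using invPD(2) invW(2) by simp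
  also have "\<dots> = expectation (\<lambda>\<omega>. real (card {g \<in> ?G. ?PD (act g (?v \<omega>))}) + real (card {g \<in> ?G. ?W (act g (?v \<omega>))}))"
    unfolding sPD(1) sW(1) using sPD(2) sW(2) by (rule Bochner_Integration.integral_add[symmetric])
  also have "\<dots> = expectation (\<lambda>_. 2 * ?c)"
    using sPD(2) sW(2) count by (intro integral_cong_AE) auto
  also have "\<dots> = 2 * ?c" by (simp add: prob_space)
  finally have "real (card ?G) * (p + w) = real (card ?G) * (2 * (1 - bless 2 (Suc m) d))" by (simp add: algebra_simps)
  moreover have "card ?G \<noteq> 0" using finG by (simp add: sperms_nonempty)
  ultimately have "p + w = 2 * (1 - bless 2 (Suc m) d)" by simp
  moreover have "w = 1 - bless 2 m d"
    using prob_wall_D[OF ta' d n(2) ind0] prob_not[OF tuple_event_law(1)[OF evW type_assms_rv(2)[OF ta']]]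
    by (simp add: w_def)
  moreover have "hull_pts TypeD X n \<omega> = hullD (Suc m) (?v \<omega>)" for \<omega>
    by (intro ext) (simp add: hull_pts_def psum_star_def hullD_def psum_eq_psums n)
  moreover have "hull_idx TypeD n = {1..Suc m + 1}" by (simp add: hull_idx_def n)
  ultimately show ?thesis
    using prob_not[OF tuple_event_law(1)[OF evPD type_assms_rv(2)[OF ta']]] by (simp add: p_def n)
qed

section \<open>Asymptotics and conclusion\<close>

lemma bless_limit_shift:
  assumes q: "q = 1 \<or> q = 2"
    and d: "(\<lambda>n. (real (d n) - ln (real n) / real q) / sqrt (ln (real n) / real q)) \<longlonglongrightarrow> a"
  shows "(\<lambda>n. bless q (n - 1) (d n)) \<longlonglongrightarrow> (LBINT t:{..a}. std_normal_density t)"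
proof -
  define lam where "lam = (\<lambda>n. ln (real n) / real q)"
  have q0: "real q > 0" using q by auto
  have d': "(\<lambda>N. (real (d (Suc N)) - lam (Suc N)) / sqrt (lam (Suc N))) \<longlonglongrightarrow> a"
    using LIMSEQ_Suc[OF d] by (simp add: lam_def)
  \<comment> \<open>Normalising at \<open>Suc N\<close> or at \<open>N\<close> makes no difference
    in the limit: the scales have ratio tending to one, and the centres differ by less than the
    order of the scale.\<close>
  have r: "(\<lambda>N. sqrt (lam (Suc N)) / sqrt (lam N)) \<longlonglongrightarrow> 1"
    using q0 unfolding lam_def by real_asymp
  have s: "(\<lambda>N. (lam (Suc N) - lam N) / sqrt (lam N)) \<longlonglongrightarrow> 0"
    using q0 unfolding lam_def by real_asymp
  have "(\<lambda>N. (real (d (Suc N)) - lam (Suc N)) / sqrt (lam (Suc N)) * (sqrt (lam (Suc N)) / sqrt (lam N))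
      + (lam (Suc N) - lam N) / sqrt (lam N)) \<longlonglongrightarrow> a * 1 + 0"
    by (intro tendsto_intros d' r s)
  moreover have "\<forall>\<^sub>F N in sequentially. (real (d (Suc N)) - lam (Suc N)) / sqrt (lam (Suc N)) * (sqrt (lam (Suc N)) / sqrt (lam N))
      + (lam (Suc N) - lam N) / sqrt (lam N) = (real (d (Suc N)) - lam N) / sqrt (lam N)"
    using eventually_gt_at_top[of 1]
  proof eventually_elim
    case (elim N)
    have "lam (Suc N) > 0" using elim q0 by (simp add: lam_def)
    thus ?case by (simp add: add_divide_distrib[symmetric])
  qed
  ultimately have "(\<lambda>N. (real (d (Suc N)) - lam N) / sqrt (lam N)) \<longlonglongrightarrow> a * 1 + 0"
    by (rule Lim_transform_eventually)
  hence "(\<lambda>N. bless q N (d (Suc N))) \<longlonglongrightarrow> (LBINT t:{..a}. std_normal_density t)"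
    by (intro bless_limit[OF q]) (simp add: lam_def)
  hence "(\<lambda>n. bless q (Suc n - 1) (d (Suc n))) \<longlonglongrightarrow> (LBINT t:{..a}. std_normal_density t)" by simp
  thus ?thesis by (rule LIMSEQ_imp_Suc)
qed

lemma normalized_dimension_limit:
  assumes "(\<lambda>n. real (d n) - u * ln (real n) - a * sqrt (u * ln (real n))) \<in> o(\<lambda>n. sqrt (ln (real n)))" and u: "u > 0"
  shows "(\<lambda>n. (real (d n) - u * ln (real n)) / sqrt (u * ln (real n))) \<longlonglongrightarrow> a"
proof -
  have "(\<lambda>n. (real (d n) - u * ln (real n) - a * sqrt (u * ln (real n))) / sqrt (ln (real n))) \<longlonglongrightarrow> 0"
    using smalloD_tendsto[OF assms(1)] .
  hence "(\<lambda>n. (real (d n) - u * ln (real n) - a * sqrt (u * ln (real n))) / sqrt (ln (real n)) * (1 / sqrt u) + a) \<longlonglongrightarrow> 0 * (1 / sqrt u) + a"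
    by (intro tendsto_intros)
  moreover have "\<forall>\<^sub>F n in sequentially. (real (d n) - u * ln (real n) - a * sqrt (u * ln (real n))) / sqrt (ln (real n)) * (1 / sqrt u) + a
      = (real (d n) - u * ln (real n)) / sqrt (u * ln (real n))"
    using eventually_gt_at_top[of 1]
  proof eventually_elim
    case (elim n)
    define c where "c = sqrt (u * ln (real n))"
    have "c > 0" using elim u by (simp add: c_def)
    moreover have "sqrt (ln (real n)) * sqrt u = c" by (simp add: c_def real_sqrt_mult)
    ultimately show ?case unfolding c_def[symmetric] by (simp add: diff_divide_distrib)
  qed
  ultimately have "(\<lambda>n. (real (d n) - u * ln (real n)) / sqrt (u * ln (real n))) \<longlonglongrightarrow> 0 * (1 / sqrt u) + a"
    by (rule Lim_transform_eventually)
  thus ?thesis by simp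
qed

theorem theorem5p2:
  fixes T :: refl_type and d :: "nat \<Rightarrow> nat" and a :: real
    and M :: "nat \<Rightarrow> 'a measure" and \<xi> :: "nat \<Rightarrow> nat \<Rightarrow> 'a \<Rightarrow> nat \<Rightarrow> real"
  assumes "\<forall>n. d n > 0"
    and "(\<lambda>n. real (d n) - u_const T * ln (real n) - a * sqrt (u_const T * ln (real n)))
           \<in> o(\<lambda>n. sqrt (ln (real n)))"
    and "eventually (\<lambda>n. type_assms T n (d n) (M n) (\<xi> n)) sequentially"
  shows "(\<lambda>n. measure (M n) {\<omega> \<in> space (M n).
            \<not> zero_in_conv (d n) (hull_pts T (\<xi> n) n \<omega>) (hull_idx T n)})
         \<longlonglongrightarrow> (LBINT t:{..a}. std_normal_density t)"
proof -
  let ?\<Phi> = "LBINT t:{..a}. std_normal_density t"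
  let ?P = "\<lambda>n. measure (M n) {\<omega> \<in> space (M n). \<not> zero_in_conv (d n) (hull_pts T (\<xi> n) n \<omega>) (hull_idx T n)}"
  have "u_const T > 0" by (simp add: u_const_def)
  note lim = normalized_dimension_limit[OF assms(2) this]
  show ?thesis
  proof (cases T)
    case TypeA
    have "(\<lambda>n. (real (d n) - ln (real n) / real 1) / sqrt (ln (real n) / real 1)) \<longlonglongrightarrow> a"
      using lim by (simp add: TypeA u_const_def)
    hence "(\<lambda>n. bless 1 (n - 1) (d n)) \<longlonglongrightarrow> ?\<Phi>" by (intro bless_limit_shift) auto
    moreover have "\<forall>\<^sub>F n in sequentially. bless 1 (n - 1) (d n) = ?P n"
      using assms(3)
    proof eventually_elim
      case (elim n)
      show ?case unfolding TypeA by (rule prob_A[symmetric]) (use elim assms(1) TypeA in simp_all)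
    qed
    ultimately show ?thesis by (rule Lim_transform_eventually)
  next
    case TypeB
    have "(\<lambda>n. (real (d n) - ln (real n) / real 2) / sqrt (ln (real n) / real 2)) \<longlonglongrightarrow> a"
      using lim by (simp add: TypeB u_const_def)
    hence "(\<lambda>n. bless 2 n (d n)) \<longlonglongrightarrow> ?\<Phi>" by (intro bless_limit) auto
    moreover have "\<forall>\<^sub>F n in sequentially. bless 2 n (d n) = ?P n"
      using assms(3)
    proof eventually_elim
      case (elim n)
      show ?case unfolding TypeB by (rule prob_B[symmetric]) (use elim assms(1) TypeB in simp_all)
    qed
    ultimately show ?thesis by (rule Lim_transform_eventually)
  next
    case TypeD
    have l: "(\<lambda>n. (real (d n) - ln (real n) / real 2) / sqrt (ln (real n) / real 2)) \<longlonglongrightarrow> a"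
      using lim by (simp add: TypeD u_const_def)
    have "(\<lambda>n. bless 2 n (d n)) \<longlonglongrightarrow> ?\<Phi>" using l by (intro bless_limit) auto
    moreover have "(\<lambda>n. bless 2 (n - 1) (d n)) \<longlonglongrightarrow> ?\<Phi>" using l by (intro bless_limit_shift) auto
    ultimately have "(\<lambda>n. 2 * bless 2 n (d n) - bless 2 (n - 1) (d n)) \<longlonglongrightarrow> 2 * ?\<Phi> - ?\<Phi>"
      by (intro tendsto_intros)
    hence "(\<lambda>n. 2 * bless 2 n (d n) - bless 2 (n - 1) (d n)) \<longlonglongrightarrow> ?\<Phi>" by simp
    moreover have "\<forall>\<^sub>F n in sequentially. 2 * bless 2 n (d n) - bless 2 (n - 1) (d n) = ?P n"
      using assms(3)
    proof eventually_elim
      case (elim n)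
      show ?case unfolding TypeD by (rule prob_D[symmetric]) (use elim assms(1) TypeD in simp_all)
    qed
    ultimately show ?thesis by (rule Lim_transform_eventually)
  qed
qed

end
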